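(* Let $n\ge 2$. The group $\mathrm{Aut}(X_n^{\mathbb Z},\sigma_n)$ is isomorphic to $\mathbb Z\times\mathcal L_n$ if and only if $n$ is not a power of a smaller integer.
   Context: **Shift.** $X_n=\{0,1,\dots,n-1\}$; $X_n^{\mathbb Z}$ has the product topology; $\sigma_n$ sends $x$ to $y$ with $y_i=x_{i-1}$. $\mathrm{Aut}(X_n^{\mathbb Z},\sigma_n)$ is the group (under composition) of homeomorphisms of $X_n^{\mathbb Z}$ commuting with $\sigma_n$. **Transducers.** $X_n^*$ is the set of finite words ($\varepsilon$ the empty word), $X_n^+=X_n^*\setminus\{\varepsilon\}$, $X_n^{\mathbb N}$ the set of right-infinite words, $|w|$ the length of $w$. A transducer is $T=(X_n,Q_T,\pi_T,\lambda_T)$ with $Q_T$ a finite nonempty set of states, $\pi_T:X_n\times Q_T\to Q_T$, $\lambda_T:X_n\times Q_T\to X_n^*$, extended to words by $\pi_T(\varepsilon,q)=q$, $\lambda_T(\varepsilon,q)=\varepsilon$, $\pi_T(wx,q)=\pi_T(x,\pi_T(w,q))$, $\lambda_T(wx,q)=\lambda_T(w,q)\lambda_T(x,\pi_T(w,q))$, and $\lambda_T$ extended to infinite words. Always assumed: if $w\in X_n^+$ and $\pi_T(w,q)=q$ then $\lambda_T(w,q)\ne\varepsilon$. Each state $q$ induces a continuous map $h_q:X_n^{\mathbb N}\to X_n^{\mathbb N}$, $w\mapsto\lambda_T(w,q)$. States $p,q$ (possibly of different transducers) are $\omega$-equivalent if $h_p=h_q$; $T$ is weakly minimal if distinct states are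 never $\omega$-equivalent. $\Lambda(w,q)$ is the greatest common prefix of $\{\lambda_T(wx,q):x\in X_n^{\mathbb N}\}$; $|\Lambda(\varepsilon,q)|\in\mathbb N\cup\{\infty\}$ is the extent of incomplete response of $q$, and $q$ is a state of incomplete response if $\Lambda(\varepsilon,q)\neq\varepsilon$. $T$ is strongly synchronizing if for some $k\ge 0$ (a synchronizing level), for each $w\in X_n^k$ the state $\pi_T(w,q)$ is independent of $q$; it is then called the state forced by $w$. The states forced by words of length $k$ form a subtransducer $\mathrm{core}(T)$; $T$ is core if $T=\mathrm{core}(T)$. For $x\in X_n^+$, $Z_x$ is the one-state transducer with output $x$ on every letter. A transducer is called minimal if either it is weakly minimal, strongly connected and has no states of incomplete response, or it is $Z_x$ with $x$ a prime word (not a proper power of a shorter word) lexicographically least among its rotations. Transducers are considered equal if there is a bijection of state sets matching $\omega$-equivalent states. **Reduction.** For a strongly synchronizing core transducer $C$ define a minimal transducer $[C]$: if some (equivalently every) state has infinite extent of incomplete response, each state of $C$ is $\omega$-equivalent to the state of some $Z_x$ with $x$ prime (unique up to rotation) and $[C]:=Z_{\bar x}$ with $\bar x$ the lexicographically least rotation of $x$; otherwise keep states and transitions, replace the output $\lambda_C(x,q)$ ($x\in X_n$) by the word obtained by deleting the prefix $\Lambda(\varepsilon,q)$ from $\Lambda(x,q)$, and then identify $\omega$-equivalent states. **Monoids and groups.** $T*U$ has states $Q_T\times Q_U$, $\pi_{T*U}(x,(p,q))=(\pi_T(x,p),\pi_U(\lambda_T(x,p),q))$, $\lambda_{T*U}(x,(p,q))=\lambda_U(\lambda_T(x,p),q)$.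 $\mathcal M_n$ is the monoid of minimal, strongly synchronizing, core transducers over $X_n$ with product $TU:=[\mathrm{core}(T*U)]$; its identity is the one-state identity transducer. $\widetilde{\mathcal O}_n\subseteq\mathcal M_n$ is the submonoid of those $T$ all of whose states $q$ have $h_q$ injective with clopen image; $\mathcal O_n$ is its largest inverse-closed subset (group of units). $\widetilde{\mathcal L}_n\subseteq\mathcal M_n$ is the submonoid of those $T$ such that for all $a\in X_n^*$, $q\in Q_T$ with $\pi_T(a,q)=q$ one has $|\lambda_T(a,q)|=|a|$. $\mathcal L_n:=\mathcal O_n\cap\widetilde{\mathcal L}_n$, a group. "$n$ is a power of a smaller integer" means $n=m^k$ for integers $1\le m<n$, $k\ge 2$. *)

theory Defs
  imports
    "HOL-Analysis.Abstract_Topology"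
    "HOL-Analysis.Product_Topology"
    "HOL-Analysis.Function_Topology"
    "HOL-Algebra.Bij"
    "HOL-Algebra.Elementary_Groups"
    "HOL-Library.Omega_Words_Fun"
    "HOL-Library.Extended_Nat"
begin

text \<open>The alphabet is \<open>{..<n}\<close>, finite words are lists and right-infinite words are
  functions on the natural numbers, as in the library theory of omega-words.\<close>

definition words :: "nat \<Rightarrow> nat list set" where
  "words n = lists {..<n}"

definition sequences :: "nat \<Rightarrow> ('i \<Rightarrow> nat) set" where
  "sequences n = (UNIV \<rightarrow>\<^sub>E {..<n})"

definition sequence_topology :: "nat \<Rightarrow> ('i \<Rightarrow> nat) topology" where
  "sequence_topology n = product_topology (\<lambda>_. discrete_topology {..<n}) UNIV"

lemma topspace_sequence_topology: "topspace (sequence_topology n) = sequences n"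
  by (simp add: sequence_topology_def sequences_def)

subsection \<open>Automorphisms of the full shift\<close>

definition shift_map :: "(int \<Rightarrow> nat) \<Rightarrow> (int \<Rightarrow> nat)" where
  "shift_map x = (\<lambda>i. x (i - 1))"

text \<open>As in \<open>BijGroup\<close>, maps are extensional on the space they act on.\<close>

definition shift_Aut :: "nat \<Rightarrow> ((int \<Rightarrow> nat) \<Rightarrow> (int \<Rightarrow> nat)) monoid" where
  "shift_Aut n = (BijGroup (sequences n)) \<lparr>carrier :=
     {f \<in> Bij (sequences n).
        homeomorphic_map (sequence_topology n) (sequence_topology n) f \<and>
        (\<forall>x \<in> sequences n. f (shift_map x) = shift_map (f x))}\<rparr>"

subsection \<open>Transducers\<close>

record 'q transducer =
  states :: "'q set"
  next_state :: "nat \<Rightarrow> 'q \<Rightarrow> 'q"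
  out :: "nat \<Rightarrow> 'q \<Rightarrow> nat list"

primrec next_state_word :: "'q transducer \<Rightarrow> nat list \<Rightarrow> 'q \<Rightarrow> 'q" where
  "next_state_word T [] q = q"
| "next_state_word T (x # w) q = next_state_word T w (next_state T x q)"

primrec out_word :: "'q transducer \<Rightarrow> nat list \<Rightarrow> 'q \<Rightarrow> nat list" where
  "out_word T [] q = []"
| "out_word T (x # w) q = out T x q @ out_word T w (next_state T x q)"

lemma next_state_word_append:
  "next_state_word T (v @ w) q = next_state_word T w (next_state_word T v q)"
  by (induction v arbitrary: q) simp_all

lemma out_word_append:
  "out_word T (v @ w) q = out_word T v q @ out_word T w (next_state_word T v q)"
  by (induction v arbitrary: q) simp_all

definition is_transducer :: "nat \<Rightarrow> 'q transducer \<Rightarrow> bool" where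
  "is_transducer n T \<longleftrightarrow>
     finite (states T) \<and> states T \<noteq> {} \<and>
     (\<forall>x<n. \<forall>q \<in> states T. next_state T x q \<in> states T \<and> out T x q \<in> words n) \<and>
     (\<forall>w \<in> words n. \<forall>q \<in> states T.
        w \<noteq> [] \<and> next_state_word T w q = q \<longrightarrow> out_word T w q \<noteq> [])"

text \<open>The map \<open>h\<^sub>q\<close> on right-infinite words; the outputs on the finite prefixes of the input
  form a chain (see \<open>out_word_prefix\<close>), which is unbounded for a transducer.\<close>

definition state_map :: "'q transducer \<Rightarrow> 'q \<Rightarrow> nat word \<Rightarrow> nat word" where
  "state_map T q w =
     (\<lambda>i. out_word T (prefix (LEAST k. i < length (out_word T (prefix k w) q)) w) q ! i)"

lemma out_word_prefix:
  "out_word T (prefix k w) q =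
     prefix (length (out_word T (prefix k w) q)) (state_map T q w)"
proof (rule nth_equalityI)
  let ?o = "\<lambda>k. out_word T (prefix k w) q"
  fix i assume i: "i < length (?o k)"
  define l where "l = (LEAST k. i < length (?o k))"
  have l: "i < length (?o l)" "l \<le> k"
    unfolding l_def using i by (rule LeastI, intro Least_le)
  have "prefix k w = prefix l w @ (w [l \<rightarrow> k])"
    using subsequence_append[of w l "k - l"] l(2) by simp
  then have "?o k ! i = ?o l ! i"
    using l(1) by (simp add: out_word_append nth_append)
  then show "?o k ! i = prefix (length (?o k)) (state_map T q w) ! i"
    using i by (simp add: state_map_def l_def)
qed simp

definition omega_equivalent ::
  "nat \<Rightarrow> 'q transducer \<Rightarrow> 'q \<Rightarrow> 'r transducer \<Rightarrow> 'r \<Rightarrow> bool" where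
  "omega_equivalent n T p U q \<longleftrightarrow> (\<forall>w \<in> sequences n. state_map T p w = state_map U q w)"

definition weakly_minimal :: "nat \<Rightarrow> 'q transducer \<Rightarrow> bool" where
  "weakly_minimal n T \<longleftrightarrow>
     (\<forall>p \<in> states T. \<forall>q \<in> states T. omega_equivalent n T p T q \<longrightarrow> p = q)"

definition strongly_connected :: "nat \<Rightarrow> 'q transducer \<Rightarrow> bool" where
  "strongly_connected n T \<longleftrightarrow>
     (\<forall>p \<in> states T. \<forall>q \<in> states T. \<exists>w \<in> words n. next_state_word T w p = q)"

definition gcp_length :: "nat word set \<Rightarrow> enat" where
  "gcp_length S = Sup {enat l | l. \<forall>u \<in> S. \<forall>v \<in> S. prefix l u = prefix l v}"

text \<open>Only meaningful if \<open>gcp_length S\<close> is finite and \<open>S\<close> is nonempty.\<close>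

definition gcp :: "nat word set \<Rightarrow> nat list" where
  "gcp S = prefix (the_enat (gcp_length S)) (SOME u. u \<in> S)"

definition continuations :: "nat \<Rightarrow> 'q transducer \<Rightarrow> nat list \<Rightarrow> 'q \<Rightarrow> nat word set" where
  "continuations n T w q = {state_map T q (w \<frown> x) | x. x \<in> sequences n}"

definition Lambda :: "nat \<Rightarrow> 'q transducer \<Rightarrow> nat list \<Rightarrow> 'q \<Rightarrow> nat list" where
  "Lambda n T w q = gcp (continuations n T w q)"

definition extent :: "nat \<Rightarrow> 'q transducer \<Rightarrow> 'q \<Rightarrow> enat" where
  "extent n T q = gcp_length (continuations n T [] q)"

definition incomplete_response :: "nat \<Rightarrow> 'q transducer \<Rightarrow> 'q \<Rightarrow> bool" where
  "incomplete_response n T q \<longleftrightarrow> extent n T q \<noteq> 0"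

subsection \<open>Synchronization and cores\<close>

definition sync_level :: "nat \<Rightarrow> 'q transducer \<Rightarrow> nat \<Rightarrow> bool" where
  "sync_level n T k \<longleftrightarrow>
     (\<forall>w \<in> words n. length w = k \<longrightarrow>
        (\<forall>p \<in> states T. \<forall>q \<in> states T. next_state_word T w p = next_state_word T w q))"

definition strongly_synchronizing :: "nat \<Rightarrow> 'q transducer \<Rightarrow> bool" where
  "strongly_synchronizing n T \<longleftrightarrow> (\<exists>k. sync_level n T k)"

text \<open>The set of forced states does not depend on the synchronizing level: the state forced by
  a longer word is the one forced by its suffix.\<close>

definition core :: "nat \<Rightarrow> 'q transducer \<Rightarrow> 'q transducer" where
  "core n T = T \<lparr>states :=
     {next_state_word T w q | w q k.
        sync_level n T k \<and> w \<in> words n \<and> length w = k \<and> q \<in> states T}\<rparr>"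

definition is_core :: "nat \<Rightarrow> 'q transducer \<Rightarrow> bool" where
  "is_core n T \<longleftrightarrow> core n T = T"

subsection \<open>Minimal transducers and reduction\<close>

definition prime_word :: "nat list \<Rightarrow> bool" where
  "prime_word x \<longleftrightarrow> x \<noteq> [] \<and>
     \<not> (\<exists>u k. length u < length x \<and> x = concat (replicate k u))"

definition least_rotation :: "nat list \<Rightarrow> bool" where
  "least_rotation x \<longleftrightarrow> (\<forall>k. lexordp_eq x (rotate k x))"

definition Z_transducer :: "'q \<Rightarrow> nat list \<Rightarrow> 'q transducer" where
  "Z_transducer s x = \<lparr>states = {s}, next_state = (\<lambda>_ _. s), out = (\<lambda>_ _. x)\<rparr>"

text \<open>The values of the transition and output functions outside the alphabet and the state set
  are irrelevant, hence the pointwise description of \<open>Z\<^sub>x\<close>.\<close>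

definition minimal :: "nat \<Rightarrow> 'q transducer \<Rightarrow> bool" where
  "minimal n T \<longleftrightarrow>
     (weakly_minimal n T \<and> strongly_connected n T \<and>
        (\<forall>q \<in> states T. \<not> incomplete_response n T q)) \<or>
     (\<exists>s x. states T = {s} \<and> (\<forall>a<n. next_state T a s = s \<and> out T a s = x) \<and>
        x \<in> words n \<and> prime_word x \<and> least_rotation x)"

definition transducer_eq :: "nat \<Rightarrow> 'q transducer \<Rightarrow> 'r transducer \<Rightarrow> bool" where
  "transducer_eq n T U \<longleftrightarrow>
     (\<exists>f. bij_betw f (states T) (states U) \<and>
        (\<forall>q \<in> states T. omega_equivalent n T q U (f q)))"

definition constant_word :: "nat \<Rightarrow> 'q transducer \<Rightarrow> nat list" where
  "constant_word n C = (THE y. least_rotation y \<and>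
     (\<exists>q \<in> states C. \<exists>x \<in> words n. \<exists>k. prime_word x \<and>
        omega_equivalent n C q (Z_transducer () x) () \<and> y = rotate k x))"

definition remove_incomplete_response :: "nat \<Rightarrow> 'q transducer \<Rightarrow> 'q transducer" where
  "remove_incomplete_response n C = C \<lparr>out :=
     (\<lambda>x q. drop (length (Lambda n C [] q)) (Lambda n C [x] q))\<rparr>"

definition omega_rel :: "nat \<Rightarrow> 'q transducer \<Rightarrow> ('q \<times> 'q) set" where
  "omega_rel n T = {(p, q). p \<in> states T \<and> q \<in> states T \<and> omega_equivalent n T p T q}"

definition identify_equivalent :: "nat \<Rightarrow> 'q transducer \<Rightarrow> 'q set transducer" where
  "identify_equivalent n T =
     \<lparr>states = states T // omega_rel n T,
      next_state = (\<lambda>x c. omega_rel n T `` {next_state T x (SOME q. q \<in> c)}),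
      out = (\<lambda>x c. out T x (SOME q. q \<in> c))\<rparr>"

text \<open>In the first case the single state of the result is, arbitrarily, the whole state set.\<close>

definition reduction :: "nat \<Rightarrow> 'q transducer \<Rightarrow> 'q set transducer" where
  "reduction n C =
     (if \<exists>q \<in> states C. extent n C q = \<infinity>
      then Z_transducer (states C) (constant_word n C)
      else identify_equivalent n (remove_incomplete_response n C))"

subsection \<open>The monoid of minimal strongly synchronizing core transducers and its subgroups\<close>

definition transducer_prod ::
  "'q transducer \<Rightarrow> 'r transducer \<Rightarrow> ('q \<times> 'r) transducer" where
  "transducer_prod T U =
     \<lparr>states = states T \<times> states U,
      next_state = (\<lambda>x (p, q). (next_state T x p, next_state_word U (out T x p) q)),
      out = (\<lambda>x (p, q). out_word U (out T x p) q)\<rparr>"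

definition in_M :: "nat \<Rightarrow> 'q transducer \<Rightarrow> bool" where
  "in_M n T \<longleftrightarrow>
     is_transducer n T \<and> minimal n T \<and> strongly_synchronizing n T \<and> is_core n T"

text \<open>An element of the monoid is the class, with respect to \<open>transducer_eq\<close>, of a transducer in
  \<open>in_M\<close>; every finite state set has a copy inside the natural numbers.\<close>

definition transducer_class :: "nat \<Rightarrow> 'q transducer \<Rightarrow> nat transducer set" where
  "transducer_class n T = {V. in_M n V \<and> transducer_eq n V T}"

definition identity_transducer :: "unit transducer" where
  "identity_transducer =
     \<lparr>states = {()}, next_state = (\<lambda>_ _. ()), out = (\<lambda>x _. [x])\<rparr>"

definition M_monoid :: "nat \<Rightarrow> nat transducer set monoid" where
  "M_monoid n =
     \<lparr>carrier = {transducer_class n T | T :: nat transducer. in_M n T},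
      mult = (\<lambda>A B. \<Union>T \<in> A. \<Union>U \<in> B.
        transducer_class n (reduction n (core n (transducer_prod T U)))),
      one = transducer_class n identity_transducer\<rparr>"

definition O_tilde :: "nat \<Rightarrow> nat transducer set set" where
  "O_tilde n = {transducer_class n T | T :: nat transducer. in_M n T \<and>
     (\<forall>q \<in> states T. inj_on (state_map T q) (sequences n) \<and>
        openin (sequence_topology n) (state_map T q ` sequences n) \<and>
        closedin (sequence_topology n) (state_map T q ` sequences n))}"

definition O_units :: "nat \<Rightarrow> nat transducer set set" where
  "O_units n = Units ((M_monoid n) \<lparr>carrier := O_tilde n\<rparr>)"

definition L_tilde :: "nat \<Rightarrow> nat transducer set set" where
  "L_tilde n = {transducer_class n T | T :: nat transducer. in_M n T \<and>
     (\<forall>a \<in> words n. \<forall>q \<in> states T. next_state_word T a q = q \<longrightarrow>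
        length (out_word T a q) = length a)}"

definition L_group :: "nat \<Rightarrow> nat transducer set monoid" where
  "L_group n = (M_monoid n) \<lparr>carrier := O_units n \<inter> L_tilde n\<rparr>"

definition power_of_smaller :: "nat \<Rightarrow> bool" where
  "power_of_smaller n \<longleftrightarrow> (\<exists>m k. 1 \<le> m \<and> m < n \<and> 2 \<le> k \<and> n = m ^ k)"

end

theory Submission
  imports Defs "HOL-Computational_Algebra.Primes"
begin

text \<open>Given the past of a point \<open>x\<close>, an automorphism \<open>f\<close> determines a left-infinite part of
  \<open>f x\<close>; what remains is a map of futures, and the finitely many maps obtained in this way are the
  states of a minimal synchronizing transducer. It determines \<open>f\<close> up to a power of the shift, and all
  of \<open>L_group n\<close> arises like this, so that \<open>L_group n\<close> is the quotient of the automorphism group by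
  the powers of the shift.

  If \<open>n\<close> is not a proper power, the quotient splits off: \<open>f\<close> scales the natural measures on unstable
  sets by a rational number (for the shift, by \<open>1 / n\<close>), and an integral combination of the
  \<open>p\<close>-adic valuations of this number is a homomorphism to the integers mapping the shift to \<open>1\<close>.

  If \<open>n = m\<^sup>k\<close> with \<open>k \<ge> 2\<close>, the shift is a \<open>k\<close>-th power of an automorphism, so a homomorphism to
  the integers maps every power of the shift to a multiple of \<open>k\<close>. For a product decomposition, however,
  the projection to the first factor maps some central element to \<open>1\<close>, and by Ryan's theorem central
  elements are powers of the shift.\<close>

section \<open>Block codes\<close>

text \<open>Multiplication in \<open>M_monoid\<close> passes through a product, a core and a
  reduction, so it cannot be compared with composition of automorphisms directly. The remedy is the
  locale \<open>tracking\<close>: besides the state \<open>Q x\<close> belonging to the past of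
  \<open>x\<close> it records the position \<open>d x\<close> at which output starts. Products add
  these positions, reduction increases them by the extent of incomplete response, and without
  incomplete response they are forced. A power of the shift changes nothing but \<open>d\<close>,
  which is why a class forgets it. Conversely, the loop condition in \<open>L_tilde\<close> makes
  output length minus input length a potential on the states, and this potential is the missing
  \<open>d\<close>. As units are formed in \<open>O_tilde\<close>, the loop condition for the
  inverse needs an argument of its own. The homomorphism to the integers exists because the
  exponents in the prime factorization of a number that is not a proper power have greatest common
  divisor 1, so Bezout coefficients combine the valuations. That the scaling factor is the same at
  every point is a maximum principle.\<close>

definition translate :: "int \<Rightarrow> (int \<Rightarrow> 'a) \<Rightarrow> int \<Rightarrow> 'a" where
  "translate k x = (\<lambda>i. x (i + k))"

lemma translate_apply [simp]: "translate k x i = x (i + k)"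
  by (simp add: translate_def)

lemma translate_translate [simp]: "translate k (translate l x) = translate (k + l) x"
  by (simp add: translate_def algebra_simps)

lemma translate_0 [simp]: "translate 0 x = x"
  by (simp add: translate_def)

lemma shift_map_eq_translate: "shift_map x = translate (- 1) x"
  by (simp add: shift_map_def translate_def)

lemma mem_sequences: "x \<in> sequences n \<longleftrightarrow> (\<forall>i. x i < n)"
  by (auto simp: sequences_def)

lemma translate_in_sequences [simp]: "translate k x \<in> sequences n \<longleftrightarrow> x \<in> sequences n"
  by (auto simp: mem_sequences) (metis diff_add_cancel)

text \<open>Sliding block codes of radius at most \<open>r\<close>. Nothing is demanded outside
  \<open>sequences n\<close>, so codes compose as plain functions; extensionality is restored only
  on entering \<open>shift_Aut\<close>.\<close>

definition block_code :: "nat \<Rightarrow> int \<Rightarrow> ((int \<Rightarrow> nat) \<Rightarrow> int \<Rightarrow> nat) \<Rightarrow> bool" where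
  "block_code n r f \<longleftrightarrow> 0 \<le> r \<and> (\<forall>x\<in>sequences n. f x \<in> sequences n) \<and>
     (\<forall>x\<in>sequences n. \<forall>k. f (translate k x) = translate k (f x)) \<and>
     (\<forall>x\<in>sequences n. \<forall>y\<in>sequences n. (\<forall>i. \<bar>i\<bar> \<le> r \<longrightarrow> x i = y i) \<longrightarrow> f x 0 = f y 0)"

lemma block_codeI:
  assumes "0 \<le> r" "\<And>x. x \<in> sequences n \<Longrightarrow> f x \<in> sequences n"
    "\<And>x k. x \<in> sequences n \<Longrightarrow> f (translate k x) = translate k (f x)"
    "\<And>x y. x \<in> sequences n \<Longrightarrow> y \<in> sequences n \<Longrightarrow> (\<And>i. \<bar>i\<bar> \<le> r \<Longrightarrow> x i = y i) \<Longrightarrow> f x 0 = f y 0"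
  shows "block_code n r f"
  using assms unfolding block_code_def by blast

lemma block_code_mem: "block_code n r f \<Longrightarrow> x \<in> sequences n \<Longrightarrow> f x \<in> sequences n"
  by (simp add: block_code_def)

lemma block_code_translate:
  "block_code n r f \<Longrightarrow> x \<in> sequences n \<Longrightarrow> f (translate k x) = translate k (f x)"
  by (simp add: block_code_def)

lemma block_code_radius_nonneg: "block_code n r f \<Longrightarrow> 0 \<le> r"
  by (simp add: block_code_def)

lemma block_code_local:
  assumes f: "block_code n r f" and xy: "x \<in> sequences n" "y \<in> sequences n"
    and eq: "\<And>j. i - r \<le> j \<Longrightarrow> j \<le> i + r \<Longrightarrow> x j = y j"
  shows "f x i = f y i"
proof -
  have "(\<forall>k. \<bar>k\<bar> \<le> r \<longrightarrow> translate i x k = translate i y k) \<longrightarrow>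
      f (translate i x) 0 = f (translate i y) 0"
    using f xy unfolding block_code_def by (meson translate_in_sequences)
  then have "f (translate i x) 0 = f (translate i y) 0"
    using eq by auto
  then show ?thesis
    using block_code_translate[OF f] xy by simp
qed

lemma block_code_mono: "block_code n r f \<Longrightarrow> r \<le> s \<Longrightarrow> block_code n s f"
  unfolding block_code_def by (meson order_trans)

lemma block_code_comp:
  assumes f: "block_code n r f" and g: "block_code n s g"
  shows "block_code n (r + s) (\<lambda>x. g (f x))"
  unfolding block_code_def
proof (intro conjI ballI allI impI)
  show "0 \<le> r + s" using f g by (simp add: block_code_def)
  fix x :: "int \<Rightarrow> nat" assume x: "x \<in> sequences n"
  show "g (f x) \<in> sequences n" using block_code_mem f g x by blast
  show "g (f (translate k x)) = translate k (g (f x))" for k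
    using block_code_mem[OF f x] x
    by (simp add: block_code_translate[OF f] block_code_translate[OF g])
  fix y :: "int \<Rightarrow> nat" assume y: "y \<in> sequences n" and eq: "\<forall>i. \<bar>i\<bar> \<le> r + s \<longrightarrow> x i = y i"
  have r: "0 \<le> r" "0 \<le> s" using f g by (simp_all add: block_code_def)
  show "g (f x) 0 = g (f y) 0"
  proof (rule block_code_local[OF g])
    show "f x \<in> sequences n" "f y \<in> sequences n" using block_code_mem[OF f] x y by blast+
    fix j :: int assume "0 - s \<le> j" "j \<le> 0 + s"
    then show "f x j = f y j"
      by (intro block_code_local[OF f x y]) (auto simp: eq)
  qed
qed

lemma block_code_translation: "block_code n \<bar>k\<bar> (translate k)"
  unfolding block_code_def by (auto simp: algebra_simps)

lemma block_code_cong: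
  assumes f: "block_code n r f" and eq: "\<And>x. x \<in> sequences n \<Longrightarrow> g x = f x"
  shows "block_code n r g"
proof -
  have t: "g (translate k x) = translate k (g x)" if "x \<in> sequences n" for x k
    using that eq[of "translate k x"] eq[OF that] block_code_translate[OF f that, of k] by simp
  have l: "g x 0 = g y 0"
    if "x \<in> sequences n" "y \<in> sequences n" "\<forall>i. \<bar>i\<bar> \<le> r \<longrightarrow> x i = y i" for x y
    unfolding eq[OF that(1)] eq[OF that(2)]
    using that(3) by (intro block_code_local[OF f that(1,2)]) auto
  have m: "g x \<in> sequences n" if "x \<in> sequences n" for x
    unfolding eq[OF that] by (rule block_code_mem[OF f that])
  show ?thesis
    by (rule block_codeI[OF block_code_radius_nonneg[OF f] m t l]) auto
qed

text \<open>The inverse is a parameter with the same radius because the counting arguments and the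
  clopen images use the window of the inverse.\<close>

definition invertible_code ::
  "nat \<Rightarrow> int \<Rightarrow> ((int \<Rightarrow> nat) \<Rightarrow> int \<Rightarrow> nat) \<Rightarrow> ((int \<Rightarrow> nat) \<Rightarrow> int \<Rightarrow> nat) \<Rightarrow> bool" where
  "invertible_code n r f g \<longleftrightarrow> block_code n r f \<and> block_code n r g \<and>
     (\<forall>x\<in>sequences n. g (f x) = x \<and> f (g x) = x)"

lemma invertible_code_sym: "invertible_code n r f g \<Longrightarrow> invertible_code n r g f"
  by (simp add: invertible_code_def)

lemma invertible_code_comp:
  assumes f: "invertible_code n r f f'" and g: "invertible_code n s g g'"
  shows "invertible_code n (r + s) (\<lambda>x. g (f x)) (\<lambda>x. f' (g' x))"
proof -
  have "block_code n (s + r) (\<lambda>x. f' (g' x))" "block_code n (r + s) (\<lambda>x. g (f x))"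
    using f g block_code_comp unfolding invertible_code_def by blast+
  then show ?thesis
    using f g block_code_mem[of n r f] block_code_mem[of n s g']
    unfolding invertible_code_def by (simp add: add.commute)
qed

lemma invertible_code_translate: "invertible_code n \<bar>k\<bar> (translate k) (translate (- k))"
  using block_code_translation[of n k] block_code_translation[of n "- k"]
  by (simp add: invertible_code_def)

lemma invertible_code_cong:
  assumes "invertible_code n r f f'" "\<And>x. x \<in> sequences n \<Longrightarrow> g x = f x"
  shows "invertible_code n r g f'"
  using assms block_code_mem[of n r f'] block_code_cong[of n r f g] unfolding invertible_code_def by auto

section \<open>Finite windows, continuity and the automorphism group\<close>

lemma openin_finite_window:
  assumes S: "S \<subseteq> sequences n" and F: "finite F"
    and win: "\<And>x y. x \<in> S \<Longrightarrow> y \<in> sequences n \<Longrightarrow> (\<And>i. i \<in> F \<Longrightarrow> x i = y i) \<Longrightarrow> y \<in> S"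
  shows "openin (sequence_topology n) S"
  unfolding sequence_topology_def openin_product_topology_alt
proof (intro ballI)
  fix x assume x: "x \<in> S"
  define U where "U = (\<lambda>i. if i \<in> F then {x i} else {..<n})"
  have xn: "x i < n" for i
    using S x by (auto simp: mem_sequences)
  have "finite {i \<in> UNIV. U i \<noteq> topspace (discrete_topology {..<n})}"
    by (rule finite_subset[OF _ F]) (auto simp: U_def)
  moreover have "\<forall>i\<in>UNIV. openin (discrete_topology {..<n}) (U i)"
    using xn by (auto simp: U_def)
  moreover have "x \<in> Pi\<^sub>E UNIV U"
    using xn by (auto simp: U_def)
  moreover have "Pi\<^sub>E UNIV U \<subseteq> S"
  proof
    fix y assume "y \<in> Pi\<^sub>E UNIV U"
    then have y: "y i \<in> U i" for i by auto
    show "y \<in> S"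
    proof (rule win[OF x])
      have "y i < n" for i using y[of i] xn by (auto simp: U_def split: if_splits)
      then show "y \<in> sequences n" by (simp add: mem_sequences)
      show "x i = y i" if "i \<in> F" for i using y[of i] that by (auto simp: U_def)
    qed
  qed
  ultimately show "\<exists>U. finite {i \<in> UNIV. U i \<noteq> topspace (discrete_topology {..<n})} \<and>
      (\<forall>i\<in>UNIV. openin (discrete_topology {..<n}) (U i)) \<and> x \<in> Pi\<^sub>E UNIV U \<and> Pi\<^sub>E UNIV U \<subseteq> S"
    by blast
qed

lemma closedin_finite_window:
  assumes S: "S \<subseteq> sequences n" and F: "finite F"
    and win: "\<And>x y. x \<in> S \<Longrightarrow> y \<in> sequences n \<Longrightarrow> (\<And>i. i \<in> F \<Longrightarrow> x i = y i) \<Longrightarrow> y \<in> S"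
  shows "closedin (sequence_topology n) S"
  unfolding closedin_def topspace_sequence_topology
proof
  show "openin (sequence_topology n) (sequences n - S)"
    by (rule openin_finite_window[OF _ F]) (auto, metis S subsetD win)
qed (rule S)

lemma continuous_map_window:
  fixes f :: "(int \<Rightarrow> nat) \<Rightarrow> int \<Rightarrow> nat"
  assumes "block_code n r f"
  shows "continuous_map (sequence_topology n) (sequence_topology n) f"
proof -
  have "continuous_map (sequence_topology n) (discrete_topology {..<n}) (\<lambda>x. f x k)" for k
    unfolding continuous_map_def topspace_sequence_topology
  proof (intro conjI allI impI)
    show "(\<lambda>x. f x k) \<in> sequences n \<rightarrow> topspace (discrete_topology {..<n})"
      using block_code_mem[OF assms] by (auto simp: mem_sequences)
    fix U :: "nat set"
    show "openin (sequence_topology n) {x \<in> sequences n. f x k \<in> U}"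
    proof (rule openin_finite_window[where F = "{k - r..k + r}"])
      fix x y :: "int \<Rightarrow> nat"
      assume "x \<in> {x \<in> sequences n. f x k \<in> U}" "y \<in> sequences n"
        and "\<And>i. i \<in> {k - r..k + r} \<Longrightarrow> x i = y i"
      then show "y \<in> {x \<in> sequences n. f x k \<in> U}"
        using block_code_local[OF assms, of x y k] by auto
    qed auto
  qed
  then show ?thesis
    unfolding sequence_topology_def continuous_map_componentwise_UNIV
    by (simp add: sequence_topology_def)
qed

text \<open>The Curtis--Hedlund--Lyndon argument: the finitely many coordinates needed at each point
  become uniform by compactness.\<close>

lemma continuous_map_uniform_window:
  fixes f :: "(int \<Rightarrow> nat) \<Rightarrow> int \<Rightarrow> nat"
  assumes f: "continuous_map (sequence_topology n) (sequence_topology n) f"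
  obtains r where "0 \<le> r" "\<And>x y. x \<in> sequences n \<Longrightarrow> y \<in> sequences n \<Longrightarrow>
    (\<And>i. \<bar>i\<bar> \<le> r \<Longrightarrow> x i = y i) \<Longrightarrow> f x 0 = f y 0"
proof -
  have f0: "continuous_map (sequence_topology n) (discrete_topology {..<n}) (\<lambda>x. f x 0)"
    using f unfolding sequence_topology_def continuous_map_componentwise_UNIV by simp
  have "\<exists>F. finite F \<and> (\<forall>y\<in>sequences n. (\<forall>i\<in>F. y i = x i) \<longrightarrow> f y 0 = f x 0)"
    if x: "x \<in> sequences n" for x
  proof -
    have fx: "f x 0 < n"
      using f x mem_sequences[of "f x" n]
      by (simp add: continuous_map_def topspace_sequence_topology Pi_iff)
    then have "openin (sequence_topology n) {y \<in> sequences n. f y 0 \<in> {f x 0}}"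
      using f0 unfolding continuous_map_def topspace_sequence_topology openin_discrete_topology
      by (elim conjE allE[of _ "{f x 0}"]) simp
    then obtain U where U: "finite {i. U i \<noteq> {..<n}}" "x \<in> Pi\<^sub>E UNIV U"
        "Pi\<^sub>E UNIV U \<subseteq> {y \<in> sequences n. f y 0 \<in> {f x 0}}"
      unfolding sequence_topology_def openin_product_topology_alt using x by (auto 0 3)
    have "f y 0 = f x 0" if y: "y \<in> sequences n" "\<forall>i\<in>{i. U i \<noteq> {..<n}}. y i = x i" for y
    proof -
      have "y i \<in> U i" for i
        using y U(2) by (cases "U i = {..<n}") (auto simp: mem_sequences PiE_iff)
      then show ?thesis using U(3) by auto
    qed
    then show ?thesis using U(1) by blast
  qed
  then obtain F where F: "\<And>x. x \<in> sequences n \<Longrightarrow> finite (F x)"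
    "\<And>x y. x \<in> sequences n \<Longrightarrow> y \<in> sequences n \<Longrightarrow> (\<forall>i\<in>F x. y i = x i) \<Longrightarrow> f y 0 = f x 0"
    by metis
  define C where "C = (\<lambda>x. {y \<in> sequences n. \<forall>i\<in>F x. y i = x i})"
  have C: "openin (sequence_topology n) (C x)" if "x \<in> sequences n" for x
    unfolding C_def by (rule openin_finite_window[OF _ F(1)[OF that]]) auto
  have "compact_space (sequence_topology n :: (int \<Rightarrow> nat) topology)"
    unfolding sequence_topology_def compact_space_product_topology
    by (simp add: compact_space_discrete_topology)
  then have "\<exists>D. finite D \<and> D \<subseteq> C ` sequences n \<and> sequences n \<subseteq> \<Union> D"
    unfolding compact_space_alt topspace_sequence_topology
  proof (elim allE[of _ "C ` sequences n"] mp, intro conjI ballI)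
    show "openin (sequence_topology n) U" if "U \<in> C ` sequences n" for U
      using that C by blast
    show "sequences n \<subseteq> \<Union> (C ` sequences n)"
      unfolding C_def by blast
  qed
  then obtain X where X: "finite X" "X \<subseteq> sequences n" "sequences n \<subseteq> \<Union> (C ` X)"
    by (metis finite_subset_image)
  define G where "G = (\<Union>x\<in>X. F x)"
  have G: "finite G" unfolding G_def using X F(1) by blast
  define r where "r = Max (insert 0 (abs ` G))"
  have r: "\<bar>i\<bar> \<le> r" if "i \<in> G" for i
    unfolding r_def by (rule Max_ge) (use G that in auto)
  show ?thesis
  proof
    show "0 \<le> r" unfolding r_def using G by simp
    fix x y :: "int \<Rightarrow> nat"
    assume xy: "x \<in> sequences n" "y \<in> sequences n" "\<And>i. \<bar>i\<bar> \<le> r \<Longrightarrow> x i = y i"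
    obtain z where z: "z \<in> X" "x \<in> C z" using X xy by blast
    have "\<forall>i\<in>F z. x i = z i" using z by (simp add: C_def)
    moreover have "\<forall>i\<in>F z. y i = x i"
    proof
      fix i assume "i \<in> F z"
      with z(1) have "i \<in> G" by (auto simp: G_def)
      from xy(3)[OF r[OF this]] show "y i = x i" ..
    qed
    ultimately show "f x 0 = f y 0"
      using F(2)[of z x] F(2)[of z y] z X xy by auto
  qed
qed

text \<open>Translates the topological definition into block codes. The inverse homeomorphism is
  continuous as well, so compactness gives both maps a window, and the larger one is a common
  radius.\<close>

lemma mem_shift_Aut_iff:
  "f \<in> carrier (shift_Aut n) \<longleftrightarrow>
     f \<in> extensional (sequences n) \<and> (\<exists>r g. invertible_code n r f g)"
proof
  assume "f \<in> carrier (shift_Aut n)"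
  then have ext: "f \<in> extensional (sequences n)"
    and bij: "bij_betw f (sequences n) (sequences n)"
    and homeo: "homeomorphic_map (sequence_topology n) (sequence_topology n) f"
    and comm: "\<And>x. x \<in> sequences n \<Longrightarrow> f (translate (- 1) x) = translate (- 1) (f x)"
    by (auto simp: shift_Aut_def Bij_def shift_map_eq_translate)
  obtain g where g: "continuous_map (sequence_topology n) (sequence_topology n) f"
      "continuous_map (sequence_topology n) (sequence_topology n) g"
      "\<And>x. x \<in> sequences n \<Longrightarrow> g (f x) = x" "\<And>x. x \<in> sequences n \<Longrightarrow> f (g x) = x"
    using homeo unfolding homeomorphic_map_maps homeomorphic_maps_def topspace_sequence_topology
    by blast
  have mem: "f x \<in> sequences n" "g x \<in> sequences n" if "x \<in> sequences n" for x
    using g(1,2) that by (auto simp: continuous_map_def topspace_sequence_topology Pi_iff)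
  \<comment> \<open>Only commutation with the shift itself is given; induction over the integers
    extends it to all translations. \<open>h\<close> is generic so that the inverse is covered
    too.\<close>
  have step: "h (translate k x) = translate k (h x)"
    if h: "\<And>x. x \<in> sequences n \<Longrightarrow> h (translate (- 1) x) = translate (- 1) (h x)"
      "\<And>x. x \<in> sequences n \<Longrightarrow> h x \<in> sequences n" and x: "x \<in> sequences n"
    for h :: "(int \<Rightarrow> nat) \<Rightarrow> int \<Rightarrow> nat" and k x
  proof (induction k rule: int_induct[where k = 0])
    case (step1 i)
    have "translate (- 1) (h (translate (i + 1) x)) = h (translate i x)"
      using h(1)[of "translate (i + 1) x"] x by simp
    also have "\<dots> = translate i (h x)" by (fact step1)
    finally have "translate 1 (translate (- 1) (h (translate (i + 1) x))) =
      translate 1 (translate i (h x))" by (rule arg_cong)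
    then have "h (translate (i + 1) x) = translate (1 + i) (h x)" by simp
    then show ?case by (simp only: add.commute)
  next
    case (step2 i)
    have "h (translate (- 1) (translate i x)) = translate (- 1) (h (translate i x))"
      using h(1)[of "translate i x"] x by simp
    also have "h (translate i x) = translate i (h x)" by (fact step2)
    finally show ?case by (simp only: translate_translate uminus_add_conv_diff)
  qed (simp only: translate_0)
  have commg: "g (translate (- 1) x) = translate (- 1) (g x)" if "x \<in> sequences n" for x
    using comm[of "g x"] g(3)[of "translate (- 1) (g x)"] g(4)[of x] mem that by simp
  obtain r where r: "0 \<le> r" "\<And>x y. x \<in> sequences n \<Longrightarrow> y \<in> sequences n \<Longrightarrow>
      (\<And>i. \<bar>i\<bar> \<le> r \<Longrightarrow> x i = y i) \<Longrightarrow> f x 0 = f y 0"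
    using continuous_map_uniform_window[OF g(1)] by metis
  obtain s where s: "0 \<le> s" "\<And>x y. x \<in> sequences n \<Longrightarrow> y \<in> sequences n \<Longrightarrow>
      (\<And>i. \<bar>i\<bar> \<le> s \<Longrightarrow> x i = y i) \<Longrightarrow> g x 0 = g y 0"
    using continuous_map_uniform_window[OF g(2)] by metis
  have "block_code n r f"
    by (rule block_codeI[OF r(1) mem(1) step[of f, OF comm mem(1)] r(2)])
  moreover have "block_code n s g"
    by (rule block_codeI[OF s(1) mem(2) step[of g, OF commg mem(2)] s(2)])
  ultimately have "block_code n (max r s) f" "block_code n (max r s) g"
    by (auto intro: block_code_mono)
  then show "f \<in> extensional (sequences n) \<and> (\<exists>r g. invertible_code n r f g)"
    using ext g unfolding invertible_code_def by blast
next
  assume "f \<in> extensional (sequences n) \<and> (\<exists>r g. invertible_code n r f g)"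
  then obtain r g where f: "f \<in> extensional (sequences n)" "block_code n r f" "block_code n r g"
    "\<And>x. x \<in> sequences n \<Longrightarrow> g (f x) = x" "\<And>x. x \<in> sequences n \<Longrightarrow> f (g x) = x"
    unfolding invertible_code_def by blast
  have "bij_betw f (sequences n) (sequences n)"
    by (rule bij_betw_byWitness[where f' = g]) (use f block_code_mem in auto)
  moreover have "homeomorphic_map (sequence_topology n) (sequence_topology n) f"
    unfolding homeomorphic_map_maps homeomorphic_maps_def topspace_sequence_topology
    using f continuous_map_window by blast
  ultimately show "f \<in> carrier (shift_Aut n)"
    using f block_code_translate[OF f(2)]
    by (auto simp: shift_Aut_def Bij_def shift_map_eq_translate)
qed

lemma restrict_mem_shift_Aut:
  assumes "invertible_code n r f g"
  shows "restrict f (sequences n) \<in> carrier (shift_Aut n)"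
  using invertible_code_cong[OF assms, of "restrict f (sequences n)"]
  by (auto simp: mem_shift_Aut_iff)

lemma shift_Aut_mult:
  assumes "f \<in> carrier (shift_Aut n)" "g \<in> carrier (shift_Aut n)"
  shows "f \<otimes>\<^bsub>shift_Aut n\<^esub> g = restrict (\<lambda>x. f (g x)) (sequences n)"
  using assms by (auto simp: shift_Aut_def BijGroup_def compose_def)

lemma shift_Aut_mult_closed:
  assumes "f \<in> carrier (shift_Aut n)" "g \<in> carrier (shift_Aut n)"
  shows "f \<otimes>\<^bsub>shift_Aut n\<^esub> g \<in> carrier (shift_Aut n)"
proof -
  obtain r f' s g' where "invertible_code n r f f'" "invertible_code n s g g'"
    using assms by (auto simp: mem_shift_Aut_iff)
  from restrict_mem_shift_Aut[OF invertible_code_comp[OF this(2,1)]] show ?thesis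
    by (simp add: shift_Aut_mult[OF assms])
qed

lemma invertible_codeD:
  assumes "invertible_code n r f g"
  shows "block_code n r f" "block_code n r g" "0 \<le> r"
    "x \<in> sequences n \<Longrightarrow> g (f x) = x" "x \<in> sequences n \<Longrightarrow> f (g x) = x"
    "x \<in> sequences n \<Longrightarrow> f x \<in> sequences n" "x \<in> sequences n \<Longrightarrow> g x \<in> sequences n"
  using assms block_code_mem block_code_radius_nonneg unfolding invertible_code_def by blast+

section \<open>Central automorphisms and roots of the shift\<close>

definition merge_letters :: "nat \<Rightarrow> nat \<Rightarrow> nat \<Rightarrow> nat" where
  "merge_letters a b s = (if s = b then a else s)"

text \<open>The test automorphisms for centrality. \<open>P\<close> sees the point recentred at
  \<open>i\<close>, so one predicate can single out one place of a prescribed point.\<close>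

definition cond_swap :: "nat \<Rightarrow> nat \<Rightarrow> ((int \<Rightarrow> nat) \<Rightarrow> bool) \<Rightarrow> (int \<Rightarrow> nat) \<Rightarrow> int \<Rightarrow> nat" where
  "cond_swap a b P x = (\<lambda>i. if P (\<lambda>j. merge_letters a b (x (j + i)))
     then (if x i = a then b else if x i = b then a else x i) else x i)"

text \<open>The condition cannot see the difference between the swapped letters, so the swap is an
  involution for every local predicate.\<close>

lemma invertible_code_cond_swap:
  assumes ab: "a < n" "b < n" and N: "0 \<le> N"
    and P: "\<And>u v. (\<And>i. \<bar>i\<bar> \<le> N \<Longrightarrow> u i = v i) \<Longrightarrow> P u = P v"
  shows "invertible_code n N (cond_swap a b P) (cond_swap a b P)"
proof -
  have "block_code n N (cond_swap a b P)"
  proof (rule block_codeI[OF N])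
    fix x y :: "int \<Rightarrow> nat" assume x: "x \<in> sequences n" and "y \<in> sequences n"
    show "cond_swap a b P x \<in> sequences n"
      using x ab by (auto simp: mem_sequences cond_swap_def)
    show "cond_swap a b P (translate k x) = translate k (cond_swap a b P x)" for k
      by (rule ext) (simp add: cond_swap_def add.assoc)
    assume eq: "\<And>i. \<bar>i\<bar> \<le> N \<Longrightarrow> x i = y i"
    have "x 0 = y 0" using eq N by simp
    moreover have "P (\<lambda>j. merge_letters a b (x (j + 0))) = P (\<lambda>j. merge_letters a b (y (j + 0)))"
      by (rule P) (simp add: eq)
    ultimately show "cond_swap a b P x 0 = cond_swap a b P y 0"
      by (simp add: cond_swap_def)
  qed
  moreover have "cond_swap a b P (cond_swap a b P x) = x" for x
  proof -
    have "merge_letters a b (cond_swap a b P x i) = merge_letters a b (x i)" for i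
      by (simp add: cond_swap_def merge_letters_def)
    then show ?thesis
      by (intro ext) (simp add: cond_swap_def[of a b P "cond_swap a b P x"], simp add: cond_swap_def)
  qed
  ultimately show ?thesis by (simp add: invertible_code_def)
qed

text \<open>The leading 1 is the letter that the swaps will move. It differs from the letter 0 that
  surrounds the word in the probe, which makes its place recognizable. Any enumeration of the words
  serves, hence \<open>SOME\<close>.\<close>

definition universal_word :: "nat \<Rightarrow> nat \<Rightarrow> nat list" where
  "universal_word n l = 1 # concat (SOME ws. set ws = {w \<in> words n. length w = l})"

lemma universal_word_choice:
  "set (SOME ws. set ws = {w \<in> words n. length w = l}) = {w \<in> words n. length w = l}"
proof -
  have "finite {w \<in> words n. length w = l}"
    using finite_lists_length_eq[of "{..<n}" l] by (simp add: words_def lists_eq_set conj_commute)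
  then show ?thesis by (rule someI_ex[OF finite_list])
qed

lemma universal_word_factor:
  assumes "w \<in> words n" "length w = l"
  obtains u v where "universal_word n l = 1 # u @ w @ v"
proof -
  have "w \<in> set (SOME ws. set ws = {w \<in> words n. length w = l})"
    using assms by (simp add: universal_word_choice)
  then obtain xs ys where "(SOME ws. set ws = {w \<in> words n. length w = l}) = xs @ w # ys"
    by (meson split_list)
  then have "universal_word n l = 1 # concat xs @ w @ concat ys"
    by (simp add: universal_word_def)
  then show ?thesis ..
qed

lemma universal_word_less: "n \<ge> 2 \<Longrightarrow> s \<in> set (universal_word n l) \<Longrightarrow> s < n"
  using universal_word_choice[of n l] by (auto simp: universal_word_def words_def)

text \<open>Ryan's theorem. The probe is a finitely supported point containing every word of the relevant
  length; a conditional swap that moves only its origin pins down its image up to merging two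
  letters.\<close>

theorem central_block_code:
  assumes n: "4 \<le> n" and f: "invertible_code n r f f'"
    and central: "\<And>s g g' x. invertible_code n s g g' \<Longrightarrow> x \<in> sequences n \<Longrightarrow> f (g x) = g (f x)"
  shows "\<exists>k. \<forall>x\<in>sequences n. f x = translate k x"
proof -
  note fb = invertible_codeD(1)[OF f] and r = invertible_codeD(3)[OF f]
  have inj: "x = y" if "x \<in> sequences n" "y \<in> sequences n" "f x = f y" for x y
    using invertible_codeD(4)[OF f] that by metis
  define U where "U = universal_word n (nat (2 * r + 1))"
  define z where "z = (\<lambda>i. if 0 \<le> i \<and> i < int (length U) then U ! nat i else 0)"
  have z0: "z 0 = 1" by (simp add: z_def U_def universal_word_def)
  have zneg: "z i = 0" if "i < 0" for i using that by (simp add: z_def)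
  have zlen: "z i = 0" if "i \<ge> int (length U)" for i using that by (simp add: z_def)
  have z: "z \<in> sequences n"
    unfolding mem_sequences
  proof
    fix i
    show "z i < n"
    proof (cases "0 \<le> i \<and> i < int (length U)")
      case True
      then have "U ! nat i \<in> set U" by (intro nth_mem) linarith
      then have "U ! nat i < n" unfolding U_def using n by (intro universal_word_less) simp_all
      then show ?thesis using True by (simp add: z_def)
    qed (use n in \<open>auto simp: z_def\<close>)
  qed
  \<comment> \<open>Within distance \<open>N\<close> of the origin lies the whole universal word,
    and the surplus \<open>2 * r\<close> allows for comparing two offsets of size at most
    \<open>r\<close>.\<close>
  define N where "N = int (length U) + 2 * r"
  have N: "0 \<le> N" "2 * r \<le> N" "int (length U) \<le> N" using r by (auto simp: N_def)
  \<comment> \<open>Swapping 1 and \<open>b\<close> wherever the surroundings look like the probe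
    changes \<open>z\<close> at the origin only. As \<open>f\<close> is injective and local,
    \<open>f z\<close> must be changed by the same swap at some place within \<open>r\<close>, and
    there its surroundings look like the probe too.\<close>
  have key: "\<exists>i. \<bar>i\<bar> \<le> r \<and> (\<forall>k. \<bar>k\<bar> \<le> N \<longrightarrow> merge_letters 1 b (f z (k + i)) = merge_letters 1 b (z k))"
    if b: "b < n" "b \<noteq> 0" "b \<noteq> 1" for b
  proof -
    define P where "P = (\<lambda>u. \<forall>k. \<bar>k\<bar> \<le> N \<longrightarrow> u k = merge_letters 1 b (z k))"
    let ?g = "cond_swap 1 b P"
    have g: "invertible_code n N ?g ?g"
      using b n N by (intro invertible_code_cond_swap) (auto simp: P_def)
    have gb: "block_code n N ?g" using g by (simp add: invertible_code_def)
    have gz: "?g z i = z i" if "i \<noteq> 0" for i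
    proof -
      have "\<not> P (\<lambda>j. merge_letters 1 b (z (j + i)))"
      proof
        assume "P (\<lambda>j. merge_letters 1 b (z (j + i)))"
        then have eq: "merge_letters 1 b (z (k + i)) = merge_letters 1 b (z k)" if "\<bar>k\<bar> \<le> N" for k
          using that by (simp add: P_def)
        \<comment> \<open>In each case the letter 1 at the origin meets a letter 0 outside the word:
          the one at \<open>i\<close>, or the one at \<open>- i\<close> when \<open>i\<close> may
          lie inside the word.\<close>
        consider "i < 0" | "0 < i" "i \<le> N" | "N < i" using \<open>i \<noteq> 0\<close> by linarith
        then show False
        proof cases
          case 1 then show ?thesis
            using eq[of 0] N z0 zneg[of i] b by (simp add: merge_letters_def)
        next
          case 2 then show ?thesis
            using eq[of "- i"] N z0 zneg[of "- i"] b by (simp add: merge_letters_def)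
        next
          case 3 then show ?thesis
            using eq[of 0] N z0 zlen[of i] b by (simp add: merge_letters_def)
        qed
      qed
      then show ?thesis by (simp add: cond_swap_def)
    qed
    have "P (\<lambda>j. merge_letters 1 b (z (j + 0)))" by (simp add: P_def)
    then have "?g z 0 = b" using z0 by (simp add: cond_swap_def)
    then have "?g z \<noteq> z" using z0 b by auto
    then have "f (?g z) \<noteq> f z"
      using inj[of "?g z" z] z block_code_mem[OF gb z] by blast
    then obtain i where i: "f (?g z) i \<noteq> f z i" by auto
    have "\<bar>i\<bar> \<le> r"
    proof (rule ccontr)
      assume "\<not> \<bar>i\<bar> \<le> r"
      then have "f (?g z) i = f z i"
        by (intro block_code_local[OF fb block_code_mem[OF gb z] z] gz) auto
      with i show False by simp
    qed
    \<comment> \<open>Centrality turns \<open>f (?g z)\<close> into \<open>?g (f z)\<close>, so the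
      difference at \<open>i\<close> means that the condition of the swap holds there.\<close>
    moreover have "P (\<lambda>j. merge_letters 1 b (f z (j + i)))"
      using i unfolding central[OF g z] by (auto simp: cond_swap_def split: if_splits)
    ultimately show ?thesis unfolding P_def by blast
  qed
  \<comment> \<open>Two swaps, of 1 with 2 and of 1 with 3; together with the background letter 0
    this uses four letters.\<close>
  obtain i where i: "\<bar>i\<bar> \<le> r"
      "\<And>k. \<bar>k\<bar> \<le> N \<Longrightarrow> merge_letters 1 2 (f z (k + i)) = merge_letters 1 2 (z k)"
    using key[of 2] n by auto
  obtain j where j: "\<bar>j\<bar> \<le> r"
      "\<And>k. \<bar>k\<bar> \<le> N \<Longrightarrow> merge_letters 1 3 (f z (k + j)) = merge_letters 1 3 (z k)"
    using key[of 3] n by auto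
  \<comment> \<open>The origin carries the leftmost nonzero letter of the probe, and merging 1 with
    another nonzero letter does not hide that; so both offsets locate the same place.\<close>
  have ij: "i = j"
  proof (rule ccontr)
    assume "i \<noteq> j"
    then consider "i < j" | "j < i" by linarith
    then show False
    proof cases
      case 1
      have "merge_letters 1 3 (f z i) = merge_letters 1 3 0"
        using j(2)[of "i - j"] 1 i j N zneg[of "i - j"] by simp
      moreover have "merge_letters 1 2 (f z i) = 1"
        using i(2)[of 0] N z0 by (simp add: merge_letters_def)
      ultimately show False by (simp add: merge_letters_def split: if_splits)
    next
      case 2
      have "merge_letters 1 2 (f z j) = merge_letters 1 2 0"
        using i(2)[of "j - i"] 2 i j N zneg[of "j - i"] by simp
      moreover have "merge_letters 1 3 (f z j) = 1"
        using j(2)[of 0] N z0 by (simp add: merge_letters_def)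
      ultimately show False by (simp add: merge_letters_def split: if_splits)
    qed
  qed
  \<comment> \<open>Two letters that agree after merging 1 and 3 as well as after merging 1 and 2
    are equal.\<close>
  have fz: "f z (k + i) = z k" if "\<bar>k\<bar> \<le> N" for k
    using i(2)[OF that] j(2)[OF that] ij by (auto simp: merge_letters_def split: if_splits)
  have f0: "f x 0 = x (- i)" if x: "x \<in> sequences n" for x
  proof -
    define w where "w = map (\<lambda>t. x (int t - r)) [0..<nat (2 * r + 1)]"
    have "w \<in> words n" using x by (auto simp: w_def words_def mem_sequences)
    moreover have lw: "length w = nat (2 * r + 1)" by (simp add: w_def)
    ultimately obtain u v where uv: "U = 1 # u @ w @ v"
      unfolding U_def by (rule universal_word_factor)
    \<comment> \<open>The centre of an occurrence in the probe of the window of \<open>x\<close>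
      around 0: the leading 1, the part before the occurrence, and half a window.\<close>
    define p where "p = 1 + int (length u) + r"
    have zx: "z (p + t) = x t" if "\<bar>t\<bar> \<le> r" for t
    proof -
      have t: "nat (p + t) = Suc (length u + nat (t + r))" "nat (t + r) < length w"
        "p + t < int (length U)" "0 \<le> p + t"
        using that lw by (auto simp: p_def uv)
      then have "z (p + t) = w ! nat (t + r)"
        by (simp add: z_def uv nth_append)
      also have "0 \<le> t + r" using that by simp
      then have "w ! nat (t + r) = x t"
        using t(2) by (simp add: w_def)
      finally show ?thesis .
    qed
    have "f x 0 = f (translate p z) 0"
      using zx by (intro block_code_local[OF fb x]) (auto simp: z add.commute)
    also have "\<dots> = f z p" using block_code_translate[OF fb z] by simp
    also have "\<dots> = z (p - i)"
      using fz[of "p - i"] i(1) lw r by (simp add: N_def uv p_def)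
    also have "\<dots> = x (- i)" using zx[of "- i"] i(1) by simp
    finally show ?thesis .
  qed
  have "f x = translate (- i) x" if x: "x \<in> sequences n" for x
  proof
    fix t
    show "f x t = translate (- i) x t"
      using f0[of "translate t x"] block_code_translate[OF fb x, of t] x by simp
  qed
  then show ?thesis by blast
qed

text \<open>For \<open>n = m\<^sup>k\<close>, shifting the base-\<open>m\<close> digits of a point by one place.\<close>

definition digit_shift :: "nat \<Rightarrow> nat \<Rightarrow> (int \<Rightarrow> nat) \<Rightarrow> int \<Rightarrow> nat" where
  "digit_shift m k x = (\<lambda>i. x i * m mod m ^ k + x (i - 1) div m ^ (k - 1))"

lemma mod_mult_add:
  fixes d c l e :: nat
  assumes "e < d"
  shows "(d * l + e) mod (d * c) = d * (l mod c) + e"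
  using assms by (simp add: mod_mult2_eq)

text \<open>The induction step for powers of \<open>digit_shift\<close>, with
  \<open>a = m ^ j\<close> and \<open>c = m ^ (k - Suc j)\<close>; \<open>u\<close>,
  \<open>v\<close>, \<open>w\<close> are the letters at \<open>i\<close>, \<open>i - 1\<close>,
  \<open>i - 2\<close>. The digit that moves over is the leading digit of what the
  \<open>j\<close>-th power has left of \<open>v\<close>; whatever stems from \<open>w\<close> lies
  in lower digits and is cut off by the division.\<close>

lemma digit_shift_step:
  fixes a m c u v w :: nat
  assumes pos: "0 < a" "0 < m" "0 < c" and v: "v < a * m * c" and w: "w < a * m * c"
  shows "(u * a mod (a * m * c) + v div (m * c)) * m mod (a * m * c) +
      (v * a mod (a * m * c) + w div (m * c)) div (a * c) =
    u * (a * m) mod (a * m * c) + v div c"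
proof -
  have small: "t div (m * c) < a" if "t < a * m * c" for t
    using that pos by (simp add: div_less_iff_less_mult mult.assoc)
  have md: "t * a mod (a * m * c) = a * (t mod (m * c))" for t
    unfolding mult_mod_right by (simp only: ac_simps)
  have B: "v div (m * c) * m < a * m"
    using small[OF v] pos by simp
  have "(u * a mod (a * m * c) + v div (m * c)) * m mod (a * m * c) =
      ((a * m) * (u mod (m * c)) + v div (m * c) * m) mod (a * m * c)"
    by (simp add: md algebra_simps)
  also have "\<dots> = (a * m) * (u mod (m * c) mod c) + v div (m * c) * m"
    by (rule mod_mult_add[OF B])
  also have "u mod (m * c) mod c = u mod c"
    by (simp add: mod_mod_cancel)
  also have "(a * m) * (u mod c) = u * (a * m) mod (a * m * c)"
    unfolding mult_mod_right by (simp only: ac_simps)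
  finally have 1: "(u * a mod (a * m * c) + v div (m * c)) * m mod (a * m * c) =
      u * (a * m) mod (a * m * c) + v div (m * c) * m" .
  have "(v * a mod (a * m * c) + w div (m * c)) div (a * c) =
      (a * (v mod (m * c)) + w div (m * c)) div a div c"
    by (simp add: md div_mult2_eq)
  also have "(a * (v mod (m * c)) + w div (m * c)) div a = v mod (m * c)"
    using small[OF w] pos by simp
  finally have 2: "(v * a mod (a * m * c) + w div (m * c)) div (a * c) = v mod (m * c) div c" .
  have "v div c = (v div (m * c) * m * c + v mod (m * c)) div c"
    by (metis div_mult_mod_eq mult.assoc)
  also have "\<dots> = v div (m * c) * m + v mod (m * c) div c"
    using pos by simp
  finally show ?thesis using 1 2 by simp
qed

lemma digit_shift_funpow:
  assumes m: "0 < m" and x: "x \<in> sequences (m ^ k)" and j: "j \<le> k"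
  shows "(digit_shift m k ^^ j) x i = x i * m ^ j mod m ^ k + x (i - 1) div m ^ (k - j)"
  using j
proof (induction j arbitrary: i)
  case 0
  then show ?case using x by (simp add: mem_sequences)
next
  case (Suc j)
  define a c where "a = m ^ j" and "c = m ^ (k - Suc j)"
  have e: "m ^ k = a * m * c" "m ^ (k - 1) = a * c" "m ^ (k - j) = m * c" "m ^ Suc j = a * m"
  proof -
    have "k = j + 1 + (k - Suc j)" using Suc.prems by simp
    then have "m ^ k = m ^ (j + 1 + (k - Suc j))" by (rule arg_cong)
    then show "m ^ k = a * m * c" by (simp add: a_def c_def power_add)
    have "k - 1 = j + (k - Suc j)" using Suc.prems by simp
    then have "m ^ (k - 1) = m ^ (j + (k - Suc j))" by (rule arg_cong)
    then show "m ^ (k - 1) = a * c" by (simp add: a_def c_def power_add)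
    have "k - j = Suc (k - Suc j)" using Suc.prems by simp
    then show "m ^ (k - j) = m * c" by (simp add: c_def)
  qed (simp add: a_def)
  have lt: "x t < a * m * c" for t using x e(1) by (simp add: mem_sequences)
  have IH: "(digit_shift m k ^^ j) x t = x t * a mod (a * m * c) + x (t - 1) div (m * c)" for t
    using Suc.IH[of t] Suc.prems unfolding e(1,3) by (simp add: a_def)
  have "(digit_shift m k ^^ Suc j) x i =
      (digit_shift m k ^^ j) x i * m mod (a * m * c) + (digit_shift m k ^^ j) x (i - 1) div (a * c)"
    by (simp only: funpow.simps comp_apply digit_shift_def[of m k "(digit_shift m k ^^ j) x"] e(1,2))
  also have "\<dots> = x i * (a * m) mod (a * m * c) + x (i - 1) div c"
    unfolding IH using m by (intro digit_shift_step lt) (auto simp: a_def c_def)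
  finally show ?case unfolding e by (simp add: c_def)
qed

lemma block_code_digit_shift:
  assumes m: "0 < m" and k: "0 < k"
  shows "block_code (m ^ k) 1 (digit_shift m k)"
proof (rule block_codeI)
  fix x y :: "int \<Rightarrow> nat" assume x: "x \<in> sequences (m ^ k)" and "y \<in> sequences (m ^ k)"
  have "m ^ k = m * m ^ (k - 1)" using k by (cases k) simp_all
  then have k': "m ^ k = m * m ^ (k - 1)" .
  have "x i * m mod m ^ k + x (i - 1) div m ^ (k - 1) < m ^ k" for i
  proof -
    have 1: "x i * m mod m ^ k = m * (x i mod m ^ (k - 1))"
      unfolding k' mult_mod_right by (simp only: ac_simps)
    have "x (i - 1) < m * m ^ (k - 1)" using x k' by (simp add: mem_sequences)
    then have 2: "x (i - 1) div m ^ (k - 1) < m" using m by (simp add: div_less_iff_less_mult)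
    have 3: "x i mod m ^ (k - 1) \<le> m ^ (k - 1) - 1" using m by (simp add: Suc_leI less_eq_Suc_le[symmetric] less_Suc_eq_le[symmetric])
    have "m * (x i mod m ^ (k - 1)) \<le> m * (m ^ (k - 1) - 1)" using 3 by (rule mult_le_mono2)
    also have "\<dots> = m ^ k - m" using k' by (simp add: diff_mult_distrib2)
    finally have "x i * m mod m ^ k + x (i - 1) div m ^ (k - 1) < (m ^ k - m) + m"
      using 1 2 by linarith
    also have "\<dots> = m ^ k" using k' m by simp
    finally show ?thesis .
  qed
  then show "digit_shift m k x \<in> sequences (m ^ k)"
    by (simp add: mem_sequences digit_shift_def)
  show "digit_shift m k (translate t x) = translate t (digit_shift m k x)" for t
    by (rule ext) (simp add: digit_shift_def algebra_simps)
  assume "\<And>i. \<bar>i\<bar> \<le> 1 \<Longrightarrow> x i = y i"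
  from this[of 0] this[of "- 1"]
  show "digit_shift m k x 0 = digit_shift m k y 0"
    by (simp add: digit_shift_def)
qed simp

text \<open>After \<open>k\<close> steps every digit has moved past one whole letter, as a letter
  has \<open>k\<close> digits.\<close>

lemma digit_shift_root:
  assumes "0 < m" "x \<in> sequences (m ^ k)"
  shows "(digit_shift m k ^^ k) x = translate (- 1) x"
  by (rule ext) (simp add: digit_shift_funpow[OF assms order_refl])

lemma block_code_funpow:
  assumes "block_code n r f"
  shows "block_code n (int j * r) (f ^^ j)"
proof (induction j)
  case 0
  then show ?case using block_code_translation[of n 0] by (auto intro: block_code_cong)
next
  case (Suc j)
  show ?case
    using block_code_comp[OF Suc assms] by (simp add: algebra_simps comp_def)
qed

lemma invertible_code_digit_shift:
  assumes m: "0 < m" and k: "0 < k"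
  obtains r g where "invertible_code (m ^ k) r (digit_shift m k) g"
proof
  let ?d = "digit_shift m k" and ?r = "1 + int (k - 1) * 1 + 1"
  \<comment> \<open>Since the \<open>k\<close>-th power is the shift, the inverse is the
    \<open>(k - 1)\<close>-st power after undoing the shift.\<close>
  let ?g = "\<lambda>x. (?d ^^ (k - 1)) (translate 1 x)"
  have d: "block_code (m ^ k) 1 ?d" by (rule block_code_digit_shift[OF assms])
  have "block_code (m ^ k) (\<bar>1\<bar> + int (k - 1) * 1) ?g"
    by (rule block_code_comp[OF block_code_translation block_code_funpow[OF d]])
  then have g: "block_code (m ^ k) ?r ?g" by (rule block_code_mono) simp
  have "?g (?d x) = x \<and> ?d (?g x) = x" if x: "x \<in> sequences (m ^ k)" for x
  proof
    have r: "(?d ^^ (k - 1)) (?d y) = (?d ^^ k) y" "?d ((?d ^^ (k - 1)) y) = (?d ^^ k) y" for y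
      using k by (cases k; simp add: funpow_swap1)+
    have "?g (?d x) = (?d ^^ (k - 1)) (?d (translate 1 x))"
      using block_code_translate[OF d x] by simp
    then show "?g (?d x) = x"
      using digit_shift_root[OF m, of "translate 1 x" k] x unfolding r by simp
    show "?d (?g x) = x"
      using digit_shift_root[OF m, of "translate 1 x" k] x unfolding r by simp
  qed
  then show "invertible_code (m ^ k) ?r ?d ?g"
    using g block_code_mono[OF d, of ?r] by (simp add: invertible_code_def)
qed

lemma shift_power_mem: "restrict (translate k) (sequences n) \<in> carrier (shift_Aut n)"
  by (rule restrict_mem_shift_Aut[OF invertible_code_translate])

text \<open>The obstruction sits in the integer factor alone, so the second factor is an arbitrary
  structure \<open>L\<close>. In place of a unit of \<open>L\<close> the image
  \<open>H (S 0)\<close> of the identity is used: it acts as a unit on all values of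
  \<open>H\<close>.\<close>

theorem power_not_iso:
  fixes L :: "'a monoid"
  assumes m: "2 \<le> m" and k: "2 \<le> k" and n: "n = m ^ k"
  shows "\<not> shift_Aut n \<cong> integer_group \<times>\<times> L"
proof
  assume "shift_Aut n \<cong> integer_group \<times>\<times> L"
  then obtain h where hom: "h \<in> hom (shift_Aut n) (integer_group \<times>\<times> L)"
    and bij: "bij_betw h (carrier (shift_Aut n)) (carrier (integer_group \<times>\<times> L))"
    unfolding is_iso_def iso_def by blast
  have "2 ^ 2 \<le> m ^ 2" using m by (intro power_mono) simp_all
  also have "m ^ 2 \<le> m ^ k" using m k by (intro power_increasing) simp_all
  finally have n4: "4 \<le> n" using n by simp
  let ?A = "carrier (shift_Aut n)" and ?X = "sequences n :: (int \<Rightarrow> nat) set"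
  define F H where "F = (\<lambda>g. fst (h g))" and "H = (\<lambda>g. snd (h g))"
  have FH: "F (f \<otimes>\<^bsub>shift_Aut n\<^esub> g) = F f + F g" "H (f \<otimes>\<^bsub>shift_Aut n\<^esub> g) = H f \<otimes>\<^bsub>L\<^esub> H g"
    if "f \<in> ?A" "g \<in> ?A" for f g
    using hom_mult[OF hom that] by (auto simp: F_def H_def DirProd_def split: prod.splits)
  define S where "S = (\<lambda>j. restrict (translate j) ?X)"
  have S: "S j \<in> ?A" for j unfolding S_def by (rule shift_power_mem)
  have SS: "S i \<otimes>\<^bsub>shift_Aut n\<^esub> S j = S (i + j)" for i j
    by (subst shift_Aut_mult) (auto simp: S intro!: ext, auto simp: S_def)
  have S0: "S 0 \<otimes>\<^bsub>shift_Aut n\<^esub> f = f" "f \<otimes>\<^bsub>shift_Aut n\<^esub> S 0 = f" if f: "f \<in> ?A" for f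
  proof -
    from f obtain r f' where f': "f \<in> extensional ?X" "block_code n r f"
      by (auto simp: mem_shift_Aut_iff invertible_code_def)
    show "S 0 \<otimes>\<^bsub>shift_Aut n\<^esub> f = f" "f \<otimes>\<^bsub>shift_Aut n\<^esub> S 0 = f"
      unfolding shift_Aut_mult[OF S f] shift_Aut_mult[OF f S]
      using f'(1) block_code_mem[OF f'(2)]
      by (auto simp: S_def fun_eq_iff extensional_def)
  qed
  have F0: "F (S 0) = 0" using FH(1)[OF S S, of 0 0] SS[of 0 0] by simp
  have FS: "F (S j) = j * F (S 1)" for j
  proof (induction j rule: int_induct[where k = 0])
    case (step1 i)
    then show ?case using FH(1)[OF S S, of i 1] SS[of i 1] by (simp add: algebra_simps)
  next
    case (step2 i)
    then show ?case using FH(1)[OF S S, of "i - 1" 1] SS[of "i - 1" 1] by (simp add: algebra_simps)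
  qed (simp add: F0)
  have "(1, H (S 0)) \<in> carrier (integer_group \<times>\<times> L)"
    using hom_in_carrier[OF hom S, of 0] by (auto simp: H_def DirProd_def)
  \<comment> \<open>This pair commutes with every value of \<open>h\<close>, so its preimage is
    central.\<close>
  then obtain c where c: "c \<in> ?A" "h c = (1, H (S 0))"
    using bij by (metis bij_betw_imp_surj_on imageE)
  have comm: "c \<otimes>\<^bsub>shift_Aut n\<^esub> g = g \<otimes>\<^bsub>shift_Aut n\<^esub> c" if g: "g \<in> ?A" for g
  proof -
    have "H c = H (S 0)" using c by (simp add: H_def)
    then have "H (c \<otimes>\<^bsub>shift_Aut n\<^esub> g) = H (g \<otimes>\<^bsub>shift_Aut n\<^esub> c)"
      using FH(2)[OF c(1) g] FH(2)[OF g c(1)] FH(2)[OF S g, of 0] FH(2)[OF g S, of 0] S0[OF g] by simp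
    moreover have "F (c \<otimes>\<^bsub>shift_Aut n\<^esub> g) = F (g \<otimes>\<^bsub>shift_Aut n\<^esub> c)"
      using FH(1)[OF c(1) g] FH(1)[OF g c(1)] by simp
    ultimately have "h (c \<otimes>\<^bsub>shift_Aut n\<^esub> g) = h (g \<otimes>\<^bsub>shift_Aut n\<^esub> c)"
      by (simp add: F_def H_def prod_eq_iff)
    then show ?thesis
      using bij_betw_imp_inj_on[OF bij] shift_Aut_mult_closed c(1) g by (meson inj_onD)
  qed
  obtain r c' where c': "invertible_code n r c c'" "c \<in> extensional ?X"
    using c(1) by (auto simp: mem_shift_Aut_iff)
  have cc: "c (g x) = g (c x)" if g: "invertible_code n s g g'" and x: "x \<in> ?X"
    for s g g' and x :: "int \<Rightarrow> nat"
  proof -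
    have gA: "restrict g ?X \<in> ?A" by (rule restrict_mem_shift_Aut[OF g])
    have "g x \<in> ?X" "c x \<in> ?X"
      using invertible_codeD(6)[OF g x] invertible_codeD(6)[OF c'(1) x] .
    then show "c (g x) = g (c x)"
      using fun_cong[OF comm[OF gA], of x] x
      unfolding shift_Aut_mult[OF c(1) gA] shift_Aut_mult[OF gA c(1)] by simp
  qed
  have "\<exists>j. \<forall>x\<in>?X. c x = translate j x"
    by (rule central_block_code[OF n4 c'(1)]) (erule (1) cc)
  then obtain j where j: "\<And>x. x \<in> ?X \<Longrightarrow> c x = translate j x" by blast
  have "c = S j" using j c'(2) by (auto simp: S_def fun_eq_iff extensional_def)
  then have "F (S j) = 1" using c(2) by (simp add: F_def)
  define T where "T = (\<lambda>i. restrict (digit_shift m k ^^ i) ?X)"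
  have m0: "0 < m" and k0: "0 < k" using m k by simp_all
  obtain r g where d: "invertible_code n r (digit_shift m k) g"
    unfolding n by (rule invertible_code_digit_shift[OF m0 k0])
  have T1: "T 1 \<in> ?A" unfolding T_def using restrict_mem_shift_Aut[OF d] by simp
  have T: "T i \<in> ?A \<and> F (T i) = int i * F (T 1)" for i
  proof (induction i)
    case 0
    have "T 0 = S 0" by (simp add: T_def S_def fun_eq_iff)
    then show ?case using S F0 by simp
  next
    case (Suc i)
    have db: "block_code n (int i * r) (digit_shift m k ^^ i)"
      using d block_code_funpow unfolding invertible_code_def by blast
    have "T 1 \<otimes>\<^bsub>shift_Aut n\<^esub> T i = T (Suc i)"
      unfolding shift_Aut_mult[OF T1 conjunct1[OF Suc]]
      using block_code_mem[OF db] by (auto simp: T_def fun_eq_iff)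
    then show ?case
      using shift_Aut_mult_closed[OF T1 conjunct1[OF Suc]] FH(1)[OF T1 conjunct1[OF Suc]] Suc
      by (simp add: algebra_simps)
  qed
  have "T k = S (- 1)"
    using digit_shift_root[OF m0] by (auto simp: T_def S_def fun_eq_iff n)
  then have "int k * F (T 1) = - F (S 1)" using T[of k] FS[of "- 1"] by simp
  \<comment> \<open>From \<open>j * F (S 1) = 1\<close> and
    \<open>F (S 1) = - int k * F (T 1)\<close>.\<close>
  then have "1 = int k * (- j * F (T 1))"
    using \<open>F (S j) = 1\<close> FS[of j] by (simp add: algebra_simps)
  then have "int k dvd 1" by (rule dvdI)
  then show False using k by simp
qed

section \<open>The dimension representation\<close>

text \<open>Positions from \<open>K\<close> on are filled with the letter 0 rather than left
  undefined, so that a truncated point is again a point and can serve as a base point for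
  \<open>same_past\<close>.\<close>

definition trunc :: "int \<Rightarrow> (int \<Rightarrow> nat) \<Rightarrow> int \<Rightarrow> nat" where
  "trunc K z = (\<lambda>i. if i < K then z i else 0)"

definition same_past :: "nat \<Rightarrow> (int \<Rightarrow> nat) \<Rightarrow> (int \<Rightarrow> nat) set" where
  "same_past n x = {y \<in> sequences n. \<forall>i<0. y i = x i}"

text \<open>For all large \<open>K\<close> the quotient \<open>past_count n f K x / n\<^sup>K\<close> is the measure of the image under \<open>f\<close>
  of the local unstable set of \<open>x\<close>, which itself has measure \<open>1\<close>.\<close>

definition past_count ::
  "nat \<Rightarrow> ((int \<Rightarrow> nat) \<Rightarrow> int \<Rightarrow> nat) \<Rightarrow> int \<Rightarrow> (int \<Rightarrow> nat) \<Rightarrow> nat" where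
  "past_count n f K x = card (trunc K ` f ` same_past n x)"

lemma trunc_eq_iff: "trunc K y = trunc K z \<longleftrightarrow> (\<forall>i<K. y i = z i)"
  by (auto simp: trunc_def fun_eq_iff)

lemma trunc_trunc [simp]: "trunc K (trunc K z) = trunc K z"
  by (simp add: trunc_def fun_eq_iff)

lemma trunc_in_sequences: "0 < n \<Longrightarrow> z \<in> sequences n \<Longrightarrow> trunc K z \<in> sequences n"
  by (simp add: mem_sequences trunc_def)

lemma trunc_translate: "trunc (K + M) (translate (- K) y) = translate (- K) (trunc M y)"
  by (rule ext) (auto simp: trunc_def)

lemma same_past_subset: "same_past n x \<subseteq> sequences n"
  by (auto simp: same_past_def)

lemma same_past_self: "x \<in> sequences n \<Longrightarrow> x \<in> same_past n x"
  by (simp add: same_past_def)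

lemma same_past_cong: "(\<And>i. i < 0 \<Longrightarrow> x i = y i) \<Longrightarrow> same_past n x = same_past n y"
  by (simp add: same_past_def)

lemma past_count_cong:
  assumes "\<And>x. x \<in> sequences n \<Longrightarrow> f x = g x"
  shows "past_count n f = past_count n g"
proof (intro ext)
  fix K x
  have "f ` same_past n x = g ` same_past n x"
    using same_past_subset by (intro image_cong[OF refl] assms) blast
  then show "past_count n f K x = past_count n g K x" by (simp add: past_count_def)
qed

text \<open>Left of \<open>- r\<close> the common past already decides the image; only the finitely
  many coordinates in \<open>{- r..<K}\<close> can vary.\<close>

lemma trunc_image_subset:
  assumes f: "block_code n r f" and x: "x \<in> sequences n"
  shows "trunc K ` f ` same_past n x \<subseteq>
    (\<lambda>u i. if i < - r then trunc K (f x) i else if i < K then u i else 0) `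
      Pi\<^sub>E {- r..<K} (\<lambda>_. {..<n})"
proof
  fix z assume "z \<in> trunc K ` f ` same_past n x"
  then obtain y where y: "y \<in> same_past n x" "z = trunc K (f y)" by blast
  have yn: "y \<in> sequences n" using y same_past_subset by blast
  have lt: "f y i < n" for i using block_code_mem[OF f yn] by (simp add: mem_sequences)
  have "f y i = f x i" if "i < - r" for i
    using y that block_code_radius_nonneg[OF f]
    by (intro block_code_local[OF f yn x]) (auto simp: same_past_def)
  then have "z = (\<lambda>i. if i < - r then trunc K (f x) i
      else if i < K then restrict (f y) {- r..<K} i else 0)"
    by (auto simp: y trunc_def fun_eq_iff)
  then show "z \<in> (\<lambda>u i. if i < - r then trunc K (f x) i else if i < K then u i else 0) `
      Pi\<^sub>E {- r..<K} (\<lambda>_. {..<n})"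
    using lt by (intro image_eqI[of _ _ "restrict (f y) {- r..<K}"]) auto
qed

lemma finite_trunc_image:
  assumes f: "block_code n r f" and x: "x \<in> sequences n"
  shows "finite (trunc K ` f ` same_past n x)"
  by (rule finite_subset[OF trunc_image_subset[OF assms]]) (simp add: finite_PiE)

lemma past_count_le:
  assumes f: "block_code n r f" and x: "x \<in> sequences n"
  shows "past_count n f K x \<le> card (Pi\<^sub>E {- r..<K} (\<lambda>_. {..<n}))"
proof -
  have fin: "finite (Pi\<^sub>E {- r..<K} (\<lambda>_. {..<n}))" by (simp add: finite_PiE)
  have "past_count n f K x \<le> card ((\<lambda>u i. if i < - r then trunc K (f x) i
      else if i < K then u i else 0) ` Pi\<^sub>E {- r..<K} (\<lambda>_. {..<n}))"
    unfolding past_count_def by (rule card_mono[OF finite_imageI[OF fin] trunc_image_subset[OF assms]])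
  also have "\<dots> \<le> card (Pi\<^sub>E {- r..<K} (\<lambda>_. {..<n}))"
    by (rule card_image_le[OF fin])
  finally show ?thesis .
qed

lemma past_count_pos:
  assumes f: "block_code n r f" and x: "x \<in> sequences n"
  shows "0 < past_count n f K x"
  unfolding past_count_def using finite_trunc_image[OF assms] same_past_self[OF x]
  by (auto simp: card_gt_0_iff)

text \<open>The inverse looks at most \<open>r <= K\<close> places ahead, so the past of a preimage
  is decided by the truncation. Hence the image of a local unstable set is a union of whole
  cylinders, and counting truncations measures it.\<close>

lemma trunc_image_saturated:
  assumes f: "invertible_code n r f g" and K: "r \<le> K" and y: "y \<in> same_past n x"
    and z: "z \<in> sequences n" and eq: "trunc K z = trunc K (f y)"
  shows "z \<in> f ` same_past n x"
proof (rule image_eqI)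
  note D = invertible_codeD[OF f]
  have yn: "y \<in> sequences n" using y same_past_subset by blast
  show "z = f (g z)" using D(5)[OF z] by simp
  have "g z i = x i" if "i < 0" for i
  proof -
    have "g z i = g (f y) i"
      using eq that K by (intro block_code_local[OF D(2) z D(6)[OF yn]]) (auto simp: trunc_eq_iff)
    then show ?thesis using D(4)[OF yn] y that by (simp add: same_past_def)
  qed
  then show "g z \<in> same_past n x"
    using D(7)[OF z] by (simp add: same_past_def)
qed

text \<open>A chain rule. The image under \<open>f\<close> splits into cylinders, one for each
  truncation \<open>g\<close>; up to translation by \<open>K\<close> each is the local unstable set
  of \<open>translate K g\<close>, whose image under \<open>h\<close> is counted separately.\<close>

lemma past_count_comp:
  assumes n: "0 < n" and f: "invertible_code n r f f'" and h: "invertible_code n s h h'"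
    and K: "r \<le> K" and M: "s \<le> M" and x: "x \<in> sequences n"
  shows "past_count n (\<lambda>x. h (f x)) (K + M) x =
    (\<Sum>g\<in>trunc K ` f ` same_past n x. past_count n h M (translate K g))"
proof -
  note F = invertible_codeD[OF f] and H = invertible_codeD[OF h]
  let ?I = "trunc K ` f ` same_past n x"
  define A where "A = (\<lambda>g. trunc (K + M) ` h ` {z \<in> sequences n. trunc K z = g})"
  have I: "g \<in> sequences n" "trunc K g = g" if "g \<in> ?I" for g
    using that same_past_subset F(6) trunc_in_sequences[OF n] by force+
  have A_eq: "A g = translate (- K) ` trunc M ` h ` same_past n (translate K g)" if "g \<in> ?I" for g
  proof -
    have "{z \<in> sequences n. trunc K z = g} = translate (- K) ` same_past n (translate K g)"
    proof (intro equalityI subsetI)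
      fix z assume "z \<in> {z \<in> sequences n. trunc K z = g}"
      then have "translate K z \<in> same_past n (translate K g)"
        by (auto simp: same_past_def trunc_def)
      then show "z \<in> translate (- K) ` same_past n (translate K g)"
        by (intro image_eqI) auto
    next
      fix z assume "z \<in> translate (- K) ` same_past n (translate K g)"
      then obtain y where y: "y \<in> sequences n" "z = translate (- K) y"
          "\<And>i. i < 0 \<Longrightarrow> y i = g (i + K)"
        by (auto simp: same_past_def)
      have "trunc K z = trunc K g"
        unfolding trunc_eq_iff using y(2) y(3)[of "_ - K"] by simp
      then show "z \<in> {z \<in> sequences n. trunc K z = g}" using y I[OF that] by simp
    qed
    then have "A g = (\<lambda>y. trunc (K + M) (h (translate (- K) y))) ` same_past n (translate K g)"
      by (simp add: A_def image_image)
    also have "\<dots> = (\<lambda>y. translate (- K) (trunc M (h y))) ` same_past n (translate K g)"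
    proof (rule image_cong[OF refl])
      fix y assume "y \<in> same_past n (translate K g)"
      then have "y \<in> sequences n" using same_past_subset by blast
      then show "trunc (K + M) (h (translate (- K) y)) = translate (- K) (trunc M (h y))"
        by (simp only: block_code_translate[OF H(1)] trunc_translate)
    qed
    finally show ?thesis by (simp add: image_image)
  qed
  have inj: "inj_on (translate (- K)) B" for B :: "(int \<Rightarrow> nat) set"
    by (rule inj_on_inverseI[where g = "translate K"]) simp
  have "trunc (K + M) ` (\<lambda>x. h (f x)) ` same_past n x = (\<Union>g\<in>?I. A g)"
  proof (intro equalityI subsetI)
    fix w assume "w \<in> trunc (K + M) ` (\<lambda>x. h (f x)) ` same_past n x"
    then obtain y where y: "y \<in> same_past n x" "w = trunc (K + M) (h (f y))" by blast
    then have "f y \<in> sequences n" using same_past_subset F(6) by blast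
    then have "w \<in> A (trunc K (f y))" using y by (auto simp: A_def)
    then show "w \<in> (\<Union>g\<in>?I. A g)" using y by blast
  next
    fix w assume "w \<in> (\<Union>g\<in>?I. A g)"
    then obtain y z where y: "y \<in> same_past n x" and z: "z \<in> sequences n"
        "trunc K z = trunc K (f y)" "w = trunc (K + M) (h z)"
      by (auto simp: A_def)
    from trunc_image_saturated[OF f K y z(1,2)] z(3)
    show "w \<in> trunc (K + M) ` (\<lambda>x. h (f x)) ` same_past n x" by blast
  qed
  moreover have "card (\<Union>g\<in>?I. A g) = (\<Sum>g\<in>?I. card (A g))"
  proof (rule card_UN_disjoint)
    show "finite ?I" by (rule finite_trunc_image[OF F(1) x])
    show "\<forall>g\<in>?I. finite (A g)"
    proof
      fix g assume g: "g \<in> ?I"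
      show "finite (A g)"
        unfolding A_eq[OF g] using I(1)[OF g]
        by (intro finite_imageI[of "trunc M ` _" "translate (- K)"] finite_trunc_image[OF H(1)]) simp
    qed
    \<comment> \<open>The inverse of \<open>h\<close> has radius at most \<open>M\<close>, so the
      coordinates of \<open>h z\<close> below \<open>K + M\<close> determine those of
      \<open>z\<close> below \<open>K\<close>.\<close>
    show "\<forall>g\<in>?I. \<forall>g'\<in>?I. g \<noteq> g' \<longrightarrow> A g \<inter> A g' = {}"
    proof (intro ballI impI, rule ccontr)
      fix g g' assume g: "g \<noteq> g'" "A g \<inter> A g' \<noteq> {}"
      then obtain z z' where z: "z \<in> sequences n" "z' \<in> sequences n" "trunc K z = g" "trunc K z' = g'"
          "trunc (K + M) (h z) = trunc (K + M) (h z')"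
        by (auto simp: A_def)
      have "z i = z' i" if "i < K" for i
      proof -
        have "h' (h z) i = h' (h z') i"
          using z(5) that M
          by (intro block_code_local[OF H(2) H(6)[OF z(1)] H(6)[OF z(2)]]) (auto simp: trunc_eq_iff)
        then show ?thesis using H(4) z by simp
      qed
      then have "trunc K z = trunc K z'" by (simp add: trunc_eq_iff)
      then show False using z g by simp
    qed
  qed
  ultimately have "past_count n (\<lambda>x. h (f x)) (K + M) x = (\<Sum>g\<in>?I. card (A g))"
    by (simp add: past_count_def)
  also have "\<dots> = (\<Sum>g\<in>?I. past_count n h M (translate K g))"
    by (rule sum.cong[OF refl]) (simp add: A_eq past_count_def card_image[OF inj])
  finally show ?thesis .
qed

lemma invertible_code_id: "invertible_code n 0 (\<lambda>x. x) (\<lambda>x. x)"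
  by (auto simp: invertible_code_def intro: block_codeI)

lemma past_count_id:
  assumes x: "x \<in> sequences n" and n: "0 < n" and M: "0 \<le> M"
  shows "past_count n (\<lambda>x. x) M x = n ^ nat M"
proof -
  let ?e = "\<lambda>u i. if i < 0 then x i else if i < M then u i else 0"
  have "trunc M ` (\<lambda>x. x) ` same_past n x = ?e ` Pi\<^sub>E {0..<M} (\<lambda>_. {..<n})"
  proof
    show "trunc M ` (\<lambda>x. x) ` same_past n x \<subseteq> ?e ` Pi\<^sub>E {0..<M} (\<lambda>_. {..<n})"
    proof
      fix z assume "z \<in> trunc M ` (\<lambda>x. x) ` same_past n x"
      then obtain y where y: "y \<in> sequences n" "z = trunc M y" "\<And>i. i < 0 \<Longrightarrow> y i = x i"
        by (auto simp: same_past_def)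
      then show "z \<in> ?e ` Pi\<^sub>E {0..<M} (\<lambda>_. {..<n})"
        using M by (intro image_eqI[of _ _ "restrict y {0..<M}"])
          (auto simp: trunc_def fun_eq_iff mem_sequences)
    qed
    show "?e ` Pi\<^sub>E {0..<M} (\<lambda>_. {..<n}) \<subseteq> trunc M ` (\<lambda>x. x) ` same_past n x"
    proof
      fix z assume "z \<in> ?e ` Pi\<^sub>E {0..<M} (\<lambda>_. {..<n})"
      then obtain u where u: "u \<in> Pi\<^sub>E {0..<M} (\<lambda>_. {..<n})" "z = ?e u" by blast
      have "z i < n" for i
        using u x n PiE_mem[OF u(1), of i] by (auto simp: mem_sequences)
      then have "z \<in> same_past n x" by (auto simp: same_past_def mem_sequences u)
      moreover have "trunc M z = z" using M by (auto simp: trunc_def u fun_eq_iff)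
      ultimately show "z \<in> trunc M ` (\<lambda>x. x) ` same_past n x" by force
    qed
  qed
  moreover have "inj_on ?e (Pi\<^sub>E {0..<M} (\<lambda>_. {..<n}))"
  proof (rule inj_onI)
    fix u v assume uv: "u \<in> Pi\<^sub>E {0..<M} (\<lambda>_. {..<n})" "v \<in> Pi\<^sub>E {0..<M} (\<lambda>_. {..<n})" "?e u = ?e v"
    show "u = v"
    proof (rule PiE_ext[OF uv(1,2)])
      fix i assume "i \<in> {0..<M}"
      then show "u i = v i" using fun_cong[OF uv(3), of i] by simp
    qed
  qed
  ultimately show ?thesis
    by (simp add: past_count_def card_image card_PiE)
qed

text \<open>Refining by \<open>M\<close> places splits every cylinder into \<open>n ^ M\<close>
  cylinders; this is the chain rule with the identity as second map. So the quotient of the count by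
  \<open>n ^ K\<close> is the same for all \<open>K >= r\<close>.\<close>

lemma past_count_add:
  assumes n: "0 < n" and f: "invertible_code n r f f'" and K: "r \<le> K" and M: "0 \<le> M"
    and x: "x \<in> sequences n"
  shows "past_count n f (K + M) x = past_count n f K x * n ^ nat M"
proof -
  have "past_count n f (K + M) x =
      (\<Sum>g\<in>trunc K ` f ` same_past n x. past_count n (\<lambda>x. x) M (translate K g))"
    by (rule past_count_comp[OF n f invertible_code_id K M x])
  also have "\<dots> = (\<Sum>g\<in>trunc K ` f ` same_past n x. n ^ nat M)"
  proof (rule sum.cong[OF refl])
    fix g assume "g \<in> trunc K ` f ` same_past n x"
    then have "g \<in> sequences n"
      using same_past_subset invertible_codeD(6)[OF f] trunc_in_sequences[OF n] by force
    then show "past_count n (\<lambda>x. x) M (translate K g) = n ^ nat M"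
      by (simp add: past_count_id n M)
  qed
  finally show ?thesis by (simp add: past_count_def)
qed

text \<open>Along the image the coordinates below \<open>- r\<close> are constant, so
  \<open>R\<close> may forget them, and those from \<open>- r\<close> on do not see beyond
  \<open>- 2 * r\<close>.\<close>

lemma past_count_window:
  assumes f: "block_code n r f" and x: "x \<in> sequences n" and y: "y \<in> sequences n"
    and eq: "\<And>i. - 2 * r \<le> i \<Longrightarrow> i < 0 \<Longrightarrow> x i = y i"
  shows "past_count n f K x = past_count n f K y"
proof -
  define R where "R = (\<lambda>z i. if - r \<le> i \<and> i < K then z i else (0::nat))"
  have count: "past_count n f K x = card (R ` f ` same_past n x)" if x: "x \<in> sequences n" for x
  proof -
    have "R ` f ` same_past n x = R ` trunc K ` f ` same_past n x"
      unfolding image_image by (rule image_cong[OF refl]) (auto simp: R_def trunc_def)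
    moreover have "inj_on R (trunc K ` f ` same_past n x)"
    proof (rule inj_onI)
      fix u v assume uv: "u \<in> trunc K ` f ` same_past n x" "v \<in> trunc K ` f ` same_past n x"
        and R: "R u = R v"
      have "u i = v i" for i
      proof (cases "- r \<le> i")
        case True
        then show ?thesis using fun_cong[OF R, of i] uv by (auto simp: R_def trunc_def split: if_splits)
      next
        case False
        then show ?thesis using subsetD[OF trunc_image_subset[OF f x] uv(1)]
            subsetD[OF trunc_image_subset[OF f x] uv(2)] by auto
      qed
      then show "u = v" by (rule ext)
    qed
    ultimately show ?thesis by (simp add: past_count_def card_image)
  qed
  have sub: "R ` f ` same_past n x \<subseteq> R ` f ` same_past n y"
    if x: "x \<in> sequences n" and y: "y \<in> sequences n"
      and eq: "\<And>i. - 2 * r \<le> i \<Longrightarrow> i < 0 \<Longrightarrow> x i = y i" for x y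
  proof
    fix w assume "w \<in> R ` f ` same_past n x"
    then obtain u where u: "u \<in> same_past n x" "w = R (f u)" by blast
    have un: "u \<in> sequences n" using u same_past_subset by blast
    define v where "v = (\<lambda>i. if i < 0 then y i else u i)"
    have v: "v \<in> same_past n y" using y un by (auto simp: v_def same_past_def mem_sequences)
    then have vn: "v \<in> sequences n" using same_past_subset by blast
    have "f u i = f v i" if "- r \<le> i" for i
      using that u eq by (intro block_code_local[OF f un vn]) (auto simp: v_def same_past_def)
    then have "w = R (f v)" by (auto simp: u R_def)
    then show "w \<in> R ` f ` same_past n y" using v by blast
  qed
  have "R ` f ` same_past n x = R ` f ` same_past n y"
    using sub[OF x y eq] sub[OF y x] eq by (metis subset_antisym)
  then show ?thesis by (simp add: count x y)
qed

text \<open>A maximum principle. By the chain rule and refinement, \<open>n\<close> times the count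
  at a point is the sum of the counts at the \<open>n\<close> points obtained by appending a letter
  to its past. At a maximal point all of these are maximal, and so on; as the count sees only
  finitely many letters of the past, every point is reached.\<close>

lemma past_count_const:
  assumes n: "0 < n" and f: "invertible_code n r f f'" and K: "r \<le> K"
    and x: "x \<in> sequences n" and y: "y \<in> sequences n"
  shows "past_count n f K x = past_count n f K y"
proof -
  note F = invertible_codeD[OF f]
  have "\<forall>y. y \<in> sequences n \<longrightarrow> past_count n f K y < Suc (card (Pi\<^sub>E {- r..<K} (\<lambda>_. {..<n})))"
    using past_count_le[OF F(1)] by (simp add: less_Suc_eq_le)
  from ex_has_greatest_nat[of "\<lambda>y. y \<in> sequences n", OF x this]
  obtain x0 where x0: "x0 \<in> sequences n"
    and max: "\<And>y. y \<in> sequences n \<Longrightarrow> past_count n f K y \<le> past_count n f K x0"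
    by auto
  let ?c = "past_count n f K x0"
  have claim: "past_count n f K y = ?c"
    if "y \<in> sequences n" "\<And>i. i < - int m \<Longrightarrow> y i = x0 (i + int m)" for m y
    using that
  proof (induction m arbitrary: y)
    case 0
    then have "same_past n y = same_past n x0" by (intro same_past_cong) auto
    then show ?case by (simp add: past_count_def)
  next
    case (Suc m)
    \<comment> \<open>\<open>y'\<close> is \<open>y\<close> before the last letter of its past was
      appended, so the induction hypothesis applies to it.\<close>
    define y' where "y' = translate (- 1) y"
    have y': "y' \<in> sequences n" using Suc.prems by (simp add: y'_def)
    have c: "past_count n f K y' = ?c"
      using y' by (rule Suc.IH) (simp add: y'_def Suc.prems(2) algebra_simps)
    let ?I = "trunc 1 ` (\<lambda>x. x) ` same_past n y'"
    have fin: "finite ?I"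
      by (rule finite_trunc_image[OF invertible_codeD(1)[OF invertible_code_id] y'])
    have cardI: "card ?I = n"
      using past_count_id[OF y' n, of 1] by (simp add: past_count_def)
    have le: "past_count n f K (translate 1 g) \<le> ?c" if "g \<in> ?I" for g
    proof -
      have "g \<in> sequences n" using that same_past_subset trunc_in_sequences[OF n] by force
      then show ?thesis by (intro max) simp
    qed
    have "(\<Sum>g\<in>?I. past_count n f K (translate 1 g)) = past_count n f (1 + K) y'"
      using past_count_comp[OF n invertible_code_id f _ K y', of 1] by simp
    also have "\<dots> = (\<Sum>g\<in>?I. ?c)"
      using past_count_add[OF n f K, of 1 y'] y' cardI by (simp add: c add.commute)
    finally have sum: "(\<Sum>g\<in>?I. past_count n f K (translate 1 g)) = (\<Sum>g\<in>?I. ?c)" .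
    have all: "past_count n f K (translate 1 g) = ?c" if g: "g \<in> ?I" for g
    proof (rule ccontr)
      assume "past_count n f K (translate 1 g) \<noteq> ?c"
      then have "past_count n f K (translate 1 g) < ?c" using le[OF g] by simp
      then have "(\<Sum>g\<in>?I. past_count n f K (translate 1 g)) < (\<Sum>g\<in>?I. ?c)"
        using le g by (intro sum_strict_mono_ex1[OF fin]) blast+
      with sum show False by simp
    qed
    have "trunc 1 y' \<in> ?I" using same_past_self[OF y'] by simp
    then have "past_count n f K (translate 1 (trunc 1 y')) = ?c" by (rule all)
    moreover have "same_past n (translate 1 (trunc 1 y')) = same_past n y"
      by (rule same_past_cong) (simp add: trunc_def y'_def)
    ultimately show ?case by (simp add: past_count_def)
  qed
  have "past_count n f K y = ?c" if y: "y \<in> sequences n" for y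
  proof -
    \<comment> \<open>The window of \<open>past_count_window\<close>: \<open>w\<close> continues the
      past of \<open>x0\<close> by exactly the letters of \<open>y\<close> that the count
      sees.\<close>
    define m where "m = nat (2 * r)"
    define w where "w = (\<lambda>i. if i < - int m then x0 (i + int m) else y i)"
    have w: "w \<in> sequences n" using y x0 by (simp add: w_def mem_sequences)
    have "past_count n f K y = past_count n f K w"
      using F(3) by (intro past_count_window[OF F(1) y w]) (simp add: w_def m_def)
    also have "\<dots> = ?c" using w by (rule claim[where m = m]) (simp add: w_def)
    finally show ?thesis .
  qed
  then show ?thesis using x y by simp
qed

lemma past_count_mult:
  assumes n: "0 < n" and f: "invertible_code n r f f'" and h: "invertible_code n s h h'"
    and K: "r \<le> K" and M: "s \<le> M" and x: "x \<in> sequences n"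
  shows "past_count n (\<lambda>x. h (f x)) (K + M) x = past_count n f K x * past_count n h M x"
proof -
  have "past_count n h M (translate K g) = past_count n h M x"
    if "g \<in> trunc K ` f ` same_past n x" for g
  proof -
    have "g \<in> sequences n"
      using that same_past_subset invertible_codeD(6)[OF f] trunc_in_sequences[OF n] by force
    then show ?thesis by (intro past_count_const[OF n h M _ x]) simp
  qed
  then show ?thesis
    by (simp add: past_count_comp[OF assms]) (simp add: past_count_def)
qed

text \<open>The \<open>p\<close>-adic valuation of the quotient of the count by
  \<open>n ^ K\<close>; the point 0 is as good as any other by
  \<open>past_count_const\<close>.\<close>

definition valuation_defect ::
  "nat \<Rightarrow> nat \<Rightarrow> ((int \<Rightarrow> nat) \<Rightarrow> int \<Rightarrow> nat) \<Rightarrow> int \<Rightarrow> int" where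
  "valuation_defect n p f K =
     int (multiplicity p (past_count n f K (\<lambda>_. 0))) - K * int (multiplicity p n)"

text \<open>The \<open>p\<close>-adic valuation of the factor by which \<open>f\<close> scales the measures on unstable sets.\<close>

definition scaling_valuation :: "nat \<Rightarrow> nat \<Rightarrow> ((int \<Rightarrow> nat) \<Rightarrow> int \<Rightarrow> nat) \<Rightarrow> int" where
  "scaling_valuation n p f =
     valuation_defect n p f (SOME K. \<exists>f'. invertible_code n K f f')"

lemma invertible_code_mono:
  "invertible_code n r f f' \<Longrightarrow> r \<le> s \<Longrightarrow> invertible_code n s f f'"
  by (auto simp: invertible_code_def intro: block_code_mono)

text \<open>The radius chosen by \<open>SOME\<close> and the given \<open>K\<close> are unrelated;
  both defects are compared with the one at their maximum, using refinement.\<close>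

lemma scaling_valuation_eq:
  assumes n: "0 < n" and p: "prime p" and f: "invertible_code n r f f'" and K: "r \<le> K"
  shows "scaling_valuation n p f = valuation_defect n p f K"
proof -
  have 0: "(\<lambda>_. 0) \<in> sequences n" using n by (simp add: mem_sequences)
  have step: "valuation_defect n p f L = valuation_defect n p f K"
    if f: "invertible_code n L f g" and "L \<le> K" for K L g
  proof -
    have "past_count n f (L + (K - L)) (\<lambda>_. 0) = past_count n f L (\<lambda>_. 0) * n ^ nat (K - L)"
      using that by (intro past_count_add[OF n f _ _ 0]) simp_all
    moreover have "past_count n f L (\<lambda>_. 0) > 0"
      by (rule past_count_pos[OF invertible_codeD(1)[OF f] 0])
    ultimately have "multiplicity p (past_count n f K (\<lambda>_. 0)) =
        multiplicity p (past_count n f L (\<lambda>_. 0)) + nat (K - L) * multiplicity p n"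
      using n p by (simp add: prime_elem_multiplicity_mult_distrib prime_elem_multiplicity_power_distrib)
    then show ?thesis using that(2) by (simp add: valuation_defect_def algebra_simps)
  qed
  define L where "L = (SOME K. \<exists>f'. invertible_code n K f f')"
  have "\<exists>f'. invertible_code n L f f'"
    unfolding L_def by (rule someI) (use f in blast)
  then obtain g where g: "invertible_code n L f g" by blast
  have "valuation_defect n p f L = valuation_defect n p f (max L K)"
    by (rule step[OF g]) simp
  also have "\<dots> = valuation_defect n p f K"
    by (rule step[symmetric, OF invertible_code_mono[OF f K]]) simp
  finally show ?thesis by (simp add: scaling_valuation_def L_def)
qed

lemma scaling_valuation_comp:
  assumes n: "0 < n" and p: "prime p" and f: "invertible_code n r f f'" and h: "invertible_code n s h h'"
  shows "scaling_valuation n p (\<lambda>x. h (f x)) = scaling_valuation n p f + scaling_valuation n p h"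
proof -
  have 0: "(\<lambda>_. 0) \<in> sequences n" using n by (simp add: mem_sequences)
  have "multiplicity p (past_count n (\<lambda>x. h (f x)) (r + s) (\<lambda>_. 0)) =
      multiplicity p (past_count n f r (\<lambda>_. 0)) + multiplicity p (past_count n h s (\<lambda>_. 0))"
    unfolding past_count_mult[OF n f h order_refl order_refl 0]
    using p past_count_pos[OF invertible_codeD(1)[OF f] 0] past_count_pos[OF invertible_codeD(1)[OF h] 0]
    by (simp add: prime_elem_multiplicity_mult_distrib)
  then show ?thesis
    by (simp add: scaling_valuation_eq[OF n p f order_refl] scaling_valuation_eq[OF n p h order_refl]
        scaling_valuation_eq[OF n p invertible_code_comp[OF f h] order_refl] valuation_defect_def
        algebra_simps)
qed

text \<open>After the shift all coordinates below 1 come from the past, so at \<open>K = 1\<close>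
  there is a single truncation and the measure is \<open>1 / n\<close>.\<close>

lemma scaling_valuation_shift:
  assumes n: "0 < n" and p: "prime p"
  shows "scaling_valuation n p (translate (- 1)) = - int (multiplicity p n)"
proof -
  have 0: "(\<lambda>_. 0) \<in> sequences n" using n by (simp add: mem_sequences)
  have inv: "invertible_code n 1 (translate (- 1)) (translate 1)"
    using invertible_code_translate[of n "- 1"] by simp
  have "trunc 1 ` translate (- 1) ` same_past n (\<lambda>_. 0) = {\<lambda>_. 0}"
    using same_past_self[OF 0] by (force simp: trunc_def fun_eq_iff same_past_def)
  then have "past_count n (translate (- 1)) 1 (\<lambda>_. 0) = 1"
    by (simp add: past_count_def)
  then show ?thesis
    by (simp add: scaling_valuation_eq[OF n p inv order_refl] valuation_defect_def)
qed

section \<open>Combining the valuations into one integer\<close>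

lemma bezout_finite:
  fixes a :: "'a \<Rightarrow> int"
  assumes "finite S"
  shows "\<exists>b. (\<Sum>p\<in>S. b p * a p) = Gcd (a ` S)"
  using assms
proof (induction S)
  case (insert x S)
  then obtain b where b: "(\<Sum>p\<in>S. b p * a p) = Gcd (a ` S)" by blast
  obtain u v where uv: "u * a x + v * Gcd (a ` S) = gcd (a x) (Gcd (a ` S))"
    using bezout_int by blast
  have "(\<Sum>p\<in>insert x S. (if p = x then u else v * b p) * a p) =
      u * a x + (\<Sum>p\<in>S. (if p = x then u else v * b p) * a p)"
    using insert.hyps by simp
  also have "(\<Sum>p\<in>S. (if p = x then u else v * b p) * a p) = (\<Sum>p\<in>S. v * (b p * a p))"
    using insert.hyps by (intro sum.cong) auto
  also have "\<dots> = v * Gcd (a ` S)" by (simp add: b flip: sum_distrib_left)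
  finally have "(\<Sum>p\<in>insert x S. (if p = x then u else v * b p) * a p) = Gcd (a ` insert x S)"
    using uv by simp
  then show ?case by (rule exI[of _ "\<lambda>p. if p = x then u else v * b p"])
qed simp

text \<open>Dividing all exponents of the prime factorization by a common divisor
  \<open>d >= 2\<close> would produce a \<open>d\<close>-th root of \<open>n\<close>.\<close>

lemma Gcd_multiplicities:
  assumes n: "2 \<le> n" and np: "\<not> power_of_smaller n"
  shows "Gcd ((\<lambda>p. int (multiplicity p n)) ` prime_factors n) = 1"
proof -
  let ?P = "prime_factors n"
  define d where "d = Gcd ((\<lambda>p. multiplicity p n) ` ?P)"
  have dvd: "d dvd multiplicity p n" if "p \<in> ?P" for p
    unfolding d_def using that by (intro Gcd_dvd) simp
  obtain q where q: "prime q" "q dvd n" using prime_factor_nat[of n] n by auto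
  have qP: "q \<in> ?P" using q n by (simp add: in_prime_factors_iff)
  have "multiplicity q n > 0"
    using q n by (simp add: prime_multiplicity_gt_zero_iff)
  then have "d \<noteq> 0" using dvd[OF qP] by auto
  moreover have "\<not> 2 \<le> d"
  proof
    assume d: "2 \<le> d"
    define m where "m = (\<Prod>p\<in>?P. p ^ (multiplicity p n div d))"
    have "m ^ d = (\<Prod>p\<in>?P. p ^ multiplicity p n)"
      unfolding m_def prod_power_distrib using dvd
      by (intro prod.cong) (auto simp flip: power_mult)
    also have "\<dots> = n" using n by (intro prime_factorization_nat[symmetric]) simp
    finally have md: "m ^ d = n" .
    have "2 \<le> m"
    proof (rule ccontr)
      assume "\<not> 2 \<le> m"
      then have "m = 0 \<or> m = 1" by linarith
      then show False using md d n by (auto simp: power_0_left)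
    qed
    then have "m ^ 1 < m ^ d" using d by (intro power_strict_increasing) simp_all
    then have "power_of_smaller n"
      unfolding power_of_smaller_def using md d \<open>2 \<le> m\<close> by (intro exI[of _ m] exI[of _ d]) simp
    with np show False ..
  qed
  ultimately have "d = 1" by linarith
  moreover have "Gcd ((\<lambda>p. int (multiplicity p n)) ` ?P) = int d"
    unfolding d_def Gcd_int_eq[symmetric] by (simp only: image_image)
  ultimately show ?thesis by simp
qed

text \<open>The third property makes \<open>D\<close> usable on group elements: these are
  restrictions, which agree with composites of codes on \<open>sequences n\<close> only.\<close>

theorem integer_valued_hom:
  assumes n: "2 \<le> n" and np: "\<not> power_of_smaller n"
  obtains D :: "((int \<Rightarrow> nat) \<Rightarrow> int \<Rightarrow> nat) \<Rightarrow> int"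
  where "\<And>r f f' s g g'. invertible_code n r f f' \<Longrightarrow> invertible_code n s g g' \<Longrightarrow>
      D (\<lambda>x. g (f x)) = D f + D g"
    and "D (translate (- 1)) = 1"
    and "\<And>r f f' g. invertible_code n r f f' \<Longrightarrow> (\<And>x. x \<in> sequences n \<Longrightarrow> f x = g x) \<Longrightarrow> D f = D g"
proof -
  let ?P = "prime_factors n"
  have n0: "0 < n" using n by simp
  obtain b where b: "(\<Sum>p\<in>?P. b p * int (multiplicity p n)) = 1"
    using bezout_finite[of ?P "\<lambda>p. int (multiplicity p n)"] Gcd_multiplicities[OF assms] by auto
  \<comment> \<open>The sign is there because the shift has valuations
    \<open>- multiplicity p n\<close>.\<close>
  define D where "D = (\<lambda>f. - (\<Sum>p\<in>?P. b p * scaling_valuation n p f))"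
  have P: "prime p" if "p \<in> ?P" for p using that by auto
  show ?thesis
  proof
    show "D (\<lambda>x. g (f x)) = D f + D g"
      if f: "invertible_code n r f f'" and g: "invertible_code n s g g'" for r f f' s g g'
    proof -
      have "(\<Sum>p\<in>?P. b p * scaling_valuation n p (\<lambda>x. g (f x))) =
          (\<Sum>p\<in>?P. b p * scaling_valuation n p f + b p * scaling_valuation n p g)"
        by (rule sum.cong[OF refl])
          (simp add: scaling_valuation_comp[OF n0 P f g] distrib_left)
      then show ?thesis by (simp add: D_def sum.distrib)
    qed
    have "(\<Sum>p\<in>?P. b p * scaling_valuation n p (translate (- 1))) =
        (\<Sum>p\<in>?P. - (b p * int (multiplicity p n)))"
      by (rule sum.cong[OF refl]) (simp add: scaling_valuation_shift[OF n0 P])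
    then show "D (translate (- 1)) = 1" using b by (simp add: D_def sum_negf)
    show "D f = D g"
      if f: "invertible_code n r f f'" and eq: "\<And>x. x \<in> sequences n \<Longrightarrow> f x = g x" for r f f' g
    proof -
      have g: "invertible_code n r g f'" by (rule invertible_code_cong[OF f]) (simp add: eq)
      have "scaling_valuation n p f = scaling_valuation n p g" if "p \<in> ?P" for p
        using past_count_cong[of n f g, OF eq]
        by (simp add: scaling_valuation_eq[OF n0 P[OF that] f order_refl]
            scaling_valuation_eq[OF n0 P[OF that] g order_refl] valuation_defect_def)
      then show ?thesis by (simp add: D_def)
    qed
  qed
qed

section \<open>Transducers and reduction\<close>

lemma words_Nil [simp]: "[] \<in> words n"
  and words_Cons [simp]: "a # w \<in> words n \<longleftrightarrow> a < n \<and> w \<in> words n"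
  and words_append [simp]: "v @ w \<in> words n \<longleftrightarrow> v \<in> words n \<and> w \<in> words n"
  by (auto simp: words_def)

lemma prefix_in_words [simp]: "v \<in> sequences n \<Longrightarrow> prefix k v \<in> words n"
  by (auto simp: words_def mem_sequences)

lemma conc_in_sequences [simp]: "w \<in> words n \<Longrightarrow> v \<in> sequences n \<Longrightarrow> w \<frown> v \<in> sequences n"
  by (auto simp: words_def mem_sequences conc_def subset_iff lists_eq_set)

lemma suffix_in_sequences [simp]: "v \<in> sequences n \<Longrightarrow> suffix k v \<in> sequences n"
  by (simp add: mem_sequences)

lemma prefix_eq_iff: "prefix k u = prefix k v \<longleftrightarrow> (\<forall>i<k. u i = v i)"
  by (auto simp: subsequence_def)

text \<open>The greatest common prefix of all values of \<open>f\<close> has length exactly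
  \<open>l\<close>. Stated for maps instead of states, since it is also applied to a state map after
  a fixed first letter of the input.\<close>

definition branches_at :: "nat \<Rightarrow> (nat word \<Rightarrow> nat word) \<Rightarrow> nat \<Rightarrow> bool" where
  "branches_at n f l \<longleftrightarrow> (\<forall>v\<in>sequences n. \<forall>w\<in>sequences n. \<forall>i<l. f v i = f w i) \<and>
     (\<exists>v\<in>sequences n. \<exists>w\<in>sequences n. f v l \<noteq> f w l)"

definition nonconstant :: "nat \<Rightarrow> (nat word \<Rightarrow> nat word) \<Rightarrow> bool" where
  "nonconstant n f \<longleftrightarrow> (\<exists>v\<in>sequences n. \<exists>w\<in>sequences n. f v \<noteq> f w)"

text \<open>The extent of incomplete response as a natural number, meaningful for a nonconstant map;
  constant maps have infinite extent.\<close>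

definition response :: "nat \<Rightarrow> (nat word \<Rightarrow> nat word) \<Rightarrow> nat" where
  "response n f = (LEAST l. \<exists>v\<in>sequences n. \<exists>w\<in>sequences n. f v l \<noteq> f w l)"

lemma branches_at_response: "nonconstant n f \<Longrightarrow> branches_at n f (response n f)"
proof -
  assume "nonconstant n f"
  then have "\<exists>l. \<exists>v\<in>sequences n. \<exists>w\<in>sequences n. f v l \<noteq> f w l"
    by (auto simp: nonconstant_def fun_eq_iff)
  then have "\<exists>v\<in>sequences n. \<exists>w\<in>sequences n. f v (response n f) \<noteq> f w (response n f)"
    unfolding response_def by (rule LeastI_ex)
  moreover have "f v i = f w i" if "v \<in> sequences n" "w \<in> sequences n" "i < response n f" for v w i
    using not_less_Least[OF that(3)[unfolded response_def]] that(1,2) by blast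
  ultimately show ?thesis unfolding branches_at_def by blast
qed

lemma branches_atD:
  assumes "branches_at n f l"
  shows "v \<in> sequences n \<Longrightarrow> w \<in> sequences n \<Longrightarrow> i < l \<Longrightarrow> f v i = f w i"
    and "\<exists>v\<in>sequences n. \<exists>w\<in>sequences n. f v l \<noteq> f w l"
  using assms unfolding branches_at_def by blast+

lemma branches_at_unique:
  assumes "branches_at n f k" "branches_at n f l"
  shows "k = l"
proof (rule ccontr)
  assume "k \<noteq> l"
  then consider "k < l" | "l < k" by linarith
  then show False
  proof cases
    case 1 then show ?thesis using branches_atD(1)[OF assms(2)] branches_atD(2)[OF assms(1)] by blast
  next
    case 2 then show ?thesis using branches_atD(1)[OF assms(1)] branches_atD(2)[OF assms(2)] by blast
  qed
qed

lemma branches_at_nonconstant: "branches_at n f l \<Longrightarrow> nonconstant n f"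
  using branches_atD(2)[of n f l] by (force simp: nonconstant_def)

lemma branches_at_eq_response: "branches_at n f l \<Longrightarrow> response n f = l"
  using branches_at_unique branches_at_response branches_at_nonconstant by blast

lemma branches_at_conc:
  assumes "branches_at n f l" "\<And>v. v \<in> sequences n \<Longrightarrow> g v = u \<frown> f v"
  shows "branches_at n g (length u + l)"
proof -
  have "g v i = g w i" if "v \<in> sequences n" "w \<in> sequences n" "i < length u + l" for v w i
    unfolding assms(2)[OF that(1)] assms(2)[OF that(2)] conc_def
    using branches_atD(1)[OF assms(1) that(1,2), of "i - length u"] that(3) by auto
  moreover obtain v w where "v \<in> sequences n" "w \<in> sequences n" "f v l \<noteq> f w l"
    using assms(1) unfolding branches_at_def by blast
  moreover from this have "g v (length u + l) \<noteq> g w (length u + l)"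
    by (simp add: assms(2))
  ultimately show ?thesis unfolding branches_at_def by blast
qed

lemma branches_at_shift:
  assumes "branches_at n f l" "\<And>v. v \<in> sequences n \<Longrightarrow> g v = (\<lambda>i. f v (l + i))"
  shows "branches_at n g 0"
proof -
  obtain v w where vw: "v \<in> sequences n" "w \<in> sequences n" "f v l \<noteq> f w l"
    using branches_atD(2)[OF assms(1)] by blast
  then have "g v 0 \<noteq> g w 0" by (simp add: assms(2))
  then show ?thesis using vw(1,2) unfolding branches_at_def by blast
qed

lemma gcp_length_branches_at:
  assumes "branches_at n f l"
  shows "gcp_length (f ` sequences n) = enat l"
proof -
  have eq: "(\<forall>u\<in>f ` sequences n. \<forall>v\<in>f ` sequences n. prefix k u = prefix k v) \<longleftrightarrow> k \<le> l" for k
  proof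
    assume "\<forall>u\<in>f ` sequences n. \<forall>v\<in>f ` sequences n. prefix k u = prefix k v"
    then have "\<forall>v\<in>sequences n. \<forall>w\<in>sequences n. \<forall>i<k. f v i = f w i"
      unfolding prefix_eq_iff by blast
    then show "k \<le> l"
      using branches_atD(2)[OF assms] by (metis not_le_imp_less)
  next
    assume "k \<le> l"
    then show "\<forall>u\<in>f ` sequences n. \<forall>v\<in>f ` sequences n. prefix k u = prefix k v"
      unfolding prefix_eq_iff ball_simps
      using branches_atD(1)[OF assms] by (metis less_le_trans)
  qed
  show ?thesis
    unfolding gcp_length_def eq by (rule antisym) (auto intro!: Sup_least Sup_upper)
qed

lemma gcp_length_constant:
  assumes "\<not> nonconstant n f"
  shows "gcp_length (f ` sequences n) = \<infinity>"
proof -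
  have "\<forall>u\<in>f ` sequences n. \<forall>v\<in>f ` sequences n. prefix k u = prefix k v" for k
    unfolding ball_simps using assms unfolding nonconstant_def by metis
  then have "enat k \<le> gcp_length (f ` sequences n)" for k
    unfolding gcp_length_def by (intro Sup_upper) blast
  then show ?thesis
    by (metis Suc_ile_eq enat.exhaust less_irrefl)
qed

lemma gcp_branches_at:
  assumes f: "branches_at n f l" and v: "v \<in> sequences n"
  shows "gcp (f ` sequences n) = prefix l (f v)"
proof -
  have "(SOME u. u \<in> f ` sequences n) \<in> f ` sequences n"
    by (rule someI[of _ "f v"]) (use v in simp)
  then obtain w where w: "w \<in> sequences n" "(SOME u. u \<in> f ` sequences n) = f w" by blast
  show ?thesis
    unfolding gcp_def gcp_length_branches_at[OF f] the_enat.simps w(2) prefix_eq_iff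
    using branches_atD(1)[OF f w(1) v] by blast
qed

lemma continuations_eq: "continuations n T w q = (\<lambda>x. state_map T q (w \<frown> x)) ` sequences n"
  by (auto simp: continuations_def)

lemma extent_eq:
  "extent n T q = (if nonconstant n (state_map T q) then enat (response n (state_map T q)) else \<infinity>)"
  using gcp_length_branches_at[OF branches_at_response, of n "state_map T q"]
    gcp_length_constant[of n "state_map T q"]
  by (simp add: extent_def continuations_eq)

lemma incomplete_response_iff:
  "\<not> incomplete_response n T q \<longleftrightarrow> branches_at n (state_map T q) 0"
  using branches_at_response[of n "state_map T q"]
  by (auto simp: incomplete_response_def extent_eq zero_enat_def branches_at_eq_response
      branches_at_nonconstant)

text \<open>\<open>u\<close> and \<open>u'\<close> are both the greatest common prefix of one map,
  so they have the same length and can be cancelled.\<close>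

lemma conc_branches_unique:
  assumes f: "branches_at n f 0" and g: "branches_at n g 0"
    and eq: "\<And>v. v \<in> sequences n \<Longrightarrow> u \<frown> f v = u' \<frown> g v"
  shows "u = u' \<and> (\<forall>v\<in>sequences n. f v = g v)"
proof -
  define F where "F = (\<lambda>v. u \<frown> f v)"
  have F1: "branches_at n F (length u + 0)"
    by (rule branches_at_conc[OF f]) (simp add: F_def)
  have F2: "branches_at n F (length u' + 0)"
    by (rule branches_at_conc[OF g]) (simp add: F_def eq)
  have len: "length u = length u'" using branches_at_unique[OF F1 F2] by simp
  then have *: "u = u' \<and> f v = g v" if "v \<in> sequences n" for v
    using eq[OF that] by (auto simp: concat_eq)
  moreover obtain v :: "nat word" where "v \<in> sequences n" using f unfolding branches_at_def by blast
  ultimately show ?thesis by blast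
qed

subsection \<open>Productive transducers\<close>

text \<open>The consequence of the loop condition that matters: output grows without bound. In this
  form it can be followed through products and through the removal of incomplete response.\<close>

definition productive :: "nat \<Rightarrow> 'q transducer \<Rightarrow> bool" where
  "productive n T \<longleftrightarrow>
     (\<forall>q\<in>states T. \<forall>a<n. next_state T a q \<in> states T \<and> out T a q \<in> words n) \<and>
     (\<forall>q\<in>states T. \<forall>v\<in>sequences n. \<forall>m. \<exists>k. m \<le> length (out_word T (prefix k v) q))"

lemma productive_next: "productive n T \<Longrightarrow> q \<in> states T \<Longrightarrow> a < n \<Longrightarrow> next_state T a q \<in> states T"
  and productive_out: "productive n T \<Longrightarrow> q \<in> states T \<Longrightarrow> a < n \<Longrightarrow> out T a q \<in> words n"
  and productive_length: "productive n T \<Longrightarrow> q \<in> states T \<Longrightarrow> v \<in> sequences n \<Longrightarrow>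
    \<exists>k. m \<le> length (out_word T (prefix k v) q)"
  by (simp_all add: productive_def)

lemma productive_words:
  assumes "productive n T" "w \<in> words n" "q \<in> states T"
  shows "next_state_word T w q \<in> states T" "out_word T w q \<in> words n"
  using assms(2,3)
  by (induction w arbitrary: q) (use assms(1) in \<open>simp_all add: productive_next productive_out\<close>)

lemma state_map_nth:
  assumes "i < length (out_word T (prefix k v) q)"
  shows "state_map T q v i = out_word T (prefix k v) q ! i"
  by (subst out_word_prefix) (use assms in simp)

lemma state_map_conc:
  assumes T: "productive n T" and q: "q \<in> states T" and w: "w \<in> words n" and v: "v \<in> sequences n"
  shows "state_map T q (w \<frown> v) = out_word T w q \<frown> state_map T (next_state_word T w q) v"
proof
  fix i
  obtain k where k: "Suc i \<le> length (out_word T (prefix k v) (next_state_word T w q))"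
    using productive_length[OF T productive_words(1)[OF T w q] v] by blast
  have o: "out_word T (prefix (length w + k) (w \<frown> v)) q =
      out_word T w q @ out_word T (prefix k v) (next_state_word T w q)"
    by (simp add: out_word_append)
  have "state_map T q (w \<frown> v) i = (out_word T w q @ out_word T (prefix k v) (next_state_word T w q)) ! i"
    using k state_map_nth[of i T "w \<frown> v" "length w + k" q] unfolding o by simp
  then show "state_map T q (w \<frown> v) i = (out_word T w q \<frown> state_map T (next_state_word T w q) v) i"
    using k by (auto simp: nth_append conc_def state_map_nth[of _ T v k])
qed

lemma state_map_in_sequences:
  assumes T: "productive n T" and q: "q \<in> states T" and v: "v \<in> sequences n"
  shows "state_map T q v \<in> sequences n"
  unfolding mem_sequences
proof
  fix i
  obtain k where k: "Suc i \<le> length (out_word T (prefix k v) q)"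
    using productive_length[OF T q v] by blast
  then have "state_map T q v i \<in> set (out_word T (prefix k v) q)"
    by (simp add: state_map_nth[of i T v k])
  then show "state_map T q v i < n"
    using productive_words(2)[OF T prefix_in_words[OF v] q] by (auto simp: words_def)
qed

lemma state_map_eqI:
  assumes "\<And>i. \<exists>k. i < length (out_word T (prefix k v) q) \<and> out_word T (prefix k v) q ! i = f i"
  shows "state_map T q v = f"
proof
  show "state_map T q v i = f i" for i
    using assms[of i] state_map_nth[of i T v _ q] by auto
qed

lemma is_transducer_productive:
  assumes "is_transducer n T"
  shows "productive n T"
proof -
  have closed: "next_state T a q \<in> states T" "out T a q \<in> words n" if "q \<in> states T" "a < n" for q a
    using assms that unfolding is_transducer_def by blast+
  have nonempty: "out_word T w q \<noteq> []"
    if "q \<in> states T" "w \<in> words n" "w \<noteq> []" "next_state_word T w q = q" for w q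
    using assms that unfolding is_transducer_def by blast
  have mem: "next_state_word T w q \<in> states T" if "q \<in> states T" "w \<in> words n" for w q
    using that by (induction w arbitrary: q) (simp_all add: closed)
  have "\<exists>k. m \<le> length (out_word T (prefix k v) q)"
    if q: "q \<in> states T" and v: "v \<in> sequences n" for q v m
  proof (induction m)
    case (Suc m)
    then obtain k where k: "m \<le> length (out_word T (prefix k v) q)" by blast
    \<comment> \<open>Among the states visited after \<open>k\<close> letters one repeats; the input
      between two visits is a loop and must produce output.\<close>
    define s where "s = (\<lambda>i. next_state_word T (prefix (k + i) v) q)"
    have "range s \<subseteq> states T" unfolding s_def using mem[OF q prefix_in_words[OF v]] by blast
    then have "finite (range s)"
      using assms finite_subset unfolding is_transducer_def by blast
    then have "\<not> inj s" using finite_imageD infinite_UNIV_nat by blast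
    then obtain i j where ij: "i < j" "s i = s j"
      unfolding inj_def by (metis linorder_neqE_nat)
    define u where "u = v [k + i \<rightarrow> k + j]"
    have split: "prefix (k + i) v = prefix k v @ (v [k \<rightarrow> k + i])"
      "prefix (k + j) v = prefix (k + i) v @ u"
      using subsequence_append[of v k i] subsequence_append[of v "k + i" "j - i"] ij
      by (simp_all add: u_def)
    have "next_state_word T u (s i) = s i"
      using ij unfolding s_def split(2) next_state_word_append by simp
    moreover have "s i \<in> states T" using \<open>range s \<subseteq> states T\<close> by blast
    moreover have "u \<in> words n" "u \<noteq> []"
      using v ij by (auto simp: u_def words_def mem_sequences)
    ultimately have "out_word T u (s i) \<noteq> []" using nonempty by blast
    moreover have "out_word T (prefix (k + j) v) q = out_word T (prefix k v) q @
        out_word T (v [k \<rightarrow> k + i]) (next_state_word T (prefix k v) q) @ out_word T u (s i)"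
      unfolding split(2) s_def out_word_append unfolding split(1) out_word_append by simp
    ultimately have "Suc m \<le> length (out_word T (prefix (k + j) v) q)"
      using k by (cases "out_word T u (s i)") simp_all
    then show ?case by blast
  qed simp
  then show ?thesis unfolding productive_def using closed by blast
qed

definition responsive :: "nat \<Rightarrow> 'q transducer \<Rightarrow> bool" where
  "responsive n T \<longleftrightarrow> productive n T \<and> (\<forall>q\<in>states T. branches_at n (state_map T q) 0)"

lemma responsive_productive: "responsive n T \<Longrightarrow> productive n T"
  by (simp add: responsive_def)

text \<open>As the next state has no incomplete response, the output on a letter is exactly the
  common prefix of all outputs on inputs beginning with that letter, so it can be read off from the
  state map.\<close>

lemma omega_equivalent_step:
  assumes T: "responsive n T" and U: "responsive n U" and p: "p \<in> states T" and q: "q \<in> states U"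
    and pq: "omega_equivalent n T p U q" and a: "a < n"
  shows "out T a p = out U a q \<and> omega_equivalent n T (next_state T a p) U (next_state U a q)"
proof -
  note pT = responsive_productive[OF T] and pU = responsive_productive[OF U]
  have "branches_at n (state_map T (next_state T a p)) 0" "branches_at n (state_map U (next_state U a q)) 0"
    using T U productive_next[OF pT p a] productive_next[OF pU q a] unfolding responsive_def by blast+
  moreover have "out T a p \<frown> state_map T (next_state T a p) v =
      out U a q \<frown> state_map U (next_state U a q) v" if v: "v \<in> sequences n" for v
  proof -
    have a': "[a] \<in> words n" using a by simp
    have "state_map T p ([a] \<frown> v) = state_map U q ([a] \<frown> v)"
      using pq conc_in_sequences[OF a' v] unfolding omega_equivalent_def by blast
    then show ?thesis
      unfolding state_map_conc[OF pT p a' v] state_map_conc[OF pU q a' v] by simp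
  qed
  ultimately show ?thesis
    using conc_branches_unique unfolding omega_equivalent_def by blast
qed

subsection \<open>Removing incomplete response\<close>

lemma next_state_word_remove [simp]:
  "next_state_word (remove_incomplete_response n C) w q = next_state_word C w q"
  by (induction w arbitrary: q) (simp_all add: remove_incomplete_response_def)

lemma remove_incomplete_response_simps [simp]:
  "states (remove_incomplete_response n C) = states C"
  "next_state (remove_incomplete_response n C) = next_state C"
  by (simp_all add: remove_incomplete_response_def)

context
  fixes n :: nat and C :: "'q transducer"
  assumes C: "productive n C"
    and nonconst: "\<And>q. q \<in> states C \<Longrightarrow> nonconstant n (state_map C q)"
begin

text \<open>The new output on \<open>a\<close> is the stretch of the total output between the common
  prefix known before reading \<open>a\<close> and the one known afterwards. The lengths are related
  by sums to avoid subtraction of natural numbers.\<close>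

lemma out_remove:
  assumes q: "q \<in> states C" and a: "a < n" and v: "v \<in> sequences n"
  defines "q' \<equiv> next_state C a q"
  shows "length (out (remove_incomplete_response n C) a q) + response n (state_map C q) =
      length (out C a q) + response n (state_map C q')"
    and "i < length (out (remove_incomplete_response n C) a q) \<Longrightarrow>
      out (remove_incomplete_response n C) a q ! i =
        state_map C q ([a] \<frown> v) (response n (state_map C q) + i)"
proof -
  let ?l = "\<lambda>q. response n (state_map C q)"
  have a': "[a] \<in> words n" using a by simp
  have q': "q' \<in> states C" unfolding q'_def by (rule productive_next[OF C q a])
  have b: "branches_at n (\<lambda>x. state_map C q ([a] \<frown> x)) (length (out C a q) + ?l q')"
    using state_map_conc[OF C q a'] q'_def
    by (intro branches_at_conc[OF branches_at_response[OF nonconst[OF q']]]) simp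
  have bq: "branches_at n (state_map C q) (?l q)"
    by (rule branches_at_response[OF nonconst[OF q]])
  \<comment> \<open>Reading \<open>a\<close> can only lengthen the common prefix, as fewer
    continuations remain.\<close>
  have le: "?l q \<le> length (out C a q) + ?l q'"
  proof (rule ccontr)
    assume "\<not> ?l q \<le> length (out C a q) + ?l q'"
    moreover obtain x y where "x \<in> sequences n" "y \<in> sequences n"
      "state_map C q ([a] \<frown> x) (length (out C a q) + ?l q') \<noteq>
        state_map C q ([a] \<frown> y) (length (out C a q) + ?l q')"
      using b unfolding branches_at_def by blast
    ultimately show False
      using bq conc_in_sequences[OF a'] unfolding branches_at_def by (meson not_le_imp_less)
  qed
  have L: "Lambda n C [a] q = prefix (length (out C a q) + ?l q') (state_map C q ([a] \<frown> v))"
    unfolding Lambda_def continuations_eq by (rule gcp_branches_at[OF b v])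
  have "Lambda n C [] q = prefix (?l q) (state_map C q v)"
    unfolding Lambda_def continuations_eq using gcp_branches_at[OF bq v] by simp
  then have "length (Lambda n C [] q) = ?l q" by simp
  then have o: "out (remove_incomplete_response n C) a q = drop (?l q) (Lambda n C [a] q)"
    by (simp add: remove_incomplete_response_def)
  show "length (out (remove_incomplete_response n C) a q) + ?l q = length (out C a q) + ?l q'"
    unfolding o L using le by simp
  show "i < length (out (remove_incomplete_response n C) a q) \<Longrightarrow>
      out (remove_incomplete_response n C) a q ! i = state_map C q ([a] \<frown> v) (?l q + i)"
    unfolding o L by simp
qed

text \<open>Along a word the responses telescope: those of intermediate states cancel.\<close>

lemma out_word_remove:
  assumes "q \<in> states C" "w \<in> words n" "v \<in> sequences n"
  shows "length (out_word (remove_incomplete_response n C) w q) + response n (state_map C q) =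
      length (out_word C w q) + response n (state_map C (next_state_word C w q)) \<and>
    (\<forall>i < length (out_word (remove_incomplete_response n C) w q).
      out_word (remove_incomplete_response n C) w q ! i =
        state_map C q (w \<frown> v) (response n (state_map C q) + i))"
  using assms(1,2)
proof (induction w arbitrary: q)
  case (Cons a w)
  let ?R = "remove_incomplete_response n C" and ?l = "\<lambda>q. response n (state_map C q)"
  have a: "a < n" "[a] \<in> words n" and w: "w \<in> words n" using Cons.prems by auto
  have wv: "w \<frown> v \<in> sequences n" using w assms(3) by simp
  define q' where "q' = next_state C a q"
  have q': "q' \<in> states C" unfolding q'_def by (rule productive_next[OF C Cons.prems(1) a(1)])
  note IH = Cons.IH[OF q' w]
  note o = out_remove[OF Cons.prems(1) a(1) wv, folded q'_def]
  have ow: "out_word ?R (a # w) q = out ?R a q @ out_word ?R w q'"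
    by (simp add: q'_def)
  show ?case
  proof (intro conjI allI impI)
    show "length (out_word ?R (a # w) q) + ?l q =
        length (out_word C (a # w) q) + ?l (next_state_word C (a # w) q)"
      unfolding ow using o(1) IH by (simp flip: q'_def)
    fix i assume i: "i < length (out_word ?R (a # w) q)"
    have conc: "(a # w) \<frown> v = [a] \<frown> (w \<frown> v)" by simp
    show "out_word ?R (a # w) q ! i = state_map C q ((a # w) \<frown> v) (?l q + i)"
    proof (cases "i < length (out ?R a q)")
      case True
      then show ?thesis unfolding ow conc using o(2)[OF True] by (simp add: nth_append)
    next
      case False
      define j where "j = i - length (out ?R a q)"
      have j: "i = length (out ?R a q) + j" using False by (simp add: j_def)
      have "out_word ?R (a # w) q ! i = state_map C q' (w \<frown> v) (?l q' + j)"
        using i IH unfolding ow j by simp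
      also have "\<dots> = (out C a q \<frown> state_map C q' (w \<frown> v)) (?l q + i)"
      proof -
        have "?l q + i = length (out C a q) + (?l q' + j)" using o(1) j by linarith
        then show ?thesis by simp
      qed
      also have "out C a q \<frown> state_map C q' (w \<frown> v) = state_map C q ([a] \<frown> (w \<frown> v))"
        unfolding state_map_conc[OF C Cons.prems(1) a(2) wv] by (simp add: q'_def)
      finally show ?thesis unfolding conc .
    qed
  qed
qed simp

lemma productive_remove: "productive n (remove_incomplete_response n C)"
  unfolding productive_def
proof (intro conjI ballI allI impI)
  let ?R = "remove_incomplete_response n C"
  fix q assume "q \<in> states ?R"
  then have q: "q \<in> states C" by simp
  show "next_state ?R a q \<in> states ?R" if "a < n" for a
    using productive_next[OF C q that] by simp
  show "out ?R a q \<in> words n" if a: "a < n" for a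
  proof -
    have v: "(\<lambda>_. 0) \<in> sequences n" using a by (simp add: mem_sequences)
    have a': "[a] \<in> words n" using a by simp
    have "out ?R a q ! i < n" if "i < length (out ?R a q)" for i
      using out_remove(2)[OF q a v that] state_map_in_sequences[OF C q conc_in_sequences[OF a' v]]
      by (simp add: mem_sequences)
    then show ?thesis by (auto simp: words_def in_set_conv_nth)
  qed
  fix v :: "nat word" and m assume v: "v \<in> sequences n"
  obtain k where k: "m + response n (state_map C q) \<le> length (out_word C (prefix k v) q)"
    using productive_length[OF C q v] by blast
  have "m \<le> length (out_word ?R (prefix k v) q)"
    using out_word_remove[OF q prefix_in_words[OF v] suffix_in_sequences[OF v], of k k] k by linarith
  then show "\<exists>k. m \<le> length (out_word ?R (prefix k v) q)" by blast
qed

lemma state_map_remove: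
  assumes q: "q \<in> states C" and v: "v \<in> sequences n"
  shows "state_map (remove_incomplete_response n C) q v =
    (\<lambda>i. state_map C q v (response n (state_map C q) + i))"
proof (rule state_map_eqI)
  let ?R = "remove_incomplete_response n C"
  fix i
  obtain k where k: "Suc i \<le> length (out_word ?R (prefix k v) q)"
    using productive_length[OF productive_remove, of q v "Suc i"] q v by auto
  have "out_word ?R (prefix k v) q ! i =
      state_map C q (prefix k v \<frown> suffix k v) (response n (state_map C q) + i)"
    using out_word_remove[OF q prefix_in_words[OF v] suffix_in_sequences[OF v], of k k] k by simp
  then show "\<exists>k. i < length (out_word ?R (prefix k v) q) \<and>
      out_word ?R (prefix k v) q ! i = state_map C q v (response n (state_map C q) + i)"
    using k prefix_suffix[of v k] by (intro exI[of _ k]) simp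
qed

lemma responsive_remove: "responsive n (remove_incomplete_response n C)"
proof -
  have "branches_at n (state_map (remove_incomplete_response n C) q) 0" if q: "q \<in> states C" for q
    by (rule branches_at_shift[OF branches_at_response[OF nonconst[OF q]] state_map_remove[OF q]])
  then show ?thesis using productive_remove by (simp add: responsive_def)
qed

end

subsection \<open>Identifying equivalent states\<close>

definition omega_class :: "nat \<Rightarrow> 'q transducer \<Rightarrow> 'q \<Rightarrow> 'q set" where
  "omega_class n T q = omega_rel n T `` {q}"

lemma omega_equivalent_refl: "omega_equivalent n T p T p"
  by (simp add: omega_equivalent_def)

lemma omega_equivalent_sym: "omega_equivalent n T p U q \<Longrightarrow> omega_equivalent n U q T p"
  by (simp add: omega_equivalent_def)

lemma omega_equivalent_trans:
  "omega_equivalent n T p U q \<Longrightarrow> omega_equivalent n U q V r \<Longrightarrow> omega_equivalent n T p V r"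
  by (simp add: omega_equivalent_def)

lemma equiv_omega_rel: "equiv (states T) (omega_rel n T)"
  by (rule equivI) (auto simp: omega_rel_def refl_on_def sym_def trans_def omega_equivalent_def)

lemma omega_class_eq_iff:
  "p \<in> states T \<Longrightarrow> q \<in> states T \<Longrightarrow> omega_class n T p = omega_class n T q \<longleftrightarrow> omega_equivalent n T p T q"
  using eq_equiv_class_iff[OF equiv_omega_rel, of p T q n]
  by (simp add: omega_class_def) (simp add: omega_rel_def)

lemma omega_class_some:
  assumes "q \<in> states T"
  shows "(SOME r. r \<in> omega_class n T q) \<in> states T \<and>
    omega_equivalent n T (SOME r. r \<in> omega_class n T q) T q"
proof -
  have "q \<in> omega_class n T q"
    using assms by (simp add: omega_class_def omega_rel_def omega_equivalent_refl)
  then have "(SOME r. r \<in> omega_class n T q) \<in> omega_class n T q" by (rule someI)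
  then show ?thesis by (auto simp: omega_class_def omega_rel_def omega_equivalent_def)
qed

lemma states_identify: "states (identify_equivalent n T) = omega_class n T ` states T"
  by (auto simp: identify_equivalent_def quotient_def omega_class_def)

context
  fixes n :: nat and T :: "'q transducer"
  assumes T: "responsive n T"
begin

text \<open>Independence of the representative chosen by \<open>SOME\<close>. It rests on
  \<open>omega_equivalent_step\<close>, which is why incomplete response is removed before states
  are identified.\<close>

lemma identify_step:
  assumes q: "q \<in> states T" and a: "a < n"
  shows "out (identify_equivalent n T) a (omega_class n T q) = out T a q"
    and "next_state (identify_equivalent n T) a (omega_class n T q) = omega_class n T (next_state T a q)"
proof -
  define r where "r = (SOME r. r \<in> omega_class n T q)"
  have r: "r \<in> states T" "omega_equivalent n T r T q"
    using omega_class_some[OF q] unfolding r_def by blast+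
  note s = omega_equivalent_step[OF T T r(1) q r(2) a]
  show "out (identify_equivalent n T) a (omega_class n T q) = out T a q"
    using s by (simp add: identify_equivalent_def r_def)
  have "next_state (identify_equivalent n T) a (omega_class n T q) = omega_class n T (next_state T a r)"
    by (simp add: identify_equivalent_def r_def omega_class_def)
  also have "\<dots> = omega_class n T (next_state T a q)"
    using s productive_next[OF responsive_productive[OF T] _ a] r(1) q by (simp add: omega_class_eq_iff)
  finally show "next_state (identify_equivalent n T) a (omega_class n T q) =
      omega_class n T (next_state T a q)" .
qed

lemma out_word_identify:
  assumes "q \<in> states T" "w \<in> words n"
  shows "out_word (identify_equivalent n T) w (omega_class n T q) = out_word T w q"
  using assms
  by (induction w arbitrary: q)
    (simp_all add: identify_step productive_next[OF responsive_productive[OF T]])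

lemma state_map_identify:
  assumes q: "q \<in> states T" and v: "v \<in> sequences n"
  shows "state_map (identify_equivalent n T) (omega_class n T q) v = state_map T q v"
  by (simp add: state_map_def out_word_identify[OF q prefix_in_words[OF v]])

lemma responsive_identify: "responsive n (identify_equivalent n T)"
  using T unfolding responsive_def productive_def states_identify branches_at_def
  by (simp add: identify_step out_word_identify state_map_identify)

lemma weakly_minimal_identify: "weakly_minimal n (identify_equivalent n T)"
  unfolding weakly_minimal_def states_identify
  by (auto simp: omega_class_eq_iff) (simp add: omega_equivalent_def state_map_identify)

end

lemma reduction_eq:
  assumes "\<And>q. q \<in> states C \<Longrightarrow> nonconstant n (state_map C q)"
  shows "reduction n C = identify_equivalent n (remove_incomplete_response n C)"
  using assms by (simp add: reduction_def extent_eq)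

lemma transducer_eq_sym: "transducer_eq n T U \<Longrightarrow> transducer_eq n U T"
proof -
  assume "transducer_eq n T U"
  then obtain f where f: "bij_betw f (states T) (states U)"
      "\<And>q. q \<in> states T \<Longrightarrow> omega_equivalent n T q U (f q)"
    by (auto simp: transducer_eq_def)
  let ?g = "inv_into (states T) f"
  have "bij_betw ?g (states U) (states T)" by (rule bij_betw_inv_into[OF f(1)])
  moreover have "omega_equivalent n U q T (?g q)" if q: "q \<in> states U" for q
  proof -
    have "q \<in> f ` states T" using f(1) q by (simp add: bij_betw_def)
    then have "?g q \<in> states T" "f (?g q) = q" by (auto intro: inv_into_into f_inv_into_f)
    then show ?thesis using f(2)[of "?g q"] omega_equivalent_sym by fastforce
  qed
  ultimately show ?thesis unfolding transducer_eq_def by blast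
qed

lemma transducer_eq_trans:
  assumes "transducer_eq n T U" "transducer_eq n U V"
  shows "transducer_eq n T V"
proof -
  obtain f g where f: "bij_betw f (states T) (states U)"
      "\<And>q. q \<in> states T \<Longrightarrow> omega_equivalent n T q U (f q)"
    and g: "bij_betw g (states U) (states V)"
      "\<And>q. q \<in> states U \<Longrightarrow> omega_equivalent n U q V (g q)"
    using assms by (auto simp: transducer_eq_def)
  have "omega_equivalent n T q V ((g \<circ> f) q)" if "q \<in> states T" for q
    using f(2)[OF that] g(2)[of "f q"] bij_betw_apply[OF f(1) that] omega_equivalent_trans by fastforce
  then show ?thesis
    using bij_betw_trans[OF f(1) g(1)] unfolding transducer_eq_def by blast
qed

lemma transducer_class_cong:
  assumes "transducer_eq n T U"
  shows "transducer_class n T = transducer_class n U"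
  unfolding transducer_class_def
  using transducer_eq_trans[OF _ assms] transducer_eq_trans[OF _ transducer_eq_sym[OF assms]] by blast

section \<open>Transducers that track a block code\<close>

definition future :: "(int \<Rightarrow> nat) \<Rightarrow> nat word" where
  "future x = (\<lambda>i. x (int i))"

definition glue :: "(int \<Rightarrow> nat) \<Rightarrow> nat word \<Rightarrow> int \<Rightarrow> nat" where
  "glue x v = (\<lambda>i. if i < 0 then x i else v (nat i))"

lemma future_apply [simp]: "future x i = x (int i)"
  by (simp add: future_def)

lemma future_in_sequences [simp]: "x \<in> sequences n \<Longrightarrow> future x \<in> sequences n"
  by (simp add: mem_sequences)

lemma glue_in_sequences [simp]: "x \<in> sequences n \<Longrightarrow> v \<in> sequences n \<Longrightarrow> glue x v \<in> sequences n"
  by (simp add: mem_sequences glue_def)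

lemma glue_past [simp]: "i < 0 \<Longrightarrow> glue x v i = x i"
  by (simp add: glue_def)

lemma future_glue [simp]: "future (glue x v) = v"
  by (simp add: future_def glue_def)

lemma suffix_future: "suffix k (future x) = future (translate (int k) x)"
  by (simp add: fun_eq_iff add.commute)

lemma core_memI:
  "sync_level n T k \<Longrightarrow> w \<in> words n \<Longrightarrow> length w = k \<Longrightarrow> q \<in> states T \<Longrightarrow>
    next_state_word T w q \<in> states (core n T)"
  unfolding core_def by (simp, blast)

text \<open>\<open>Q x\<close> is the state in which \<open>T\<close> reads the letter \<open>x 0\<close> and \<open>d x\<close> is the position at which
  the output on that letter is placed.\<close>

locale tracking =
  fixes n :: nat and T :: "'q transducer" and Q :: "(int \<Rightarrow> nat) \<Rightarrow> 'q" and d :: "(int \<Rightarrow> nat) \<Rightarrow> int"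
    and f :: "(int \<Rightarrow> nat) \<Rightarrow> int \<Rightarrow> nat" and r K B :: int
  assumes code: "block_code n r f"
    and n2: "2 \<le> n"
    and K_nonneg: "0 \<le> K"
    and states_eq: "states T = Q ` sequences n"
    and next_Q: "\<And>x. x \<in> sequences n \<Longrightarrow> next_state T (x 0) (Q x) = Q (translate 1 x)"
    and length_out: "\<And>x. x \<in> sequences n \<Longrightarrow>
      d (translate 1 x) + 1 = d x + int (length (out T (x 0) (Q x)))"
    and nth_out: "\<And>x i. x \<in> sequences n \<Longrightarrow> i < length (out T (x 0) (Q x)) \<Longrightarrow>
      out T (x 0) (Q x) ! i = f x (d x + int i)"
    and window: "\<And>x y. x \<in> sequences n \<Longrightarrow> y \<in> sequences n \<Longrightarrow>
      (\<And>i. - K \<le> i \<Longrightarrow> i < 0 \<Longrightarrow> x i = y i) \<Longrightarrow> Q x = Q y \<and> d x = d y"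
    and bound: "\<And>x. x \<in> sequences n \<Longrightarrow> \<bar>d x\<bar> \<le> B"
begin

lemma B_nonneg: "0 \<le> B"
proof -
  have "(\<lambda>_. 0) \<in> sequences n" using n2 by (simp add: mem_sequences)
  from bound[OF this] show ?thesis by linarith
qed

lemma word:
  assumes x: "x \<in> sequences n"
  shows "next_state_word T (prefix k (future x)) (Q x) = Q (translate (int k) x) \<and>
    int (length (out_word T (prefix k (future x)) (Q x))) = d (translate (int k) x) + int k - d x \<and>
    (\<forall>i < length (out_word T (prefix k (future x)) (Q x)).
      out_word T (prefix k (future x)) (Q x) ! i = f x (d x + int i))"
proof (induction k)
  case (Suc k)
  define w where "w = prefix k (future x)"
  define y where "y = translate (int k) x"
  have y: "y \<in> sequences n" "y 0 = x (int k)" using x by (simp_all add: y_def)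
  have p: "prefix (Suc k) (future x) = w @ [y 0]" by (simp add: w_def y)
  have IH: "next_state_word T w (Q x) = Q y"
    "int (length (out_word T w (Q x))) = d y + int k - d x"
    "\<And>i. i < length (out_word T w (Q x)) \<Longrightarrow> out_word T w (Q x) ! i = f x (d x + int i)"
    using Suc unfolding w_def y_def by blast+
  have ty: "translate (int (Suc k)) x = translate 1 y" by (simp add: y_def)
  have o: "out_word T (w @ [y 0]) (Q x) = out_word T w (Q x) @ out T (y 0) (Q y)"
    by (simp add: out_word_append IH(1))
  have "out_word T (w @ [y 0]) (Q x) ! i = f x (d x + int i)"
    if i: "i < length (out_word T (w @ [y 0]) (Q x))" for i
  proof (cases "i < length (out_word T w (Q x))")
    case True
    then show ?thesis by (simp add: o nth_append IH(3))
  next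
    case False
    define j where "j = i - length (out_word T w (Q x))"
    have j: "int i = d y + int k - d x + int j" "j < length (out T (y 0) (Q y))"
      using False i IH(2) by (auto simp: j_def o)
    have "out_word T (w @ [y 0]) (Q x) ! i = out T (y 0) (Q y) ! j"
      using False by (simp add: o nth_append j_def)
    also have "\<dots> = f y (d y + int j)" by (rule nth_out[OF y(1) j(2)])
    also have "f y = translate (int k) (f x)" unfolding y_def by (rule block_code_translate[OF code x])
    also have "translate (int k) (f x) (d y + int j) = f x (d x + int i)"
      unfolding j(1) translate_apply by (rule arg_cong[where f = "f x"]) simp
    finally show ?thesis .
  qed
  moreover have "next_state_word T (w @ [y 0]) (Q x) = Q (translate 1 y)"
    by (simp add: next_state_word_append IH(1) next_Q[OF y(1)])
  moreover have "int (length (out_word T (w @ [y 0]) (Q x))) = d (translate 1 y) + int (Suc k) - d x"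
    using length_out[OF y(1)] IH(2) by (simp add: o)
  ultimately show ?case unfolding p ty by blast
qed simp

lemma word_next: "x \<in> sequences n \<Longrightarrow>
    next_state_word T (prefix k (future x)) (Q x) = Q (translate (int k) x)"
  and word_length: "x \<in> sequences n \<Longrightarrow>
    int (length (out_word T (prefix k (future x)) (Q x))) = d (translate (int k) x) + int k - d x"
  and word_nth: "x \<in> sequences n \<Longrightarrow> i < length (out_word T (prefix k (future x)) (Q x)) \<Longrightarrow>
    out_word T (prefix k (future x)) (Q x) ! i = f x (d x + int i)"
  using word by blast+

lemma word_length_ge:
  assumes "x \<in> sequences n"
  shows "int k - 2 * B \<le> int (length (out_word T (prefix k (future x)) (Q x)))"
  using word_length[OF assms, of k] bound[OF assms] bound[of "translate (int k) x"] assms by simp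

lemma state_map_future:
  assumes x: "x \<in> sequences n"
  shows "state_map T (Q x) (future x) = (\<lambda>i. f x (d x + int i))"
proof (rule state_map_eqI)
  fix i
  let ?k = "i + 1 + nat (2 * B)"
  have "i < length (out_word T (prefix ?k (future x)) (Q x))"
    using word_length_ge[OF x, of ?k] by linarith
  then show "\<exists>k. i < length (out_word T (prefix k (future x)) (Q x)) \<and>
      out_word T (prefix k (future x)) (Q x) ! i = f x (d x + int i)"
    using word_nth[OF x] by blast
qed

lemma Q_glue: "x \<in> sequences n \<Longrightarrow> v \<in> sequences n \<Longrightarrow> Q (glue x v) = Q x"
  and d_glue: "x \<in> sequences n \<Longrightarrow> v \<in> sequences n \<Longrightarrow> d (glue x v) = d x"
  using window[of "glue x v" x] by simp_all

lemma state_map_Q: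
  assumes x: "x \<in> sequences n" and v: "v \<in> sequences n"
  shows "state_map T (Q x) v = (\<lambda>i. f (glue x v) (d x + int i))"
  using state_map_future[of "glue x v"] assms by (simp add: Q_glue d_glue)

lemma zero_in_sequences [simp]: "(\<lambda>_. 0) \<in> sequences n"
  using n2 by (simp add: mem_sequences)

lemma next_word_Q:
  assumes x: "x \<in> sequences n" and w: "w \<in> words n"
  shows "next_state_word T w (Q x) = Q (translate (int (length w)) (glue x (w \<frown> (\<lambda>_. 0))))"
proof -
  have v: "w \<frown> (\<lambda>_. 0) \<in> sequences n" using w by simp
  have "prefix (length w) (future (glue x (w \<frown> (\<lambda>_. 0)))) = w" by simp
  then show ?thesis
    using word_next[of "glue x (w \<frown> (\<lambda>_. 0))" "length w"] x v by (simp add: Q_glue)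
qed

lemma productive: "productive n T"
  unfolding productive_def
proof (intro conjI ballI allI impI)
  fix q a assume q: "q \<in> states T" and a: "a < n"
  then obtain x where x: "x \<in> sequences n" "q = Q x" by (auto simp: states_eq)
  define y where "y = glue x ([a] \<frown> (\<lambda>_. 0))"
  have v: "[a] \<frown> (\<lambda>_. 0) \<in> sequences n" using a by (simp del: build_cons)
  have y: "y \<in> sequences n" "Q y = q" "y 0 = a"
    using x v unfolding y_def by (simp_all add: Q_glue del: build_cons) (simp add: glue_def)
  show "next_state T a q \<in> states T"
    using next_Q[OF y(1)] y by (simp add: states_eq)
  have "out T a q ! i < n" if "i < length (out T a q)" for i
    using nth_out[OF y(1), of i] that y block_code_mem[OF code y(1)] by (simp add: mem_sequences)
  then show "out T a q \<in> words n" by (auto simp: words_def in_set_conv_nth)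
next
  fix q m and v :: "nat word" assume q: "q \<in> states T" and v: "v \<in> sequences n"
  then obtain x where x: "x \<in> sequences n" "q = Q x" by (auto simp: states_eq)
  have "int m \<le> int (length (out_word T (prefix (m + nat (2 * B)) v) q))"
    using word_length_ge[of "glue x v" "m + nat (2 * B)"] x v B_nonneg by (simp add: Q_glue)
  then show "\<exists>k. m \<le> length (out_word T (prefix k v) q)" by auto
qed

text \<open>Whatever stands before position \<open>d x\<close> was written before time 0. A run that
  starts \<open>m\<close> steps earlier begins writing at a position of at most
  \<open>B - m\<close>, and its initial state is known from \<open>K\<close> further
  letters.\<close>

lemma past_window:
  assumes x: "x \<in> sequences n" and y: "y \<in> sequences n"
    and eq: "\<And>i. - K - int m \<le> i \<Longrightarrow> i < 0 \<Longrightarrow> x i = y i"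
    and j: "B - int m \<le> j" "j < d x"
  shows "f x j = f y j"
proof -
  define x' y' where "x' = translate (- int m) x" and "y' = translate (- int m) y"
  have x': "x' \<in> sequences n" "translate (int m) x' = x" "f x' = translate (- int m) (f x)"
    using x block_code_translate[OF code x] by (simp_all add: x'_def)
  have y': "y' \<in> sequences n" "translate (int m) y' = y" "f y' = translate (- int m) (f y)"
    using y block_code_translate[OF code y] by (simp_all add: y'_def)
  have Qd: "Q x' = Q y' \<and> d x' = d y'"
    by (rule window[OF x'(1) y'(1)]) (simp add: x'_def y'_def eq)
  have p: "prefix m (future x') = prefix m (future y')"
    unfolding prefix_eq_iff by (auto simp: x'_def y'_def intro!: eq)
      (use K_nonneg in linarith)
  define i where "i = nat (j + int m - d x')"
  have i: "int i = j + int m - d x'"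
    using j(1) bound[OF x'(1)] by (simp add: i_def)
  have l: "i < length (out_word T (prefix m (future x')) (Q x'))"
    using word_length[OF x'(1), of m] i j(2) unfolding x'(2) by linarith
  have "f x' (d x' + int i) = f y' (d y' + int i)"
    using word_nth[OF x'(1) l] word_nth[OF y'(1), of i m] l Qd p by simp
  then show ?thesis unfolding x'(3) y'(3) i using Qd by simp
qed

lemma past_constant:
  assumes x: "x \<in> sequences n" and y: "y \<in> sequences n"
    and eq: "\<And>i. i < 0 \<Longrightarrow> x i = y i" and j: "j < d x"
  shows "f x j = f y j"
  by (rule past_window[OF x y, of "nat (B - j)"]) (use eq j in auto)

lemma sync_level_K: "int k \<ge> K \<Longrightarrow> sync_level n T k"
  unfolding sync_level_def
proof (intro ballI allI impI)
  fix w p q assume k: "int k \<ge> K" and w: "w \<in> words n" "length w = k" and "p \<in> states T" "q \<in> states T"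
  then obtain x y where x: "x \<in> sequences n" "p = Q x" and y: "y \<in> sequences n" "q = Q y"
    by (auto simp: states_eq)
  have v: "w \<frown> (\<lambda>_. 0) \<in> sequences n" using w by simp
  have "Q (translate (int k) (glue x (w \<frown> (\<lambda>_. 0)))) = Q (translate (int k) (glue y (w \<frown> (\<lambda>_. 0))))"
  proof (rule conjunct1[OF window])
    fix i assume "- K \<le> i" "i < 0"
    then show "translate (int k) (glue x (w \<frown> (\<lambda>_. 0))) i = translate (int k) (glue y (w \<frown> (\<lambda>_. 0))) i"
      using k by (simp add: glue_def)
  qed (use x y v in simp_all)
  then show "next_state_word T w p = next_state_word T w q"
    using x y w by (simp add: next_word_Q)
qed

lemma forced: "x \<in> sequences n \<Longrightarrow>
    Q x = next_state_word T (prefix k (future (translate (- int k) x))) (Q (translate (- int k) x))"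
  using word_next[of "translate (- int k) x" k] by simp

lemma states_core:
  "states (core n T) = states T"
proof (intro equalityI subsetI)
  fix s assume "s \<in> states (core n T)"
  then obtain w q where "w \<in> words n" "q \<in> states T" "s = next_state_word T w q"
    by (auto simp: core_def)
  then show "s \<in> states T" using productive_words(1)[OF productive] by simp
next
  fix s assume "s \<in> states T"
  then obtain x where x: "x \<in> sequences n" "s = Q x" by (auto simp: states_eq)
  define y where "y = translate (- int (nat K)) x"
  have y: "y \<in> sequences n" using x by (simp add: y_def)
  have "s = next_state_word T (prefix (nat K) (future y)) (Q y)"
    unfolding x(2) y_def by (rule forced[OF x(1)])
  moreover have "sync_level n T (nat K)" by (rule sync_level_K) simp
  moreover have "prefix (nat K) (future y) \<in> words n" using y by simp
  moreover have "Q y \<in> states T" using y by (simp add: states_eq)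
  ultimately show "s \<in> states (core n T)" using core_memI[of n T "nat K"] by simp
qed

lemma finite_states: "finite (states T)"
proof -
  let ?e = "\<lambda>u i. if - K \<le> i \<and> i < 0 then u i else (0::nat)"
  have "Q ` sequences n \<subseteq> (\<lambda>u. Q (?e u)) ` Pi\<^sub>E {- K..<0} (\<lambda>_. {..<n})"
  proof
    fix s assume "s \<in> Q ` sequences n"
    then obtain x where x: "x \<in> sequences n" "s = Q x" by blast
    have "?e (restrict x {- K..<0}) \<in> sequences n" using x n2 by (simp add: mem_sequences)
    then have "Q x = Q (?e (restrict x {- K..<0}))"
      using x by (intro conjunct1[OF window]) auto
    moreover have "restrict x {- K..<0} \<in> Pi\<^sub>E {- K..<0} (\<lambda>_. {..<n})"
      using x by (auto simp: mem_sequences)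
    ultimately show "s \<in> (\<lambda>u. Q (?e u)) ` Pi\<^sub>E {- K..<0} (\<lambda>_. {..<n})" using x(2) by blast
  qed
  moreover have "finite ((\<lambda>u. Q (?e u)) ` Pi\<^sub>E {- K..<0} (\<lambda>_. {..<n}))"
    by (intro finite_imageI finite_PiE) simp_all
  ultimately show ?thesis unfolding states_eq by (rule finite_subset)
qed

text \<open>A state map shows \<open>f\<close> from position \<open>d x\<close> on, and the past
  fixes the rest, so injectivity is inherited. In particular the reduction never takes its branch
  for infinite extent.\<close>

lemma nonconstant_state_map:
  assumes inj: "inj_on f (sequences n)" and q: "q \<in> states T"
  shows "inj_on (state_map T q) (sequences n)" "nonconstant n (state_map T q)"
proof -
  obtain x where x: "x \<in> sequences n" "q = Q x" using q by (auto simp: states_eq)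
  show i: "inj_on (state_map T q) (sequences n)"
  proof (rule inj_onI)
    fix v w :: "nat word" assume v: "v \<in> sequences n" and w: "w \<in> sequences n"
      and eq: "state_map T q v = state_map T q w"
    have "f (glue x v) j = f (glue x w) j" for j
    proof (cases "j < d x")
      case True
      then show ?thesis using x v w by (intro past_constant) (auto simp: d_glue)
    next
      case False
      then show ?thesis
        using fun_cong[OF eq, of "nat (j - d x)"] x v w by (simp add: state_map_Q)
    qed
    then have "f (glue x v) = f (glue x w)" by (rule ext)
    then have "glue x v = glue x w"
      by (rule inj_onD[OF inj _ glue_in_sequences[OF x(1) v] glue_in_sequences[OF x(1) w]])
    then have "future (glue x v) = future (glue x w)" by simp
    then show "v = w" by simp
  qed
  have 1: "(\<lambda>_. 1) \<in> sequences n" using n2 by (simp add: mem_sequences)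
  have "state_map T q (\<lambda>_. 0) \<noteq> state_map T q (\<lambda>_. 1)"
  proof
    assume "state_map T q (\<lambda>_. 0) = state_map T q (\<lambda>_. 1)"
    from inj_onD[OF i this zero_in_sequences 1] show False by (auto dest: fun_cong)
  qed
  then show "nonconstant n (state_map T q)"
    unfolding nonconstant_def using 1 zero_in_sequences by blast
qed

end

text \<open>If \<open>U\<close> had written position \<open>d x\<close> before time 0, the letter
  there would be decided by the past, whereas the first letter written by \<open>T\<close> still
  depends on the future.\<close>

lemma tracking_d_le:
  assumes T: "tracking n T Q d f r K B" and U: "tracking n U P e f s L C"
    and x: "x \<in> sequences n" and b: "branches_at n (state_map T (Q x)) 0"
  shows "e x \<le> d x"
proof (rule ccontr)
  interpret T: tracking n T Q d f r K B by (rule T)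
  interpret U: tracking n U P e f s L C by (rule U)
  assume "\<not> e x \<le> d x"
  then have lt: "d x < e x" by simp
  obtain v w where vw: "v \<in> sequences n" "w \<in> sequences n" "state_map T (Q x) v 0 \<noteq> state_map T (Q x) w 0"
    using branches_atD(2)[OF b] by blast
  have "f (glue x v) (d x) = f (glue x w) (d x)"
    using x vw lt by (intro U.past_constant) (auto simp: U.d_glue)
  then show False using vw x by (simp add: T.state_map_Q)
qed

lemma tracking_unique:
  assumes T: "tracking n T Q d f r K B" and U: "tracking n U P e f s L C"
    and cT: "responsive n T" and cU: "responsive n U" and x: "x \<in> sequences n"
  shows "d x = e x" "omega_equivalent n T (Q x) U (P x)"
proof -
  interpret T: tracking n T Q d f r K B by (rule T)
  interpret U: tracking n U P e f s L C by (rule U)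
  have "branches_at n (state_map T (Q x)) 0" "branches_at n (state_map U (P x)) 0"
    using cT cU x T.states_eq U.states_eq unfolding responsive_def by blast+
  then show de: "d x = e x"
    using tracking_d_le[OF T U x] tracking_d_le[OF U T x] by simp
  show "omega_equivalent n T (Q x) U (P x)"
    unfolding omega_equivalent_def using x de by (simp add: T.state_map_Q U.state_map_Q)
qed

text \<open>The positions \<open>d\<close> are bound existentially; this is what makes the notion
  blind to powers of the shift.\<close>

definition represents :: "nat \<Rightarrow> 'q transducer \<Rightarrow> ((int \<Rightarrow> nat) \<Rightarrow> int \<Rightarrow> nat) \<Rightarrow> bool" where
  "represents n T f \<longleftrightarrow> responsive n T \<and> weakly_minimal n T \<and> (\<exists>Q d r K B. tracking n T Q d f r K B)"

lemma represents_transducer_eq: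
  assumes T: "represents n T f" and U: "represents n U f"
  shows "transducer_eq n T U"
proof -
  obtain Q d r K B where tT: "tracking n T Q d f r K B" using T unfolding represents_def by blast
  obtain P e s L C where tU: "tracking n U P e f s L C" using U unfolding represents_def by blast
  interpret T: tracking n T Q d f r K B by (rule tT)
  interpret U: tracking n U P e f s L C by (rule tU)
  have cT: "responsive n T" "weakly_minimal n T" and cU: "responsive n U" "weakly_minimal n U"
    using T U by (auto simp: represents_def)
  \<comment> \<open>A state is sent to the state in which \<open>U\<close> has read the same past.
    Different pasts of one state give equivalent states of \<open>U\<close>, which are equal by weak
    minimality.\<close>
  define h where "h = (\<lambda>q. P (SOME x. x \<in> sequences n \<and> Q x = q))"
  have h: "h q \<in> states U \<and> omega_equivalent n T q U (h q)" if q: "q \<in> states T" for q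
  proof -
    have "\<exists>x. x \<in> sequences n \<and> Q x = q" using q by (auto simp: T.states_eq)
    then have "(SOME x. x \<in> sequences n \<and> Q x = q) \<in> sequences n \<and>
        Q (SOME x. x \<in> sequences n \<and> Q x = q) = q" by (rule someI_ex)
    then show ?thesis
      using tracking_unique(2)[OF tT tU cT(1) cU(1), of "SOME x. x \<in> sequences n \<and> Q x = q"]
      by (simp add: h_def U.states_eq)
  qed
  have "inj_on h (states T)"
  proof (rule inj_onI)
    fix p q assume pq: "p \<in> states T" "q \<in> states T" "h p = h q"
    have "omega_equivalent n T p T q"
      using h[OF pq(1)] h[OF pq(2)] pq(3) omega_equivalent_sym omega_equivalent_trans by metis
    then show "p = q" using cT(2) pq unfolding weakly_minimal_def by blast
  qed
  moreover have "h ` states T = states U"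
  proof (intro equalityI subsetI)
    show "u \<in> states U" if "u \<in> h ` states T" for u using that h by blast
    fix u assume "u \<in> states U"
    then obtain x where x: "x \<in> sequences n" "u = P x" by (auto simp: U.states_eq)
    have q: "Q x \<in> states T" using x by (simp add: T.states_eq)
    have "omega_equivalent n U (h (Q x)) U u"
      unfolding x(2)
      by (rule omega_equivalent_trans[OF omega_equivalent_sym[OF conjunct2[OF h[OF q]]]
          tracking_unique(2)[OF tT tU cT(1) cU(1) x(1)]])
    then have "h (Q x) = u"
      using cU(2) h[OF q] \<open>u \<in> states U\<close> unfolding weakly_minimal_def by blast
    then show "u \<in> h ` states T" using q by blast
  qed
  ultimately show ?thesis
    unfolding transducer_eq_def bij_betw_def using h by blast
qed

text \<open>Equality of transducers matches states only by their maps; outputs and transitions on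
  letters are recovered by \<open>omega_equivalent_step\<close> and weak minimality of
  \<open>U\<close>.\<close>

lemma represents_transfer:
  assumes T: "represents n T f" and eq: "transducer_eq n T U"
    and cU: "responsive n U" and wU: "weakly_minimal n U"
  shows "represents n U f"
proof -
  obtain Q d r K B where tT: "tracking n T Q d f r K B" using T unfolding represents_def by blast
  interpret T: tracking n T Q d f r K B by (rule tT)
  have cT: "responsive n T" using T by (simp add: represents_def)
  obtain h where h: "bij_betw h (states T) (states U)"
      "\<And>q. q \<in> states T \<Longrightarrow> omega_equivalent n T q U (h q)"
    using eq unfolding transducer_eq_def by blast
  have hU: "h q \<in> states U" if "q \<in> states T" for q using bij_betw_apply[OF h(1) that] .
  have QT: "Q x \<in> states T" if "x \<in> sequences n" for x using that by (simp add: T.states_eq)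
  have step: "out U (x 0) (h (Q x)) = out T (x 0) (Q x)"
      "next_state U (x 0) (h (Q x)) = h (Q (translate 1 x))" if x: "x \<in> sequences n" for x
  proof -
    have a: "x 0 < n" using x by (simp add: mem_sequences)
    note s = omega_equivalent_step[OF cT cU QT[OF x] hU[OF QT[OF x]] h(2)[OF QT[OF x]] a]
    show "out U (x 0) (h (Q x)) = out T (x 0) (Q x)" using s by simp
    have t: "Q (translate 1 x) \<in> states T" using x by (intro QT) simp
    have "omega_equivalent n U (next_state U (x 0) (h (Q x))) U (h (Q (translate 1 x)))"
      using omega_equivalent_trans[OF omega_equivalent_sym[OF conjunct2[OF s]]]
        h(2)[OF t] T.next_Q[OF x] by simp
    then show "next_state U (x 0) (h (Q x)) = h (Q (translate 1 x))"
      using wU productive_next[OF responsive_productive[OF cU] hU[OF QT[OF x]] a] hU[OF t]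
      unfolding weakly_minimal_def by blast
  qed
  have "tracking n U (\<lambda>x. h (Q x)) d f r K B"
  proof
    show "states U = (\<lambda>x. h (Q x)) ` sequences n"
      using h(1) by (simp add: bij_betw_def T.states_eq image_image)
    show "h (Q x) = h (Q y) \<and> d x = d y"
      if "x \<in> sequences n" "y \<in> sequences n" "\<And>i. - K \<le> i \<Longrightarrow> i < 0 \<Longrightarrow> x i = y i" for x y
      using T.window[OF that] by simp
  qed (use T.code T.n2 T.K_nonneg T.bound T.length_out T.nth_out in \<open>auto simp: step\<close>)
  then show ?thesis using cU wU unfolding represents_def by blast
qed

lemma represents_reduction:
  assumes C: "tracking n C Q D f r K B" and inj: "inj_on f (sequences n)"
  shows "represents n (reduction n C) f"
proof -
  interpret C: tracking n C Q D f r K B by (rule C)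
  have nc: "nonconstant n (state_map C q)" if "q \<in> states C" for q
    using C.nonconstant_state_map(2)[OF inj that] .
  define R where "R = remove_incomplete_response n C"
  have cR: "responsive n R" unfolding R_def by (rule responsive_remove[OF C.productive nc])
  have red: "reduction n C = identify_equivalent n R"
    unfolding R_def by (rule reduction_eq[OF nc])
  let ?l = "\<lambda>x. response n (state_map C (Q x))"
  define M where "M = Max ((\<lambda>q. response n (state_map C q)) ` states C)"
  have M: "?l x \<le> M" if "x \<in> sequences n" for x
    unfolding M_def using C.finite_states that by (intro Max_ge) (auto simp: C.states_eq)
  \<comment> \<open>Dropping a common prefix of length \<open>?l x\<close> moves the first position
    written from this state by as much.\<close>
  have "tracking n (identify_equivalent n R) (\<lambda>x. omega_class n R (Q x)) (\<lambda>x. D x + int (?l x)) f r K (B + int M)"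
  proof
    show "states (identify_equivalent n R) = (\<lambda>x. omega_class n R (Q x)) ` sequences n"
      by (simp add: states_identify R_def C.states_eq image_image)
    fix x :: "int \<Rightarrow> nat" assume x: "x \<in> sequences n"
    have a: "x 0 < n" using x by (simp add: mem_sequences)
    have q: "Q x \<in> states C" "Q x \<in> states R" using x by (simp_all add: C.states_eq R_def)
    have v: "suffix 1 (future x) \<in> sequences n" using x by simp
    have xv: "[x 0] \<frown> suffix 1 (future x) = future x"
      using prefix_suffix[of "future x" 1] by (simp del: build_cons)
    note o = out_remove[OF C.productive nc q(1) a v, folded R_def, unfolded xv]
    note s = identify_step[OF cR q(2) a]
    show "next_state (identify_equivalent n R) (x 0) (omega_class n R (Q x)) =
        omega_class n R (Q (translate 1 x))"
      using s(2) C.next_Q[OF x] by (simp add: R_def)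
    show "D (translate 1 x) + int (?l (translate 1 x)) + 1 =
        D x + int (?l x) + int (length (out (identify_equivalent n R) (x 0) (omega_class n R (Q x))))"
      using o(1) C.length_out[OF x] C.next_Q[OF x] by (simp add: s(1))
    show "out (identify_equivalent n R) (x 0) (omega_class n R (Q x)) ! i = f x (D x + int (?l x) + int i)"
      if "i < length (out (identify_equivalent n R) (x 0) (omega_class n R (Q x)))" for i
      using o(2)[of i] that C.state_map_future[OF x] by (simp add: s(1) add.assoc)
    show "\<bar>D x + int (?l x)\<bar> \<le> B + int M" using C.bound[OF x] M[OF x] by linarith
    fix y :: "int \<Rightarrow> nat" assume "y \<in> sequences n" "\<And>i. - K \<le> i \<Longrightarrow> i < 0 \<Longrightarrow> x i = y i"
    then show "omega_class n R (Q x) = omega_class n R (Q y) \<and> D x + int (?l x) = D y + int (?l y)"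
      using C.window[OF x] by metis
  qed (use C.code C.n2 C.K_nonneg in auto)
  then show ?thesis
    unfolding red represents_def using responsive_identify[OF cR] weakly_minimal_identify[OF cR] by blast
qed

subsection \<open>Products\<close>

lemma core_simps [simp]:
  "next_state (core n T) = next_state T" "out (core n T) = out T"
  by (simp_all add: core_def)

lemma next_state_word_core [simp]: "next_state_word (core n T) w q = next_state_word T w q"
  by (induction w arbitrary: q) simp_all

lemma out_word_core [simp]: "out_word (core n T) w q = out_word T w q"
  by (induction w arbitrary: q) simp_all

lemma state_map_core [simp]: "state_map (core n T) = state_map T"
  by (simp add: state_map_def fun_eq_iff)

lemma transducer_prod_simps [simp]:
  "states (transducer_prod T U) = states T \<times> states U"
  "next_state (transducer_prod T U) a (p, q) = (next_state T a p, next_state_word U (out T a p) q)"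
  "out (transducer_prod T U) a (p, q) = out_word U (out T a p) q"
  by (simp_all add: transducer_prod_def)

lemma transducer_prod_word:
  "next_state_word (transducer_prod T U) w (p, q) =
    (next_state_word T w p, next_state_word U (out_word T w p) q)"
  "out_word (transducer_prod T U) w (p, q) = out_word U (out_word T w p) q"
  by (induction w arbitrary: p q) (simp_all add: next_state_word_append out_word_append)

text \<open>What \<open>U\<close> reads is \<open>f x\<close> recentred at \<open>d x\<close>, the
  point \<open>z x\<close> of the proof, so the positions add. States that pair unrelated pasts do
  not survive in the core. The window: \<open>U\<close> looks at \<open>L\<close> letters of
  \<open>z x\<close>, these lie at positions of \<open>f x\<close> not below \<open>- B - L\<close>,
  and \<open>past_window\<close> with \<open>m = 2 * B + L\<close> asks for \<open>K + m\<close>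
  letters.\<close>

lemma tracking_prod:
  assumes T: "tracking n T Q d f r K B" and U: "tracking n U P e g s L C"
  shows "tracking n (core n (transducer_prod T U))
    (\<lambda>x. (Q x, P (translate (d x) (f x)))) (\<lambda>x. d x + e (translate (d x) (f x)))
    (\<lambda>x. g (f x)) (r + s) (K + 2 * B + L) (B + C)"
proof -
  interpret T: tracking n T Q d f r K B by (rule T)
  interpret U: tracking n U P e g s L C by (rule U)
  define z where "z = (\<lambda>x. translate (d x) (f x))"
  define S where "S = (\<lambda>x. (Q x, P (z x)))"
  let ?P = "transducer_prod T U"
  have z: "z x \<in> sequences n" if "x \<in> sequences n" for x
    unfolding z_def using block_code_mem[OF T.code that] by simp
  have B0: "0 \<le> B" using T.bound[OF T.zero_in_sequences] by linarith
  have outT: "out_word T (prefix k (future x)) (Q x) =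
      prefix (length (out_word T (prefix k (future x)) (Q x))) (future (z x))"
    if x: "x \<in> sequences n" for x k
    by (rule nth_equalityI) (simp_all add: T.word_nth[OF x] z_def add.commute)
  have zt: "translate (int (length (out_word T (prefix k (future x)) (Q x)))) (z x) = z (translate (int k) x)"
    if x: "x \<in> sequences n" for x k
    unfolding T.word_length[OF x] by (simp add: z_def block_code_translate[OF T.code x] algebra_simps)
  have step: "next_state_word ?P (prefix k (future x)) (S x) = S (translate (int k) x) \<and>
      out_word ?P (prefix k (future x)) (S x) =
        out_word U (prefix (length (out_word T (prefix k (future x)) (Q x))) (future (z x))) (P (z x))"
    if x: "x \<in> sequences n" for x k
  proof -
    define l where "l = length (out_word T (prefix k (future x)) (Q x))"
    have o: "out_word T (prefix k (future x)) (Q x) = prefix l (future (z x))"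
      unfolding l_def by (rule outT[OF x])
    have "next_state_word U (prefix l (future (z x))) (P (z x)) = P (z (translate (int k) x))"
      using U.word_next[OF z[OF x], of l] zt[OF x, of k] by (simp add: l_def)
    then show ?thesis
      unfolding S_def transducer_prod_word o by (simp add: T.word_next[OF x])
  qed
  have S: "S x \<in> states ?P" if "x \<in> sequences n" for x
    using that z by (simp add: S_def T.states_eq U.states_eq)
  have zwin: "z x i = z y i" if x: "x \<in> sequences n" and y: "y \<in> sequences n"
    and eq: "\<And>i. - (K + 2 * B + L) \<le> i \<Longrightarrow> i < 0 \<Longrightarrow> x i = y i" and i: "- L \<le> i" "i < 0" for x y i
  proof -
    have "d x = d y" using eq U.K_nonneg B0 by (intro conjunct2[OF T.window[OF x y]]) auto
    moreover have "f x (i + d x) = f y (i + d x)"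
      using eq U.K_nonneg B0 T.bound[OF x] i
      by (intro T.past_window[OF x y, of "nat (2 * B + L)"]) auto
    ultimately show ?thesis by (simp add: z_def)
  qed
  \<comment> \<open>Reading \<open>k\<close> letters, \<open>T\<close> writes at least
    \<open>k - 2 * B >= L\<close> letters, enough to synchronize \<open>U\<close> from an arbitrary
    state \<open>P y\<close>.\<close>
  have sync: "next_state_word ?P (prefix k (future x)) (Q x, P y) = S (translate (int k) x)"
    if x: "x \<in> sequences n" and y: "y \<in> sequences n" and k: "2 * B + L \<le> int k" for x y k
  proof -
    define l where "l = length (out_word T (prefix k (future x)) (Q x))"
    define x' where "x' = translate (int k) x"
    define w where "w = prefix l (future (z x))"
    have w: "w \<in> words n" "length w = l" using z[OF x] by (simp_all add: w_def)
    have v: "w \<frown> (\<lambda>_. 0) \<in> sequences n" using w by simp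
    have l: "L \<le> int l" using T.word_length_ge[OF x, of k] k by (simp add: l_def)
    have "P (translate (int l) (glue y (w \<frown> (\<lambda>_. 0)))) = P (z x')"
    proof (rule conjunct1[OF U.window])
      show "translate (int l) (glue y (w \<frown> (\<lambda>_. 0))) \<in> sequences n" using y v by simp
      show "z x' \<in> sequences n" using z x by (simp add: x'_def)
      fix i assume i: "- L \<le> i" "i < 0"
      have "translate (int l) (glue y (w \<frown> (\<lambda>_. 0))) i = w ! nat (i + int l)"
        using i l w by (simp add: glue_def nat_less_iff)
      also have "\<dots> = translate (int l) (z x) i"
        using i l by (simp add: w_def nat_less_iff)
      also have "\<dots> = z x' i" using zt[OF x, of k] by (simp add: l_def x'_def)
      finally show "translate (int l) (glue y (w \<frown> (\<lambda>_. 0))) i = z x' i" .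
    qed
    then have "next_state_word U w (P y) = P (z x')"
      using U.next_word_Q[OF y w(1)] w(2) by simp
    then show ?thesis
      unfolding transducer_prod_word outT[OF x, of k, folded l_def w_def]
      by (simp add: T.word_next[OF x] S_def x'_def)
  qed
  define k0 where "k0 = nat (K + 2 * B + L)"
  have k0: "int k0 = K + 2 * B + L" using T.K_nonneg U.K_nonneg B0 by (simp add: k0_def)
  have Swin: "S x = S y" if x: "x \<in> sequences n" and y: "y \<in> sequences n"
    and eq: "\<And>i. - (K + 2 * B + L) \<le> i \<Longrightarrow> i < 0 \<Longrightarrow> x i = y i" for x y
  proof -
    have "Q x = Q y" using eq U.K_nonneg B0 by (intro conjunct1[OF T.window[OF x y]]) auto
    moreover have "P (z x) = P (z y)"
      by (intro conjunct1[OF U.window] z x y zwin eq)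
    ultimately show ?thesis by (simp add: S_def)
  qed
  have level: "sync_level n ?P k0"
    unfolding sync_level_def
  proof (intro ballI allI impI)
    fix w p q assume w: "w \<in> words n" "length w = k0" and "p \<in> states ?P" "q \<in> states ?P"
    then obtain x y x' y' where p: "x \<in> sequences n" "y \<in> sequences n" "p = (Q x, P y)"
        and q: "x' \<in> sequences n" "y' \<in> sequences n" "q = (Q x', P y')"
      by (auto simp: T.states_eq U.states_eq)
    have v: "w \<frown> (\<lambda>_. 0) \<in> sequences n" using w by simp
    have *: "next_state_word ?P w (Q x, P y) = S (translate (int k0) (glue x (w \<frown> (\<lambda>_. 0))))"
      if "x \<in> sequences n" "y \<in> sequences n" for x y
      using sync[of "glue x (w \<frown> (\<lambda>_. 0))" y k0] that v w k0 T.K_nonneg by (simp add: T.Q_glue)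
    show "next_state_word ?P w p = next_state_word ?P w q"
      unfolding p(3) q(3) *[OF p(1,2)] *[OF q(1,2)]
    proof (rule Swin)
      fix i assume "- (K + 2 * B + L) \<le> i" "i < 0"
      then show "translate (int k0) (glue x (w \<frown> (\<lambda>_. 0))) i =
          translate (int k0) (glue x' (w \<frown> (\<lambda>_. 0))) i"
        using k0 by (simp add: glue_def)
    qed (use p q v in simp_all)
  qed
  have states: "states (core n ?P) = S ` sequences n"
  proof (intro equalityI subsetI)
    fix t assume "t \<in> states (core n ?P)"
    then obtain w q k where w: "sync_level n ?P k" "w \<in> words n" "length w = k" "q \<in> states ?P"
        "t = next_state_word ?P w q"
      by (auto simp: core_def)
    \<comment> \<open>The core admits any synchronizing level \<open>k\<close>, so the forcing word
      is placed after an arbitrary past instead of being matched with \<open>k0\<close>.\<close>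
    define x where "x = glue (\<lambda>_. 0) (w \<frown> (\<lambda>_. 0))"
    have x: "x \<in> sequences n" using w(2) T.zero_in_sequences by (simp add: x_def)
    have "t = next_state_word ?P w (S x)"
      using w S[OF x] unfolding sync_level_def by blast
    moreover have "prefix (length w) (future x) = w" by (simp add: x_def)
    ultimately have "t = S (translate (int (length w)) x)"
      using step[OF x, of "length w"] by simp
    then show "t \<in> S ` sequences n" using x by simp
  next
    fix t assume "t \<in> S ` sequences n"
    then obtain x where x: "x \<in> sequences n" "t = S x" by blast
    define y where "y = translate (- int k0) x"
    have y: "y \<in> sequences n" using x by (simp add: y_def)
    have "t = next_state_word ?P (prefix k0 (future y)) (S y)"
      using step[OF y, of k0] x by (simp add: y_def)
    moreover have "prefix k0 (future y) \<in> words n" using y by simp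
    ultimately show "t \<in> states (core n ?P)"
      using core_memI[OF level] S[OF y] by simp
  qed
  have "tracking n (core n ?P) S (\<lambda>x. d x + e (z x)) (\<lambda>x. g (f x)) (r + s) (K + 2 * B + L) (B + C)"
  proof
    show "block_code n (r + s) (\<lambda>x. g (f x))" by (rule block_code_comp[OF T.code U.code])
    show "0 \<le> K + 2 * B + L" using k0 by simp
    fix x :: "int \<Rightarrow> nat" assume x: "x \<in> sequences n"
    define l where "l = length (out T (x 0) (Q x))"
    have p1: "prefix 1 (future x) = [x 0]" by simp
    have st: "next_state_word ?P [x 0] (S x) = S (translate 1 x)"
      "out_word ?P [x 0] (S x) = out_word U (prefix l (future (z x))) (P (z x))"
      using step[OF x, of 1] unfolding p1 by (simp_all add: l_def)
    have ou: "out ?P (x 0) (S x) = out_word U (prefix l (future (z x))) (P (z x))"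
      using st(2) by (simp add: S_def)
    show "next_state (core n ?P) (x 0) (S x) = S (translate 1 x)" using st(1) by simp
    have zl: "translate (int l) (z x) = z (translate 1 x)"
      using zt[OF x, of 1] unfolding p1 by (simp add: l_def)
    show "d (translate 1 x) + e (z (translate 1 x)) + 1 =
        d x + e (z x) + int (length (out (core n ?P) (x 0) (S x)))"
      using U.word_length[OF z[OF x], of l] T.length_out[OF x] by (simp add: ou zl flip: l_def)
    show "out (core n ?P) (x 0) (S x) ! i = g (f x) (d x + e (z x) + int i)"
      if "i < length (out (core n ?P) (x 0) (S x))" for i
    proof -
      have "out (core n ?P) (x 0) (S x) ! i = g (z x) (e (z x) + int i)"
        using U.word_nth[OF z[OF x], of i l] that by (simp add: ou)
      also have "g (z x) = translate (d x) (g (f x))"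
        unfolding z_def by (rule block_code_translate[OF U.code block_code_mem[OF T.code x]])
      finally show ?thesis by (simp add: algebra_simps)
    qed
    show "\<bar>d x + e (z x)\<bar> \<le> B + C" using T.bound[OF x] U.bound[OF z[OF x]] by linarith
    fix y assume y: "y \<in> sequences n" and eq: "\<And>i. - (K + 2 * B + L) \<le> i \<Longrightarrow> i < 0 \<Longrightarrow> x i = y i"
    have "d x = d y" using eq U.K_nonneg B0 by (intro conjunct2[OF T.window[OF x y]]) auto
    moreover have "e (z x) = e (z y)" by (intro conjunct2[OF U.window] z x y zwin eq)
    ultimately show "S x = S y \<and> d x + e (z x) = d y + e (z y)" using Swin[OF x y eq] by simp
  qed (use T.n2 states in auto)
  then show ?thesis by (simp add: S_def z_def)
qed

section \<open>The class of an automorphism\<close>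

lemma replicate_word:
  assumes "next_state_word T w q = q"
  shows "next_state_word T (concat (replicate m w)) q = q \<and>
    length (out_word T (concat (replicate m w)) q) = m * length (out_word T w q)"
  by (induction m) (simp_all add: next_state_word_append out_word_append assms)

lemma replicate_in_words: "w \<in> words n \<Longrightarrow> concat (replicate m w) \<in> words n"
  by (induction m) simp_all

lemma length_concat_replicate: "length (concat (replicate m w)) = m * length w"
  by (induction m) simp_all

context tracking
begin

text \<open>Output length minus input length is a difference of two values of \<open>d\<close>,
  hence at most \<open>2 * B\<close> in absolute value. Repeating a loop multiplies this difference,
  so for loops it vanishes.\<close>

lemma loop_length:
  assumes q: "q \<in> states T" and w: "w \<in> words n" and loop: "next_state_word T w q = q"
  shows "length (out_word T w q) = length w"
proof -
  obtain x where x: "x \<in> sequences n" "q = Q x" using q by (auto simp: states_eq)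
  define m where "m = Suc (nat (2 * B))"
  define u where "u = concat (replicate m w)"
  define y where "y = glue x (u \<frown> (\<lambda>_. 0))"
  have u: "u \<in> words n" "length u = m * length w"
    using w by (simp_all add: u_def replicate_in_words length_concat_replicate)
  have v: "u \<frown> (\<lambda>_. 0) \<in> sequences n" using u by simp
  have y: "y \<in> sequences n" "Q y = q" "prefix (length u) (future y) = u"
    using x v by (simp_all add: y_def Q_glue)
  have "int (length (out_word T u q)) = d (translate (int (length u)) y) + int (length u) - d y"
    using word_length[OF y(1), of "length u"] y by simp
  moreover have "length (out_word T u q) = m * length (out_word T w q)"
    using replicate_word[OF loop] by (simp add: u_def)
  moreover have "\<bar>d (translate (int (length u)) y)\<bar> \<le> B" "\<bar>d y\<bar> \<le> B"
    using bound y(1) by simp_all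
  ultimately have "\<bar>int m * (int (length (out_word T w q)) - int (length w))\<bar> \<le> 2 * B"
    using u(2) by (simp add: right_diff_distrib)
  moreover have "2 * B < int m" using B_nonneg by (simp add: m_def)
  ultimately have small: "int m * \<bar>int (length (out_word T w q)) - int (length w)\<bar> < int m"
    by (simp add: abs_mult)
  have "\<bar>int (length (out_word T w q)) - int (length w)\<bar> = 0"
  proof (rule ccontr)
    assume "\<bar>int (length (out_word T w q)) - int (length w)\<bar> \<noteq> 0"
    then have "int m * 1 \<le> int m * \<bar>int (length (out_word T w q)) - int (length w)\<bar>"
      by (intro mult_left_mono) linarith+
    with small show False by simp
  qed
  then show ?thesis by simp
qed

lemma is_transducer: "is_transducer n T"
  unfolding is_transducer_def
proof (intro conjI allI impI ballI)
  show "finite (states T)" by (rule finite_states)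
  show "states T \<noteq> {}" unfolding states_eq using zero_in_sequences by blast
  fix q assume q: "q \<in> states T"
  show "next_state T a q \<in> states T" "out T a q \<in> words n" if "a < n" for a
    using productive q that by (simp_all add: productive_next productive_out)
  show "out_word T w q \<noteq> []" if "w \<in> words n" "w \<noteq> [] \<and> next_state_word T w q = q" for w
    using loop_length[OF q, of w] that by auto
qed

lemma strongly_connected: "strongly_connected n T"
  unfolding strongly_connected_def
proof (intro ballI)
  fix p q assume p: "p \<in> states T" and "q \<in> states T"
  then obtain y where y: "y \<in> sequences n" "q = Q y" by (auto simp: states_eq)
  define y' where "y' = translate (- int (nat K)) y"
  have y': "y' \<in> sequences n" "Q y' \<in> states T" using y by (simp_all add: y'_def states_eq)
  define w where "w = prefix (nat K) (future y')"
  have w: "w \<in> words n" "length w = nat K" using y' by (simp_all add: w_def)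
  have "sync_level n T (nat K)" by (rule sync_level_K) simp
  then have "next_state_word T w p = next_state_word T w (Q y')"
    using w p y' unfolding sync_level_def by blast
  also have "\<dots> = q" using forced[OF y(1), of "nat K"] by (simp add: w_def y'_def y(2))
  finally show "\<exists>w\<in>words n. next_state_word T w p = q" using w by blast
qed

end

lemma represents_in_M:
  assumes "represents n T f"
  shows "in_M n T"
proof -
  obtain Q d r K B where "tracking n T Q d f r K B" using assms unfolding represents_def by blast
  then interpret tracking n T Q d f r K B .
  have "minimal n T"
    using assms strongly_connected
    unfolding minimal_def represents_def responsive_def incomplete_response_iff by blast
  moreover have "strongly_synchronizing n T"
    unfolding strongly_synchronizing_def using sync_level_K[of "nat K"] K_nonneg by auto
  moreover have "core n T = T"
  proof -
    have "core n T = T \<lparr>states := states (core n T)\<rparr>" by (simp add: core_def)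
    then show ?thesis by (simp add: states_core)
  qed
  ultimately show ?thesis using is_transducer by (simp add: in_M_def is_core_def)
qed

text \<open>In the other alternative of \<open>minimal\<close> the output depends on the length of
  the input only, so state maps are constant.\<close>

lemma in_M_nonconstant:
  assumes T: "in_M n T" and q: "q \<in> states T" and nc: "nonconstant n (state_map T q)"
  shows "responsive n T" "weakly_minimal n T" "strongly_connected n T"
proof -
  have "\<not> (\<exists>s x. states T = {s} \<and> (\<forall>a<n. next_state T a s = s \<and> out T a s = x) \<and>
      x \<in> words n \<and> prime_word x \<and> least_rotation x)"
  proof
    assume "\<exists>s x. states T = {s} \<and> (\<forall>a<n. next_state T a s = s \<and> out T a s = x) \<and>
      x \<in> words n \<and> prime_word x \<and> least_rotation x"
    then obtain x where x: "\<And>a. a < n \<Longrightarrow> next_state T a q = q \<and> out T a q = x"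
      using q by auto
    have ow: "out_word T w q = concat (replicate (length w) x)" if "w \<in> words n" for w
      using that by (induction w) (simp_all add: x)
    have "state_map T q v = state_map T q w" if "v \<in> sequences n" "w \<in> sequences n" for v w
      using that by (simp add: state_map_def ow)
    then show False using nc unfolding nonconstant_def by blast
  qed
  then have m: "weakly_minimal n T \<and> strongly_connected n T \<and> (\<forall>q\<in>states T. \<not> incomplete_response n T q)"
    using T unfolding in_M_def minimal_def by blast
  then show "weakly_minimal n T" "strongly_connected n T" by simp_all
  show "responsive n T"
    using m T is_transducer_productive unfolding responsive_def in_M_def incomplete_response_iff by blast
qed

lemma nonconstant_cong:
  "(\<And>v. v \<in> sequences n \<Longrightarrow> f v = g v) \<Longrightarrow> nonconstant n f \<Longrightarrow> nonconstant n g"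
  unfolding nonconstant_def by metis

text \<open>The element of the monoid attached to \<open>f\<close>, described by its members, so
  that no representing transducer has to be chosen.\<close>

definition represented_class :: "nat \<Rightarrow> ((int \<Rightarrow> nat) \<Rightarrow> int \<Rightarrow> nat) \<Rightarrow> nat transducer set" where
  "represented_class n f = {V. represents n V f}"

lemma transducer_class_represents:
  assumes R: "represents n R f"
  shows "transducer_class n R = represented_class n f"
proof (intro equalityI subsetI)
  fix V :: "nat transducer" assume "V \<in> represented_class n f"
  then show "V \<in> transducer_class n R"
    using represents_transducer_eq[OF _ R] represents_in_M
    by (auto simp: represented_class_def transducer_class_def)
next
  fix V :: "nat transducer" assume "V \<in> transducer_class n R"
  then have V: "in_M n V" "transducer_eq n R V"
    using transducer_eq_sym by (auto simp: transducer_class_def)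
  then obtain h where h: "bij_betw h (states R) (states V)"
      "\<And>q. q \<in> states R \<Longrightarrow> omega_equivalent n R q V (h q)"
    unfolding transducer_eq_def by blast
  have "is_transducer n R" using represents_in_M[OF R] by (simp add: in_M_def)
  then obtain q where q: "q \<in> states R" by (auto simp: is_transducer_def)
  have "nonconstant n (state_map R q)"
    using R q branches_at_nonconstant unfolding represents_def responsive_def by blast
  then have "nonconstant n (state_map V (h q))"
    using h(2)[OF q] by (auto simp: omega_equivalent_def intro: nonconstant_cong[rotated])
  from in_M_nonconstant[OF V(1) bij_betw_apply[OF h(1) q] this]
  show "V \<in> represented_class n f"
    using represents_transfer[OF R V(2)] by (simp add: represented_class_def)
qed

lemma represents_cong:
  assumes T: "represents n T f" and eq: "\<And>x. x \<in> sequences n \<Longrightarrow> g x = f x"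
  shows "represents n T g"
proof -
  obtain Q d r K B where t: "tracking n T Q d f r K B" using T unfolding represents_def by blast
  interpret tracking n T Q d f r K B by (rule t)
  have "tracking n T Q d g r K B"
  proof
    show "block_code n r g" by (rule block_code_cong[OF code eq])
    show "out T (x 0) (Q x) ! i = g x (d x + int i)"
      if "x \<in> sequences n" "i < length (out T (x 0) (Q x))" for x i
      using nth_out[OF that] eq[OF that(1)] by simp
  qed (fact n2 K_nonneg states_eq next_Q length_out window bound)+
  then show ?thesis using T unfolding represents_def by blast
qed

lemma represented_class_cong:
  assumes "\<And>x. x \<in> sequences n \<Longrightarrow> f x = g x"
  shows "represented_class n f = represented_class n g"
  unfolding represented_class_def using represents_cong[of n _ f g] represents_cong[of n _ g f] assms by auto

text \<open>The same transducer serves, with all positions lowered by \<open>k\<close>.\<close>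

lemma represents_translate:
  assumes T: "represents n T f"
  shows "represents n T (\<lambda>x. translate k (f x))"
proof -
  obtain Q d r K B where t: "tracking n T Q d f r K B" using T unfolding represents_def by blast
  interpret tracking n T Q d f r K B by (rule t)
  have "tracking n T Q (\<lambda>x. d x - k) (\<lambda>x. translate k (f x)) (r + \<bar>k\<bar>) K (B + \<bar>k\<bar>)"
  proof
    show "block_code n (r + \<bar>k\<bar>) (\<lambda>x. translate k (f x))"
      by (rule block_code_comp[OF code block_code_translation])
    fix x :: "int \<Rightarrow> nat" assume x: "x \<in> sequences n"
    show "out T (x 0) (Q x) ! i = translate k (f x) (d x - k + int i)"
      if "i < length (out T (x 0) (Q x))" for i
      using nth_out[OF x that] by simp
    show "d (translate 1 x) - k + 1 = d x - k + int (length (out T (x 0) (Q x)))"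
      using length_out[OF x] by simp
    show "\<bar>d x - k\<bar> \<le> B + \<bar>k\<bar>" using bound[OF x] by linarith
    show "Q x = Q y \<and> d x - k = d y - k"
      if "y \<in> sequences n" "\<And>i. - K \<le> i \<Longrightarrow> i < 0 \<Longrightarrow> x i = y i" for y
      using window[OF x that] by simp
  qed (fact n2 K_nonneg states_eq next_Q)+
  then show ?thesis using T unfolding represents_def by blast
qed

text \<open>Members of classes have natural numbers as states, while reductions have sets as states;
  a copy bridges the types.\<close>

lemma represents_nat:
  fixes T :: "'q transducer"
  assumes T: "represents n T f"
  shows "\<exists>V :: nat transducer. represents n V f"
proof -
  have "is_transducer n T" using represents_in_M[OF T] by (simp add: in_M_def)
  then have fin: "finite (states T)" by (simp add: is_transducer_def)
  have cT: "responsive n T" and wT: "weakly_minimal n T" using T by (auto simp: represents_def)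
  note pT = responsive_productive[OF cT]
  obtain g :: "'q \<Rightarrow> nat" where g: "inj_on g (states T)"
    using finite_imp_inj_to_nat_seg[OF fin] by blast
  define V where "V = \<lparr>states = g ` states T,
    next_state = (\<lambda>a s. g (next_state T a (inv_into (states T) g s))),
    out = (\<lambda>a s. out T a (inv_into (states T) g s))\<rparr>"
  have V: "states V = g ` states T"
    "\<And>a q. q \<in> states T \<Longrightarrow> next_state V a (g q) = g (next_state T a q)"
    "\<And>a q. q \<in> states T \<Longrightarrow> out V a (g q) = out T a q"
    by (simp_all add: V_def inv_into_f_f[OF g])
  have ow: "out_word V w (g q) = out_word T w q" if "q \<in> states T" "w \<in> words n" for q w
    using that by (induction w arbitrary: q) (simp_all add: V productive_next[OF pT])
  have sm: "state_map V (g q) v = state_map T q v" if "q \<in> states T" "v \<in> sequences n" for q v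
    using that by (simp add: state_map_def ow)
  have "responsive n V"
    using cT unfolding responsive_def productive_def V(1) branches_at_def
    by (simp add: V(2,3) ow sm)
  moreover have "weakly_minimal n V"
    using wT unfolding weakly_minimal_def V(1) omega_equivalent_def by (auto simp: sm)
  moreover have "transducer_eq n T V"
    unfolding transducer_eq_def V(1) omega_equivalent_def
    using inj_on_imp_bij_betw[OF g] by (auto simp: sm)
  ultimately show ?thesis using represents_transfer[OF T] by blast
qed

text \<open>A state stores the last \<open>2 * r\<close> letters. Together with the next letter they
  form the window around \<open>- r\<close>, so the letter written belongs to position
  \<open>- r\<close>. For a code of radius \<open>r\<close> the value there does not depend on the 0
  outside the window.\<close>

definition window_transducer ::
  "nat \<Rightarrow> int \<Rightarrow> ((int \<Rightarrow> nat) \<Rightarrow> int \<Rightarrow> nat) \<Rightarrow> nat list transducer" where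
  "window_transducer n r f = \<lparr>states = {u \<in> words n. length u = nat (2 * r)},
     next_state = (\<lambda>a u. tl (u @ [a])),
     out = (\<lambda>a u. [f (\<lambda>i. if - 2 * r \<le> i \<and> i \<le> 0 then (u @ [a]) ! nat (i + 2 * r) else 0) (- r)])\<rparr>"

lemma tracking_window_transducer:
  assumes f: "block_code n r f" and n: "2 \<le> n"
  shows "tracking n (window_transducer n r f)
    (\<lambda>x. map (\<lambda>i. x (int i - 2 * r)) [0..<nat (2 * r)]) (\<lambda>_. - r) f r (2 * r) r"
proof
  let ?Q = "\<lambda>x :: int \<Rightarrow> nat. map (\<lambda>i. x (int i - 2 * r)) [0..<nat (2 * r)]"
  let ?T = "window_transducer n r f"
  have r: "0 \<le> r" by (rule block_code_radius_nonneg[OF f])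
  show "block_code n r f" "2 \<le> n" "0 \<le> 2 * r" using f n r by simp_all
  show "states ?T = ?Q ` sequences n"
  proof (intro equalityI subsetI)
    fix u assume u: "u \<in> states ?T"
    define x where "x = (\<lambda>i. if - 2 * r \<le> i \<and> i < 0 then u ! nat (i + 2 * r) else 0)"
    have lu: "length u = nat (2 * r)" "set u \<subseteq> {..<n}"
      using u by (auto simp: window_transducer_def words_def)
    have "x i < n" for i
    proof (cases "- 2 * r \<le> i \<and> i < 0")
      case True
      then have "u ! nat (i + 2 * r) \<in> set u" using lu by (intro nth_mem) (simp add: nat_less_iff)
      then have "u ! nat (i + 2 * r) < n" using lu(2) by blast
      then show ?thesis using True by (simp add: x_def)
    next
      case False
      then show ?thesis using n by (auto simp: x_def)
    qed
    then have "x \<in> sequences n" by (simp add: mem_sequences)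
    moreover have "u = ?Q x" by (rule nth_equalityI) (simp_all add: x_def lu)
    ultimately show "u \<in> ?Q ` sequences n" by (intro image_eqI)
  next
    fix u assume "u \<in> ?Q ` sequences n"
    then show "u \<in> states ?T" by (auto simp: window_transducer_def words_def mem_sequences)
  qed
  fix x :: "int \<Rightarrow> nat" assume x: "x \<in> sequences n"
  have Qn: "(?Q x @ [x 0]) ! i = x (int i - 2 * r)" if "i \<le> nat (2 * r)" for i
    using that r by (auto simp: nth_append)
  have "tl (?Q x @ [x 0]) = ?Q (translate 1 x)"
  proof (rule nth_equalityI)
    fix i assume "i < length (tl (?Q x @ [x 0]))"
    then have i: "Suc i \<le> nat (2 * r)" by simp
    have "tl (?Q x @ [x 0]) ! i = (?Q x @ [x 0]) ! Suc i"
      using i by (intro nth_tl) simp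
    also have "\<dots> = x (int (Suc i) - 2 * r)" by (rule Qn[OF i])
    finally show "tl (?Q x @ [x 0]) ! i = ?Q (translate 1 x) ! i"
      using i by (simp add: algebra_simps)
  qed simp
  then show "next_state ?T (x 0) (?Q x) = ?Q (translate 1 x)"
    by (simp add: window_transducer_def)
  show "- r + 1 = - r + int (length (out ?T (x 0) (?Q x)))"
    by (simp add: window_transducer_def)
  show "out ?T (x 0) (?Q x) ! i = f x (- r + int i)" if "i < length (out ?T (x 0) (?Q x))" for i
  proof -
    let ?y = "\<lambda>i. if - 2 * r \<le> i \<and> i \<le> 0 then (?Q x @ [x 0]) ! nat (i + 2 * r) else 0"
    have y: "?y i = x i" if "- 2 * r \<le> i" "i \<le> 0" for i
      using that Qn[of "nat (i + 2 * r)"] by simp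
    have "?y i < n" for i
      using y[of i] x n by (cases "- 2 * r \<le> i \<and> i \<le> 0") (auto simp: mem_sequences)
    then have "?y \<in> sequences n" by (simp add: mem_sequences)
    then have "f ?y (- r) = f x (- r)"
      using y by (intro block_code_local[OF f _ x]) auto
    then show ?thesis using that by (simp add: window_transducer_def)
  qed
  show "\<bar>- r\<bar> \<le> r" using r by simp
  show "?Q x = ?Q y \<and> - r = - r"
    if "y \<in> sequences n" "\<And>i. - (2 * r) \<le> i \<Longrightarrow> i < 0 \<Longrightarrow> x i = y i" for y
    using that by auto
qed

lemma invertible_code_inj: "invertible_code n r f g \<Longrightarrow> inj_on f (sequences n)"
  by (rule inj_on_inverseI[of _ g]) (rule invertible_codeD(4))

lemma represented_class_nonempty:
  assumes f: "invertible_code n r f g" and n: "2 \<le> n"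
  obtains V :: "nat transducer" where "represents n V f" "represented_class n f = transducer_class n V"
proof -
  have "represents n (reduction n (window_transducer n r f)) f"
    by (rule represents_reduction[OF tracking_window_transducer invertible_code_inj])
      (use f n invertible_codeD in blast)+
  then obtain V :: "nat transducer" where "represents n V f" using represents_nat by blast
  then show ?thesis using that transducer_class_represents by metis
qed

text \<open>All pairs of representatives yield one class, so the union defining the product
  collapses, the two classes being nonempty.\<close>

lemma M_mult_represented:
  assumes f: "invertible_code n r f f'" and g: "invertible_code n s g g'" and n: "2 \<le> n"
  shows "represented_class n f \<otimes>\<^bsub>M_monoid n\<^esub> represented_class n g = represented_class n (\<lambda>x. g (f x))"
proof -
  obtain V W :: "nat transducer" where V: "represents n V f" and W: "represents n W g"
    using represented_class_nonempty[OF f n] represented_class_nonempty[OF g n] by metis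
  have *: "transducer_class n (reduction n (core n (transducer_prod T U))) = represented_class n (\<lambda>x. g (f x))"
    if TU: "represents n T f" "represents n U g" for T U :: "nat transducer"
  proof -
    obtain Q d r K B where T: "tracking n T Q d f r K B" using TU(1) unfolding represents_def by blast
    obtain P e s L C where U: "tracking n U P e g s L C" using TU(2) unfolding represents_def by blast
    show ?thesis
      by (intro transducer_class_represents represents_reduction[OF tracking_prod[OF T U]]
          invertible_code_inj[OF invertible_code_comp[OF f g]])
  qed
  have "represented_class n f \<otimes>\<^bsub>M_monoid n\<^esub> represented_class n g =
      (\<Union>T\<in>represented_class n f. \<Union>U\<in>represented_class n g.
        transducer_class n (reduction n (core n (transducer_prod T U))))"
    by (simp add: M_monoid_def)
  also have "\<dots> = (\<Union>T\<in>represented_class n f. \<Union>U\<in>represented_class n g. represented_class n (\<lambda>x. g (f x)))"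
    by (intro SUP_cong refl *) (simp_all add: represented_class_def)
  also have "\<dots> = represented_class n (\<lambda>x. g (f x))"
    using V W unfolding represented_class_def by blast
  finally show ?thesis .
qed

lemma represents_identity:
  assumes n: "2 \<le> n"
  shows "represents n identity_transducer (\<lambda>x. x)"
proof -
  have t: "tracking n identity_transducer (\<lambda>_. ()) (\<lambda>_. 0) (\<lambda>x. x) 0 0 0"
  proof
    have "(\<lambda>_. 0) \<in> sequences n" using n by (simp add: mem_sequences)
    then show "states identity_transducer = (\<lambda>_. ()) ` sequences n"
      by (auto simp: identity_transducer_def)
    show "block_code n 0 (\<lambda>x. x)" by (rule invertible_codeD(1)[OF invertible_code_id])
  qed (use n in \<open>auto simp: identity_transducer_def\<close>)
  interpret tracking n identity_transducer "\<lambda>_. ()" "\<lambda>_. 0" "\<lambda>x. x" 0 0 0 by (rule t)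
  have sm: "state_map identity_transducer () v = v" if "v \<in> sequences n" for v
    using state_map_Q[OF zero_in_sequences that] by (simp add: glue_def)
  have 1: "(\<lambda>_. 1) \<in> sequences n" using n by (simp add: mem_sequences)
  have "state_map identity_transducer () (\<lambda>_. 0) 0 \<noteq> state_map identity_transducer () (\<lambda>_. 1) 0"
    unfolding sm[OF zero_in_sequences] sm[OF 1] by simp
  then have "branches_at n (state_map identity_transducer ()) 0"
    unfolding branches_at_def using 1 zero_in_sequences by blast
  then have "responsive n identity_transducer" using productive by (simp add: responsive_def)
  moreover have "weakly_minimal n identity_transducer" by (simp add: weakly_minimal_def)
  ultimately show ?thesis using t unfolding represents_def by blast
qed

text \<open>Let an output be changed from index \<open>N = s + B\<close> on. Since the inverse has
  radius \<open>s\<close> and \<open>d x >= - B\<close>, the preimage keeps its past, hence is again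
  read from the state \<open>q\<close>.\<close>

lemma (in tracking) image_clopen:
  assumes g: "block_code n s g" and gf: "\<And>x. x \<in> sequences n \<Longrightarrow> g (f x) = x \<and> f (g x) = x"
    and q: "q \<in> states T"
  shows "openin (sequence_topology n) (state_map T q ` sequences n)"
    and "closedin (sequence_topology n) (state_map T q ` sequences n)"
proof -
  obtain x where x: "x \<in> sequences n" "q = Q x" using q by (auto simp: states_eq)
  have sub: "state_map T q ` sequences n \<subseteq> sequences n"
    using state_map_in_sequences[OF productive q] by blast
  define N where "N = nat (s + B)"
  have win: "v' \<in> state_map T q ` sequences n"
    if "v \<in> state_map T q ` sequences n" "v' \<in> sequences n" "\<And>i. i \<in> {..<N} \<Longrightarrow> v i = v' i" for v v'
  proof -
    from that(1) obtain w where w: "w \<in> sequences n" "v = state_map T q w" by blast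
    define y where "y = glue x w"
    have y: "y \<in> sequences n" using x w by (simp add: y_def)
    have v: "v i = f y (d x + int i)" for i using x w by (simp add: state_map_Q y_def)
    \<comment> \<open>The image point \<open>f y\<close> with everything from position
      \<open>d x\<close> on replaced by \<open>v'\<close>.\<close>
    define z where "z = translate (- d x) (glue (translate (d x) (f y)) v')"
    have fy: "f y \<in> sequences n" by (rule block_code_mem[OF code y])
    have z: "z \<in> sequences n" using fy that(2) by (simp add: z_def)
    have zj: "z j = f y j" if "j < d x + int N" for j
    proof (cases "j < d x")
      case True then show ?thesis by (simp add: z_def glue_def)
    next
      case False
      then have "z j = v' (nat (j - d x))" by (simp add: z_def glue_def)
      also have "\<dots> = v (nat (j - d x))" using False that \<open>\<And>i. i \<in> {..<N} \<Longrightarrow> v i = v' i\<close> by simp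
      also have "\<dots> = f y j" using False by (simp add: v)
      finally show ?thesis .
    qed
    define u where "u = g z"
    have u: "u \<in> sequences n" "f u = z" using block_code_mem[OF g z] gf[OF z] by (simp_all add: u_def)
    have ux: "u i = x i" if i: "i < 0" for i
    proof -
      have "g z i = g (f y) i"
        using i bound[OF x(1)] by (intro block_code_local[OF g z fy] zj) (auto simp: N_def)
      then show ?thesis using gf[OF y] i by (simp add: u_def y_def)
    qed
    have "Q u = q" "d u = d x" using window[OF u(1) x(1)] ux x(2) by auto
    then have "state_map T q (future u) = (\<lambda>i. z (d x + int i))"
      using state_map_future[OF u(1)] u(2) by simp
    also have "\<dots> = v'" by (simp add: z_def glue_def fun_eq_iff)
    finally show ?thesis using u(1) by (metis future_in_sequences image_eqI)
  qed
  show "openin (sequence_topology n) (state_map T q ` sequences n)"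
    by (rule openin_finite_window[OF sub finite_lessThan[of N] win])
  show "closedin (sequence_topology n) (state_map T q ` sequences n)"
    by (rule closedin_finite_window[OF sub finite_lessThan[of N] win])
qed

lemma represented_class_O_tilde:
  assumes f: "invertible_code n r f g" and n: "2 \<le> n"
  shows "represented_class n f \<in> O_tilde n"
proof -
  obtain V :: "nat transducer" where V: "represents n V f" "represented_class n f = transducer_class n V"
    by (rule represented_class_nonempty[OF assms])
  obtain Q d s K B where "tracking n V Q d f s K B" using V(1) unfolding represents_def by blast
  then interpret tracking n V Q d f s K B .
  note F = invertible_codeD[OF f]
  have "g (f x) = x \<and> f (g x) = x" if "x \<in> sequences n" for x using F(4,5) that by blast
  then show ?thesis
    unfolding O_tilde_def V(2)
    using represents_in_M[OF V(1)] nonconstant_state_map(1)[OF invertible_code_inj[OF f]] image_clopen[OF F(2)]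
    by blast
qed

lemma represented_class_L_tilde:
  assumes f: "invertible_code n r f g" and n: "2 \<le> n"
  shows "represented_class n f \<in> L_tilde n"
proof -
  obtain V :: "nat transducer" where V: "represents n V f" "represented_class n f = transducer_class n V"
    by (rule represented_class_nonempty[OF assms])
  obtain Q d s K B where "tracking n V Q d f s K B" using V(1) unfolding represents_def by blast
  then interpret tracking n V Q d f s K B .
  show ?thesis
    unfolding L_tilde_def V(2) using represents_in_M[OF V(1)] loop_length by blast
qed

lemma M_one: "2 \<le> n \<Longrightarrow> \<one>\<^bsub>M_monoid n\<^esub> = represented_class n (\<lambda>x. x)"
  using transducer_class_represents[OF represents_identity] by (simp add: M_monoid_def)

lemma represented_class_L_group:
  assumes f: "invertible_code n r f g" and n: "2 \<le> n"
  shows "represented_class n f \<in> carrier (L_group n)"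
proof -
  note F = invertible_codeD[OF f] and g = invertible_code_sym[OF f]
  have 1: "represented_class n f \<otimes>\<^bsub>M_monoid n\<^esub> represented_class n g = \<one>\<^bsub>M_monoid n\<^esub>"
    unfolding M_mult_represented[OF f g n] M_one[OF n] by (rule represented_class_cong) (rule F(4))
  have 2: "represented_class n g \<otimes>\<^bsub>M_monoid n\<^esub> represented_class n f = \<one>\<^bsub>M_monoid n\<^esub>"
    unfolding M_mult_represented[OF g f n] M_one[OF n] by (rule represented_class_cong) (rule F(5))
  have "represented_class n f \<in> O_units n"
    unfolding O_units_def Units_def
    using 1 2 represented_class_O_tilde[OF f n] represented_class_O_tilde[OF g n] by auto
  then show ?thesis
    using represented_class_L_tilde[OF f n] by (simp add: L_group_def)
qed

text \<open>The point \<open>z\<close> with the past of \<open>x\<close> and the future of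
  \<open>y\<close> looks like \<open>x\<close> at time 0 and like \<open>y\<close> at time
  \<open>W\<close>.\<close>

lemma shift_invariant_const:
  fixes c :: "(int \<Rightarrow> nat) \<Rightarrow> int"
  assumes inv: "\<And>x. x \<in> sequences n \<Longrightarrow> c (translate 1 x) = c x"
    and win: "\<And>x y. x \<in> sequences n \<Longrightarrow> y \<in> sequences n \<Longrightarrow>
      (\<And>i. - W \<le> i \<Longrightarrow> i < 0 \<Longrightarrow> x i = y i) \<Longrightarrow> c x = c y"
    and x: "x \<in> sequences n" and y: "y \<in> sequences n"
  shows "c x = c y"
proof -
  have invk: "c (translate (int k) x) = c x" if x: "x \<in> sequences n" for k x
  proof (induction k)
    case (Suc k)
    have "translate (int (Suc k)) x = translate 1 (translate (int k) x)" by simp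
    moreover have "c (translate 1 (translate (int k) x)) = c (translate (int k) x)"
      by (rule inv) (simp add: x)
    ultimately show ?case using Suc by (simp only:)
  qed simp
  define z where "z = glue x (future y)"
  have z: "z \<in> sequences n" using x y by (simp add: z_def)
  have "c x = c z" using x z by (intro win) (simp_all add: z_def)
  also have "\<dots> = c (translate (int (nat W)) z)" by (rule invk[OF z, symmetric])
  also have "\<dots> = c (translate (int (nat W)) y)"
    using y z by (intro win) (auto simp: z_def glue_def)
  also have "\<dots> = c y" by (rule invk[OF y])
  finally show ?thesis .
qed

text \<open>Synchronization forces \<open>Q = P\<close>. So both positions advance alike, and their
  difference is shift invariant, hence a constant \<open>k\<close>: the power of the shift in
  question.\<close>

lemma represents_same_transducer:
  assumes f: "represents n V f" and g: "represents n V g"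
  obtains k where "\<And>x. x \<in> sequences n \<Longrightarrow> g x = translate k (f x)"
proof -
  obtain Q d r K B where T: "tracking n V Q d f r K B" using f unfolding represents_def by blast
  obtain P e s L C where U: "tracking n V P e g s L C" using g unfolding represents_def by blast
  interpret T: tracking n V Q d f r K B by (rule T)
  interpret U: tracking n V P e g s L C by (rule U)
  have QP: "Q x = P x" if x: "x \<in> sequences n" for x
  proof -
    define y where "y = translate (- int (nat K)) x"
    have y: "y \<in> sequences n" using x by (simp add: y_def)
    have "sync_level n V (nat K)" by (rule T.sync_level_K) simp
    moreover have "Q y \<in> states V" "P y \<in> states V"
      using y T.states_eq U.states_eq by blast+
    moreover have "prefix (nat K) (future y) \<in> words n" "length (prefix (nat K) (future y)) = nat K"
      using y by simp_all
    ultimately have "next_state_word V (prefix (nat K) (future y)) (Q y) =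
        next_state_word V (prefix (nat K) (future y)) (P y)"
      unfolding sync_level_def by blast
    then show ?thesis
      using T.forced[OF x, of "nat K"] U.forced[OF x, of "nat K"] by (simp add: y_def)
  qed
  have const: "d x - e x = d y - e y" if "x \<in> sequences n" "y \<in> sequences n" for x y
  proof (rule shift_invariant_const[where c = "\<lambda>x. d x - e x" and W = "max K L", OF _ _ that])
    fix x :: "int \<Rightarrow> nat" assume x: "x \<in> sequences n"
    show "d (translate 1 x) - e (translate 1 x) = d x - e x"
      using T.length_out[OF x] U.length_out[OF x] QP[OF x] by simp
    fix y :: "int \<Rightarrow> nat" assume y: "y \<in> sequences n"
      and eq: "\<And>i. - max K L \<le> i \<Longrightarrow> i < 0 \<Longrightarrow> x i = y i"
    have "d x = d y" using eq by (intro conjunct2[OF T.window[OF x y]]) auto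
    moreover have "e x = e y" using eq by (intro conjunct2[OF U.window[OF x y]]) auto
    ultimately show "d x - e x = d y - e y" by simp
  qed
  define k where "k = d (\<lambda>_. 0) - e (\<lambda>_. 0)"
  have k: "d x = e x + k" if "x \<in> sequences n" for x
    using const[OF that T.zero_in_sequences] by (simp add: k_def)
  have "g x = translate k (f x)" if x: "x \<in> sequences n" for x
  proof
    fix j
    \<comment> \<open>Starting \<open>m\<close> steps earlier, the output begins at or before
      position \<open>j\<close>, because \<open>e y <= C <= j + int m\<close>.\<close>
    define m where "m = nat (C - j)"
    define y where "y = translate (- int m) x"
    have y: "y \<in> sequences n" using x by (simp add: y_def)
    define i where "i = nat (j + int m - e y)"
    have i: "e y + int i = j + int m" using U.bound[OF y] unfolding i_def m_def by linarith
    have "f y (d y + int i) = g y (e y + int i)"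
      using fun_cong[OF T.state_map_future[OF y], of i] fun_cong[OF U.state_map_future[OF y], of i] QP[OF y]
      by simp
    moreover have "d y + int i = j + int m + k" using i k[OF y] by simp
    ultimately have "f y (j + int m + k) = g y (j + int m)" using i by simp
    then show "g x j = translate k (f x) j"
      unfolding y_def block_code_translate[OF T.code x] block_code_translate[OF U.code x]
      by (simp add: algebra_simps)
  qed
  then show ?thesis by (rule that)
qed

section \<open>Every unit arises from an automorphism\<close>

definition length_preserving_loops :: "nat \<Rightarrow> 'q transducer \<Rightarrow> bool" where
  "length_preserving_loops n T \<longleftrightarrow> (\<forall>w\<in>words n. \<forall>q\<in>states T.
     next_state_word T w q = q \<longrightarrow> length (out_word T w q) = length w)"

lemma omega_equivalent_word:
  assumes T: "responsive n T" and U: "responsive n U"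
    and "p \<in> states T" "q \<in> states U" "omega_equivalent n T p U q" "w \<in> words n"
  shows "out_word T w p = out_word U w q \<and>
    omega_equivalent n T (next_state_word T w p) U (next_state_word U w q)"
  using assms(3-6)
proof (induction w arbitrary: p q)
  case (Cons a w)
  have a: "a < n" "w \<in> words n" using Cons.prems by simp_all
  note s = omega_equivalent_step[OF T U Cons.prems(1-3) a(1)]
  have "next_state T a p \<in> states T" "next_state U a q \<in> states U"
    using productive_next[OF responsive_productive[OF T] Cons.prems(1) a(1)]
      productive_next[OF responsive_productive[OF U] Cons.prems(2) a(1)] .
  from Cons.IH[OF this conjunct2[OF s] a(2)] s show ?case by simp
qed simp

text \<open>A loop of \<open>U\<close> closes up in \<open>T\<close> only up to equivalence; weak
  minimality of \<open>T\<close> makes it a genuine loop.\<close>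

lemma length_preserving_loops_transfer:
  assumes T: "responsive n T" "weakly_minimal n T" "length_preserving_loops n T"
    and U: "responsive n U" and eq: "transducer_eq n T U"
  shows "length_preserving_loops n U"
  unfolding length_preserving_loops_def
proof (intro ballI impI)
  fix w q assume w: "w \<in> words n" and q: "q \<in> states U" and loop: "next_state_word U w q = q"
  obtain h where h: "bij_betw h (states T) (states U)"
      "\<And>q. q \<in> states T \<Longrightarrow> omega_equivalent n T q U (h q)"
    using eq unfolding transducer_eq_def by blast
  have "q \<in> h ` states T" using bij_betw_imp_surj_on[OF h(1)] q by simp
  then obtain p where p: "p \<in> states T" "h p = q" by blast
  have pq: "omega_equivalent n T p U q" using h(2)[OF p(1)] p(2) by simp
  note s = omega_equivalent_word[OF T(1) U p(1) q pq w]
  have "omega_equivalent n T (next_state_word T w p) T p"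
    using omega_equivalent_trans[OF conjunct2[OF s]] omega_equivalent_sym[OF pq] loop by simp
  then have "next_state_word T w p = p"
    using T(2) p(1) productive_words(1)[OF responsive_productive[OF T(1)] w p(1)]
    unfolding weakly_minimal_def by blast
  then have "length (out_word T w p) = length w"
    using T(3) w p(1) unfolding length_preserving_loops_def by blast
  then show "length (out_word U w q) = length w" using s by simp
qed

lemma transducer_eq_nonconstant:
  assumes eq: "transducer_eq n T U" and T: "states T \<noteq> {}"
    "\<And>q. q \<in> states T \<Longrightarrow> nonconstant n (state_map T q)" and U: "in_M n U"
  shows "responsive n U" "weakly_minimal n U" "strongly_connected n U"
proof -
  obtain h where h: "bij_betw h (states T) (states U)"
      "\<And>q. q \<in> states T \<Longrightarrow> omega_equivalent n T q U (h q)"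
    using eq unfolding transducer_eq_def by blast
  obtain q where q: "q \<in> states T" using T(1) by blast
  have "nonconstant n (state_map U (h q))"
    using h(2)[OF q] T(2)[OF q] by (auto simp: omega_equivalent_def intro: nonconstant_cong[rotated])
  from in_M_nonconstant[OF U bij_betw_apply[OF h(1) q] this]
  show "responsive n U" "weakly_minimal n U" "strongly_connected n U" .
qed

lemma inj_on_nonconstant:
  assumes "inj_on f (sequences n :: nat word set)" "2 \<le> n"
  shows "nonconstant n f"
proof -
  have 01: "(\<lambda>_. 0) \<in> (sequences n :: nat word set)" "(\<lambda>_. 1) \<in> (sequences n :: nat word set)"
    using assms(2) by (simp_all add: mem_sequences)
  have "f (\<lambda>_. 0) \<noteq> f (\<lambda>_. 1)"
  proof
    assume "f (\<lambda>_. 0) = f (\<lambda>_. 1)"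
    from inj_onD[OF assms(1) this 01] show False by (auto dest: fun_cong)
  qed
  then show ?thesis unfolding nonconstant_def using 01 by blast
qed

lemma O_tilde_representative:
  assumes A: "A \<in> O_tilde n" and T: "T \<in> A" and n: "2 \<le> n"
  shows "in_M n T" "responsive n T" "weakly_minimal n T" "strongly_connected n T"
    "A = transducer_class n T"
proof -
  obtain T0 :: "nat transducer" where T0: "A = transducer_class n T0" "in_M n T0"
      "\<And>q. q \<in> states T0 \<Longrightarrow> inj_on (state_map T0 q) (sequences n)"
    using A unfolding O_tilde_def by blast
  have T: "in_M n T" "transducer_eq n T T0" using T unfolding T0(1) transducer_class_def by auto
  have "states T0 \<noteq> {}" using T0(2) unfolding in_M_def is_transducer_def by blast
  from transducer_eq_nonconstant[OF transducer_eq_sym[OF T(2)] this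
      inj_on_nonconstant[OF T0(3) n] T(1)] T(1)
  show "in_M n T" "responsive n T" "weakly_minimal n T" "strongly_connected n T" by blast+
  show "A = transducer_class n T" unfolding T0(1) by (rule transducer_class_cong[OF T(2), symmetric])
qed

lemma class_members_eq:
  "T \<in> transducer_class n V \<Longrightarrow> U \<in> transducer_class n V \<Longrightarrow> transducer_eq n T U"
  unfolding transducer_class_def using transducer_eq_trans transducer_eq_sym by blast

subsection \<open>Products that reduce to the identity\<close>

lemma productive_prod:
  assumes T: "productive n T" and U: "productive n U"
  shows "productive n (core n (transducer_prod T U))"
  unfolding productive_def
proof (intro conjI ballI allI impI)
  let ?P = "transducer_prod T U"
  have closed: "next_state ?P a s \<in> states ?P" "out ?P a s \<in> words n"
    if s: "s \<in> states ?P" and a: "a < n" for s a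
  proof -
    obtain p q where pq: "s = (p, q)" "p \<in> states T" "q \<in> states U" using s by (cases s) simp
    show "next_state ?P a s \<in> states ?P" "out ?P a s \<in> words n"
      using pq a by (simp_all add: productive_next[OF T] productive_out[OF T] productive_words[OF U])
  qed
  have mem: "next_state_word ?P w s \<in> states ?P" if "s \<in> states ?P" "w \<in> words n" for w s
    using that by (induction w arbitrary: s) (simp_all add: closed del: transducer_prod_simps)
  fix s assume s: "s \<in> states (core n ?P)"
  then obtain w q k where w: "s = next_state_word ?P w q" "sync_level n ?P k" "w \<in> words n"
      "length w = k" "q \<in> states ?P"
    by (auto simp: core_def)
  have sP: "s \<in> states ?P" using mem w by blast
  show "next_state (core n ?P) a s \<in> states (core n ?P)" if a: "a < n" for a
  proof -
    \<comment> \<open>Dropping the first letter of \<open>w @ [a]\<close> leaves a word of length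
      \<open>k\<close>, which forces the next state at the same level.\<close>
    obtain b w' where bw: "w @ [a] = b # w'" by (cases "w @ [a]") simp_all
    have l: "length w' = k" using arg_cong[OF bw, of length] w(4) by simp
    have "w @ [a] \<in> words n" using w(3) a by simp
    then have b: "b < n" "w' \<in> words n" unfolding bw by simp_all
    have "next_state ?P a s = next_state_word ?P (w @ [a]) q"
      by (simp add: next_state_word_append w(1))
    also have "\<dots> = next_state_word ?P w' (next_state ?P b q)" by (simp add: bw)
    finally show ?thesis
      using core_memI[OF w(2) b(2) l closed(1)[OF w(5) b(1)]] by simp
  qed
  show "out (core n ?P) a s \<in> words n" if "a < n" for a using closed(2)[OF sP that] by simp
  fix v :: "nat word" and m assume v: "v \<in> sequences n"
  obtain p q where pq: "s = (p, q)" "p \<in> states T" "q \<in> states U" using sP by auto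
  define f where "f = state_map T p v"
  have f: "f \<in> sequences n" unfolding f_def by (rule state_map_in_sequences[OF T pq(2) v])
  obtain k where k: "m \<le> length (out_word U (prefix k f) q)"
    using productive_length[OF U pq(3) f] by blast
  obtain l where l: "k \<le> length (out_word T (prefix l v) p)"
    using productive_length[OF T pq(2) v] by blast
  define i where "i = length (out_word T (prefix l v) p) - k"
  have "out_word T (prefix l v) p = prefix (k + i) f"
    unfolding f_def using l by (subst out_word_prefix) (simp add: i_def)
  then have "out_word (core n ?P) (prefix l v) s = out_word U (prefix k f @ (f [k \<rightarrow> k + i])) q"
    by (simp add: pq(1) transducer_prod_word subsequence_append)
  then have "m \<le> length (out_word (core n ?P) (prefix l v) s)"
    using k by (simp add: out_word_append)
  then show "\<exists>k. m \<le> length (out_word (core n ?P) (prefix k v) s)" by blast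
qed

text \<open>What is known of a product that reduces to the identity: the reduction only stripped a
  fixed word from the output of each state.\<close>

definition prefixing :: "nat \<Rightarrow> 'q transducer \<Rightarrow> bool" where
  "prefixing n C \<longleftrightarrow> (\<forall>s\<in>states C. \<exists>c. \<forall>v\<in>sequences n. state_map C s v = c \<frown> v)"

lemma state_map_identity: "state_map identity_transducer () v = v"
proof (rule state_map_eqI)
  fix i
  have "out_word identity_transducer w () = w" for w
    by (induction w) (simp_all add: identity_transducer_def)
  then show "\<exists>k. i < length (out_word identity_transducer (prefix k v) ()) \<and>
      out_word identity_transducer (prefix k v) () ! i = v i"
    by (intro exI[of _ "Suc i"]) (simp del: subseq_to_Suc)
qed

text \<open>The identity is not constant, which rules out the branch for infinite extent; in the
  other branch identifying states preserves their maps, and the removal has only cut off a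
  prefix.\<close>

lemma reduces_to_identity:
  assumes C: "productive n C" and n: "2 \<le> n"
    and eq: "transducer_eq n (reduction n C) identity_transducer"
  shows "prefixing n C" "states C \<noteq> {}"
proof -
  let ?R = "reduction n C"
  have id: "state_map ?R q v = v" if "q \<in> states ?R" "v \<in> sequences n" for q v
    using eq that by (auto simp: transducer_eq_def omega_equivalent_def state_map_identity)
  have ne: "states ?R \<noteq> {}"
    using eq by (auto simp: transducer_eq_def bij_betw_def identity_transducer_def)
  have nc: "nonconstant n (state_map C q)" if q: "q \<in> states C" for q
  proof (rule ccontr)
    assume "\<not> nonconstant n (state_map C q)"
    then have R: "?R = Z_transducer (states C) (constant_word n C)"
      using q by (auto simp: reduction_def extent_eq)
    define s where "s = states C"
    define x where "x = constant_word n C"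
    have s: "s \<in> states ?R" unfolding R by (simp add: Z_transducer_def s_def)
    have ow: "out_word ?R w s = concat (replicate (length w) x)" for w
      unfolding R by (induction w) (simp_all add: Z_transducer_def s_def x_def)
    have "state_map ?R s v = state_map ?R s w" for v w by (simp add: state_map_def ow)
    moreover have "(\<lambda>_. 0) \<in> (sequences n :: nat word set)" "(\<lambda>_. 1) \<in> (sequences n :: nat word set)"
      using n by (simp_all add: mem_sequences)
    ultimately have "(\<lambda>_. 0) = (\<lambda>_::nat. 1::nat)" using id[OF s] by metis
    then show False by (auto dest: fun_cong)
  qed
  define R1 where "R1 = remove_incomplete_response n C"
  have R1: "responsive n R1" unfolding R1_def by (rule responsive_remove[OF C nc])
  have R: "?R = identify_equivalent n R1" unfolding R1_def by (rule reduction_eq[OF nc])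
  show "states C \<noteq> {}" using ne unfolding R states_identify by (auto simp: R1_def)
  show "prefixing n C"
    unfolding prefixing_def
  proof
    fix s assume s: "s \<in> states C"
    define l where "l = response n (state_map C s)"
    have b: "branches_at n (state_map C s) l" unfolding l_def by (rule branches_at_response[OF nc[OF s]])
    have v0: "(\<lambda>_. 0) \<in> (sequences n :: nat word set)" using n by (simp add: mem_sequences)
    define c where "c = prefix l (state_map C s (\<lambda>_. 0))"
    have "state_map C s v i = (c \<frown> v) i" if v: "v \<in> sequences n" for v i
    proof (cases "i < l")
      case True
      then show ?thesis using branches_atD(1)[OF b v v0] by (simp add: c_def)
    next
      case False
      have "v = state_map ?R (omega_class n R1 s) v"
        using id[OF _ v] s unfolding R states_identify by (simp add: R1_def)
      also have "\<dots> = state_map R1 s v"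
        unfolding R using s by (intro state_map_identify[OF R1 _ v]) (simp add: R1_def)
      also have "\<dots> = (\<lambda>i. state_map C s v (l + i))"
        unfolding R1_def l_def by (rule state_map_remove[OF C nc s v])
      finally have "v (i - l) = state_map C s v (l + (i - l))" by (rule fun_cong)
      then show ?thesis using False by (simp add: c_def)
    qed
    then have "\<forall>v\<in>sequences n. state_map C s v = c \<frown> v" by blast
    then show "\<exists>c. \<forall>v\<in>sequences n. state_map C s v = c \<frown> v" ..
  qed
qed

lemma conc_length_unique:
  assumes n: "2 \<le> n" and eq: "\<And>v. v \<in> sequences n \<Longrightarrow> u \<frown> v = w \<frown> v"
  shows "length u = length w"
proof -
  have 01: "(\<lambda>_. 0) \<in> (sequences n :: nat word set)" "(\<lambda>_. 1) \<in> (sequences n :: nat word set)"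
    using n by (simp_all add: mem_sequences)
  have "branches_at n (\<lambda>v. v) 0"
    unfolding branches_at_def
  proof (intro conjI ballI allI impI)
    show "\<exists>v\<in>sequences n. \<exists>w\<in>sequences n. (v :: nat word) 0 \<noteq> (w :: nat word) 0"
      by (rule bexI[where x = "\<lambda>_. 0"], rule bexI[where x = "\<lambda>_. 1"]) (use 01 in simp_all)
  qed simp
  note b = branches_at_conc[OF this]
  have "branches_at n (\<lambda>v. u \<frown> v) (length u + 0)" by (rule b) simp
  moreover have "branches_at n (\<lambda>v. u \<frown> v) (length w + 0)" by (rule b) (rule eq)
  ultimately have "length u + 0 = length w + 0" by (rule branches_at_unique)
  then show ?thesis by simp
qed

text \<open>Gives the loop condition for the inverse of a unit, for which only membership in
  \<open>O_tilde\<close> is known. A loop \<open>a\<close> of \<open>T\<close> lifts to a loop of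
  the core at some \<open>(q, p)\<close>; its output \<open>b\<close> is a loop of \<open>U\<close>.
  Up to a fixed prefix the core copies its input, so \<open>U\<close> turns \<open>b\<close> into a
  word of length \<open>length a\<close>, and by assumption that length is also
  \<open>length b\<close>.\<close>

lemma length_preserving_loops_left:
  assumes n: "2 \<le> n" and T: "productive n T" and U: "productive n U"
    and C: "prefixing n (core n (transducer_prod T U))" "states (core n (transducer_prod T U)) \<noteq> {}"
    and loops: "length_preserving_loops n U"
  shows "length_preserving_loops n T"
  unfolding length_preserving_loops_def
proof (intro ballI impI)
  let ?P = "transducer_prod T U" and ?C = "core n (transducer_prod T U)"
  fix a q assume a: "a \<in> words n" and q: "q \<in> states T" and loop: "next_state_word T a q = q"
  show "length (out_word T a q) = length a"
  proof (cases "a = []")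
    case False
    obtain k where k: "sync_level n ?P k" using C(2) by (auto simp: core_def)
    obtain p0 where p0: "p0 \<in> states U" using C(2) by (auto simp: core_def)
    have mem: "next_state_word ?P w r \<in> states ?P" if "r \<in> states ?P" "w \<in> words n" for r w
      using that productive_words[OF T] productive_words[OF U] by (auto simp: transducer_prod_word)
    define w where "w = concat (replicate k a)"
    have w: "w \<in> words n" "k \<le> length w"
      using a False by (simp_all add: w_def replicate_in_words length_concat_replicate Suc_le_eq)
    define v v' where "v = take (length w - k) w" and "v' = drop (length w - k) w"
    have vv: "w = v @ v'" "v \<in> words n" "v' \<in> words n" "length v' = k"
      using w by (auto simp: v_def v'_def words_def dest: in_set_takeD in_set_dropD)
    have sync: "next_state_word ?P w r = next_state_word ?P w r'"
      if "r \<in> states ?P" "r' \<in> states ?P" for r r'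
      unfolding vv(1) next_state_word_append
      using k vv(3,4) mem[OF that(1) vv(2)] mem[OF that(2) vv(2)] unfolding sync_level_def by blast
    define s where "s = next_state_word ?P w (q, p0)"
    have r0: "(q, p0) \<in> states ?P" using q p0 by simp
    have sC: "s \<in> states ?C"
      unfolding s_def vv(1) next_state_word_append
      by (rule core_memI[OF k vv(3,4) mem[OF r0 vv(2)]])
    \<comment> \<open>As \<open>w\<close> is a power of \<open>a\<close> and synchronizes, the state
      forced by \<open>w\<close> is the same after one more \<open>a\<close>.\<close>
    have "w @ a = a @ w" unfolding w_def by (induction k) simp_all
    then have "next_state_word ?P a s = next_state_word ?P w (next_state_word ?P a (q, p0))"
      unfolding s_def by (metis next_state_word_append)
    also have "\<dots> = s" unfolding s_def by (rule sync[OF mem[OF r0 a] r0])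
    finally have sloop: "next_state_word ?P a s = s" .
    have "fst s = q" using replicate_word[OF loop, of k] by (simp add: s_def transducer_prod_word w_def)
    then obtain p where p: "s = (q, p)" by (cases s) simp
    have pU: "p \<in> states U" using mem[OF r0 w(1)] by (simp add: p flip: s_def)
    define b where "b = out_word T a q"
    have b: "b \<in> words n" unfolding b_def by (rule productive_words(2)[OF T a q])
    have "next_state_word U b p = p" using sloop by (simp add: p transducer_prod_word b_def)
    then have lb: "length (out_word U b p) = length b"
      using loops b pU unfolding length_preserving_loops_def by blast
    obtain c where c: "\<And>v. v \<in> sequences n \<Longrightarrow> state_map ?C s v = c \<frown> v"
      using C(1) sC unfolding prefixing_def by blast
    have "(c @ a) \<frown> v = (out_word U b p @ c) \<frown> v" if v: "v \<in> sequences n" for v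
    proof -
      have "(c @ a) \<frown> v = state_map ?C s (a \<frown> v)"
        using c[OF conc_in_sequences[OF a v]] by simp
      also have "\<dots> = out_word ?C a s \<frown> state_map ?C (next_state_word ?C a s) v"
        by (rule state_map_conc[OF productive_prod[OF T U] sC a v])
      also have "\<dots> = (out_word U b p @ c) \<frown> v"
        using sloop c[OF v] by (simp add: p transducer_prod_word b_def)
      finally show ?thesis .
    qed
    then have "length (c @ a) = length (out_word U b p @ c)" by (rule conc_length_unique[OF n])
    then show ?thesis using lb by (simp add: b_def)
  qed simp
qed

text \<open>The letter \<open>x 0\<close> is copied to position \<open>e x\<close>. Consecutive
  letters are copied to consecutive positions, so \<open>e\<close> is shift invariant, hence
  constant, and \<open>f\<close> is a power of the shift.\<close>

lemma tracking_prefixing: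
  assumes C: "tracking n C Q d f r K B" and p: "prefixing n C"
  shows "\<exists>k. \<forall>x\<in>sequences n. f x = translate k x"
proof -
  interpret tracking n C Q d f r K B by (rule C)
  obtain c where c: "\<And>s v. s \<in> states C \<Longrightarrow> v \<in> sequences n \<Longrightarrow> state_map C s v = c s \<frown> v"
    using p unfolding prefixing_def by metis
  have QC: "Q x \<in> states C" if "x \<in> sequences n" for x using that by (simp add: states_eq)
  define e where "e = (\<lambda>x. d x + int (length (c (Q x))))"
  have fe: "f x (e x) = x 0" if x: "x \<in> sequences n" for x
  proof -
    have "f x (e x) = state_map C (Q x) (future x) (length (c (Q x)))"
      using fun_cong[OF state_map_future[OF x], of "length (c (Q x))"] by (simp add: e_def)
    then show ?thesis using c[OF QC[OF x], of "future x"] x by simp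
  qed
  have step: "e (translate 1 x) = e x" if x: "x \<in> sequences n" for x
  proof -
    have a: "[x 0] \<in> words n" using x by (simp add: mem_sequences)
    have "(c (Q x) @ [x 0]) \<frown> v = (out C (x 0) (Q x) @ c (Q (translate 1 x))) \<frown> v"
      if v: "v \<in> sequences n" for v
    proof -
      have "(c (Q x) @ [x 0]) \<frown> v = state_map C (Q x) ([x 0] \<frown> v)"
        using c[OF QC[OF x] conc_in_sequences[OF a v]] by simp
      also have "\<dots> = out C (x 0) (Q x) \<frown> state_map C (Q (translate 1 x)) v"
        using state_map_conc[OF productive QC[OF x] a v] next_Q[OF x] by simp
      also have "\<dots> = (out C (x 0) (Q x) @ c (Q (translate 1 x))) \<frown> v"
        using c[OF QC[of "translate 1 x"] v] x by simp
      finally show ?thesis .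
    qed
    then have "length (c (Q x) @ [x 0]) = length (out C (x 0) (Q x) @ c (Q (translate 1 x)))"
      by (rule conc_length_unique[OF n2])
    then show ?thesis using length_out[OF x] by (simp add: e_def)
  qed
  have const: "e x = e y" if "x \<in> sequences n" "y \<in> sequences n" for x y
  proof (rule shift_invariant_const[where c = e and W = K, OF step _ that])
    show "e x = e y" if "x \<in> sequences n" "y \<in> sequences n"
      "\<And>i. - K \<le> i \<Longrightarrow> i < 0 \<Longrightarrow> x i = y i" for x y
      using window[OF that] by (simp add: e_def)
  qed
  define k where "k = e (\<lambda>_. 0)"
  have "f x = translate (- k) x" if x: "x \<in> sequences n" for x
  proof
    fix j
    have "f (translate (j - k) x) k = translate (j - k) x 0"
      using fe[of "translate (j - k) x"] const[OF _ zero_in_sequences, of "translate (j - k) x"] x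
      by (simp add: k_def)
    then show "f x j = translate (- k) x j"
      using block_code_translate[OF code x, of "j - k"] by simp
  qed
  then show ?thesis by blast
qed

subsection \<open>The block code of a synchronizing transducer\<close>

locale synchronizing_transducer =
  fixes n :: nat and T :: "'q transducer" and k :: nat and q0 :: 'q
  assumes n2: "2 \<le> n" and productive: "productive n T" and fin: "finite (states T)"
    and q0: "q0 \<in> states T" and connected: "strongly_connected n T"
    and sync: "sync_level n T k" and loops: "length_preserving_loops n T"
begin

definition Q :: "(int \<Rightarrow> nat) \<Rightarrow> 'q" where
  "Q x = next_state_word T (prefix k (future (translate (- int k) x))) q0"

lemma Q_eq:
  assumes "x \<in> sequences n" "q \<in> states T"
  shows "next_state_word T (prefix k (future (translate (- int k) x))) q = Q x"
proof -
  have "prefix k (future (translate (- int k) x)) \<in> words n"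
    "length (prefix k (future (translate (- int k) x))) = k"
    using assms(1) by simp_all
  then show ?thesis unfolding Q_def using sync q0 assms(2) unfolding sync_level_def by blast
qed

lemma Q_mem: "x \<in> sequences n \<Longrightarrow> Q x \<in> states T"
  unfolding Q_def by (intro productive_words(1)[OF productive _ q0]) simp

lemma Q_next:
  assumes x: "x \<in> sequences n"
  shows "next_state T (x 0) (Q x) = Q (translate 1 x)"
proof -
  define u where "u = future (translate (- int k) x)"
  have u: "u \<in> sequences n" using x by (simp add: u_def)
  have "next_state T (x 0) (Q x) = next_state_word T (prefix (Suc k) u) q0"
    by (simp add: Q_def next_state_word_append u_def)
  also have "prefix (Suc k) u = [u 0] @ prefix k (suffix 1 u)"
    using subsequence_append[of u 1 k] by simp
  also have "next_state_word T \<dots> q0 = next_state_word T (prefix k (suffix 1 u)) (next_state T (u 0) q0)"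
    by simp
  also have "suffix 1 u = future (translate (- int k) (translate 1 x))"
    unfolding u_def suffix_future by (simp add: add.commute)
  also have "next_state_word T (prefix k (future (translate (- int k) (translate 1 x)))) (next_state T (u 0) q0) =
      Q (translate 1 x)"
    using x u by (intro Q_eq productive_next[OF productive q0]) (simp_all add: mem_sequences)
  finally show ?thesis .
qed

lemma Q_word:
  "x \<in> sequences n \<Longrightarrow> next_state_word T (prefix m (future x)) (Q x) = Q (translate (int m) x)"
proof (induction m)
  case (Suc m)
  have t: "translate (int (Suc m)) x = translate 1 (translate (int m) x)" by simp
  have p: "prefix (Suc m) (future x) = prefix m (future x) @ [x (int m)]" by simp
  have "next_state_word T (prefix (Suc m) (future x)) (Q x) =
      next_state T (translate (int m) x 0) (Q (translate (int m) x))"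
    unfolding p next_state_word_append Suc.IH[OF Suc.prems] by simp
  also have "\<dots> = Q (translate 1 (translate (int m) x))"
    by (rule Q_next) (simp only: translate_in_sequences Suc.prems)
  finally show ?case unfolding t .
qed simp

lemma Q_window:
  assumes "\<And>i. - int k \<le> i \<Longrightarrow> i < 0 \<Longrightarrow> x i = y i"
  shows "Q x = Q y"
proof -
  have "prefix k (future (translate (- int k) x)) = prefix k (future (translate (- int k) y))"
    unfolding prefix_eq_iff by (auto intro: assms)
  then show ?thesis by (simp add: Q_def)
qed

text \<open>By strong connectedness every state lies on a loop, and the last \<open>k\<close>
  letters of a repeated loop force it.\<close>

lemma states_eq: "states T = Q ` sequences n"
proof (intro equalityI subsetI)
  fix s assume s: "s \<in> states T"
  have a: "next_state T 0 s \<in> states T" using productive_next[OF productive s, of 0] n2 by simp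
  obtain w where w: "w \<in> words n" "next_state_word T w (next_state T 0 s) = s"
    using connected a s unfolding strongly_connected_def by blast
  \<comment> \<open>The leading letter 0 guarantees a nonempty loop, so \<open>k\<close> repetitions
    have length at least \<open>k\<close>.\<close>
  define u where "u = 0 # w"
  have u: "u \<in> words n" "next_state_word T u s = s" using w n2 by (simp_all add: u_def)
  define U where "U = concat (replicate k u)"
  have U: "U \<in> words n" "next_state_word T U s = s" "k \<le> length U"
    using replicate_word[OF u(2), of k] replicate_in_words[OF u(1)]
    by (simp_all add: U_def length_concat_replicate u_def)
  define v v' where "v = take (length U - k) U" and "v' = drop (length U - k) U"
  have vv: "U = v @ v'" "v \<in> words n" "v' \<in> words n" "length v' = k"
    using U by (auto simp: v_def v'_def words_def dest: in_set_takeD in_set_dropD)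
  define x where "x = translate (int k) (glue (\<lambda>_. 0) (v' \<frown> (\<lambda>_. 0)))"
  have z: "(\<lambda>_. 0) \<in> (sequences n :: (int \<Rightarrow> nat) set)" "(\<lambda>_. 0) \<in> (sequences n :: nat word set)"
    using n2 by (simp_all add: mem_sequences)
  have x: "x \<in> sequences n" using z vv(3) by (simp add: x_def)
  have "prefix k (future (translate (- int k) x)) = v'"
    using vv(4) by (simp add: x_def)
  then have "Q x = next_state_word T v' (next_state_word T v s)"
    using Q_eq[OF x productive_words(1)[OF productive vv(2) s]] by simp
  also have "\<dots> = s" using U(2) unfolding vv(1) next_state_word_append .
  finally show "s \<in> Q ` sequences n" using x by blast
qed (auto intro: Q_mem)

text \<open>The potential given by the loop condition: output length minus input length along any
  word from \<open>q0\<close> to the state. It plays the part of the position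
  \<open>d\<close>.\<close>

definition height :: "'q \<Rightarrow> int" where
  "height q = (let w = (SOME w. w \<in> words n \<and> next_state_word T w q0 = q)
     in int (length (out_word T w q0)) - int (length w))"

text \<open>Closing two words with the same endpoint by a common return word turns them into loops.\<close>

lemma height_word:
  assumes w: "w \<in> words n"
  shows "height (next_state_word T w q0) = int (length (out_word T w q0)) - int (length w)"
proof -
  define q where "q = next_state_word T w q0"
  have q: "q \<in> states T" unfolding q_def by (rule productive_words(1)[OF productive w q0])
  obtain v where v: "v \<in> words n" "next_state_word T v q = q0"
    using connected q q0 unfolding strongly_connected_def by blast
  have loop: "int (length (out_word T u q0)) - int (length u) = int (length v) - int (length (out_word T v q))"
    if u: "u \<in> words n" "next_state_word T u q0 = q" for u
  proof -
    have "next_state_word T (u @ v) q0 = q0" using u v by (simp add: next_state_word_append)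
    moreover have "u @ v \<in> words n" using u v by simp
    ultimately have "length (out_word T (u @ v) q0) = length (u @ v)"
      using loops q0 unfolding length_preserving_loops_def by blast
    then show ?thesis using u by (simp add: out_word_append)
  qed
  define u where "u = (SOME w. w \<in> words n \<and> next_state_word T w q0 = q)"
  have "u \<in> words n \<and> next_state_word T u q0 = q"
    unfolding u_def by (rule someI[of _ w]) (simp add: w q_def)
  then have "int (length (out_word T u q0)) - int (length u) = int (length (out_word T w q0)) - int (length w)"
    using loop[of u] loop[OF w] by (simp add: q_def)
  then show ?thesis by (simp add: height_def u_def Let_def flip: q_def)
qed

lemma height_next:
  assumes q: "q \<in> states T" and w: "w \<in> words n"
  shows "height (next_state_word T w q) = height q + int (length (out_word T w q)) - int (length w)"
proof -
  obtain u where u: "u \<in> words n" "next_state_word T u q0 = q"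
    using connected q q0 unfolding strongly_connected_def by blast
  show ?thesis
    using height_word[OF u(1)] height_word[of "u @ w"] u w
    by (simp add: next_state_word_append out_word_append)
qed

definition B :: int where
  "B = Max ((\<lambda>q. \<bar>height q\<bar>) ` states T)"

lemma height_bound: "q \<in> states T \<Longrightarrow> \<bar>height q\<bar> \<le> B"
  unfolding B_def using fin by (intro Max_ge) auto

text \<open>The letter at \<open>j\<close> is taken from a run starting \<open>B\<close> places to
  its left. Relative to the start, the output begins at position \<open>height (Q y)\<close>, which
  is at most \<open>B\<close>, so \<open>B - height (Q y)\<close> is the index of the wanted
  letter.\<close>

definition code :: "(int \<Rightarrow> nat) \<Rightarrow> int \<Rightarrow> nat" where
  "code x j = (let y = translate (j - B) x in state_map T (Q y) (future y) (nat (B - height (Q y))))"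

lemma length_out_word:
  assumes x: "x \<in> sequences n"
  shows "int (length (out_word T (prefix m (future x)) (Q x))) =
    height (Q (translate (int m) x)) + int m - height (Q x)"
  using height_next[OF Q_mem[OF x], of "prefix m (future x)"] x by (simp add: Q_word)

lemma state_map_later:
  assumes x: "x \<in> sequences n"
  shows "state_map T (Q (translate (int m) x)) (future (translate (int m) x)) i =
    state_map T (Q x) (future x) (nat (height (Q (translate (int m) x)) + int m - height (Q x)) + i)"
proof -
  have "future x = prefix m (future x) \<frown> future (translate (int m) x)"
    using prefix_suffix[of "future x" m] by (simp only: suffix_future)
  then have "state_map T (Q x) (future x) =
      out_word T (prefix m (future x)) (Q x) \<frown> state_map T (Q (translate (int m) x)) (future (translate (int m) x))"
    using state_map_conc[OF productive Q_mem[OF x], of "prefix m (future x)" "future (translate (int m) x)"] x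
    by (simp add: Q_word)
  moreover have "nat (height (Q (translate (int m) x)) + int m - height (Q x)) =
      length (out_word T (prefix m (future x)) (Q x))"
    using length_out_word[OF x, of m] by simp
  ultimately show ?thesis by simp
qed

text \<open>Two runs along one point agree wherever both write; their indices differ by the length
  of the output of the earlier run up to the start of the later one. The case distinction says which
  run is the earlier.\<close>

lemma code_state_map:
  assumes x: "x \<in> sequences n"
  shows "code x (height (Q x) + int i) = state_map T (Q x) (future x) i"
proof -
  define j where "j = height (Q x) + int i"
  define y where "y = translate (j - B) x"
  have y: "y \<in> sequences n" using x by (simp add: y_def)
  have b: "\<bar>height (Q x)\<bar> \<le> B" "\<bar>height (Q y)\<bar> \<le> B"
    by (simp_all add: height_bound Q_mem x y)
  have "state_map T (Q y) (future y) (nat (B - height (Q y))) = state_map T (Q x) (future x) i"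
  proof (cases "j \<le> B")
    case True
    define m where "m = nat (B - j)"
    have m: "translate (int m) y = x" using True by (simp add: y_def m_def)
    have "state_map T (Q x) (future x) i =
        state_map T (Q y) (future y) (nat (height (Q x) + int m - height (Q y)) + i)"
      using state_map_later[OF y, of m i] unfolding m .
    also have "nat (height (Q x) + int m - height (Q y)) + i = nat (B - height (Q y))"
      using True b length_out_word[OF y, of m] unfolding m by (simp add: m_def j_def)
    finally show ?thesis ..
  next
    case False
    define m where "m = nat (j - B)"
    have m: "translate (int m) x = y" using False by (simp add: y_def m_def)
    have "state_map T (Q y) (future y) (nat (B - height (Q y))) = state_map T (Q x) (future x)
        (nat (height (Q y) + int m - height (Q x)) + nat (B - height (Q y)))"
      using state_map_later[OF x, of m] unfolding m .
    also have "nat (height (Q y) + int m - height (Q x)) + nat (B - height (Q y)) = i"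
      using False b length_out_word[OF x, of m] unfolding m by (simp add: m_def j_def)
    finally show ?thesis .
  qed
  then show ?thesis by (simp add: code_def Let_def y_def j_def)
qed

lemma B_nonneg: "0 \<le> B"
  using height_bound[OF q0] by linarith

lemma block_code: "block_code n (4 * B + int k + 1) code"
proof (rule block_codeI)
  show "0 \<le> 4 * B + int k + 1" using B_nonneg by simp
  fix x :: "int \<Rightarrow> nat" assume x: "x \<in> sequences n"
  show "code x \<in> sequences n"
    unfolding mem_sequences
  proof
    fix j
    have "state_map T (Q (translate (j - B) x)) (future (translate (j - B) x)) \<in> sequences n"
      using x by (intro state_map_in_sequences[OF productive Q_mem]) simp_all
    then show "code x j < n" by (simp add: code_def Let_def mem_sequences)
  qed
  show "code (translate j x) = translate j (code x)" for j
    by (rule ext) (simp add: code_def Let_def algebra_simps)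
  fix y :: "int \<Rightarrow> nat" assume y: "y \<in> sequences n"
    and eq: "\<And>i. \<bar>i\<bar> \<le> 4 * B + int k + 1 \<Longrightarrow> x i = y i"
  define x' y' where "x' = translate (- B) x" and "y' = translate (- B) y"
  have x': "x' \<in> sequences n" "y' \<in> sequences n" using x y by (simp_all add: x'_def y'_def)
  have eq': "x' i = y' i" if "- int k \<le> i" "i \<le> 4 * B + 1" for i
    unfolding x'_def y'_def translate_apply using that B_nonneg by (intro eq) simp
  have Q: "Q x' = Q y'" using B_nonneg by (intro Q_window eq') simp_all
  \<comment> \<open>Reading \<open>4 * B + 1\<close> letters yields at least
    \<open>2 * B + 1\<close> letters of output, and the index in \<open>code\<close> is at most
    \<open>2 * B\<close>.\<close>
  define m where "m = nat (4 * B + 1)"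
  have m: "int m = 4 * B + 1" using B_nonneg by (simp add: m_def)
  have p: "prefix m (future x') = prefix m (future y')"
    unfolding prefix_eq_iff using m by (auto intro!: eq')
  have "\<bar>height (Q x')\<bar> \<le> B" "\<bar>height (Q (translate (int m) x'))\<bar> \<le> B"
    using x' by (simp_all add: height_bound Q_mem)
  then have l: "nat (B - height (Q x')) < length (out_word T (prefix m (future x')) (Q x'))"
    using length_out_word[OF x'(1), of m] m by linarith
  have "state_map T (Q x') (future x') (nat (B - height (Q x'))) =
      state_map T (Q y') (future y') (nat (B - height (Q y')))"
    using state_map_nth[OF l] state_map_nth[of _ T "future y'" m "Q y'"] l unfolding p Q by simp
  then show "code x 0 = code y 0" by (simp add: code_def Let_def x'_def y'_def)
qed

lemma tracking: "tracking n T Q (\<lambda>x. height (Q x)) code (4 * B + int k + 1) (int k) B"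
proof
  fix x :: "int \<Rightarrow> nat" assume x: "x \<in> sequences n"
  have p1: "prefix 1 (future x) = [x 0]" by simp
  show "height (Q (translate 1 x)) + 1 = height (Q x) + int (length (out T (x 0) (Q x)))"
    using length_out_word[OF x, of 1] unfolding p1 by simp
  show "out T (x 0) (Q x) ! i = code x (height (Q x) + int i)" if "i < length (out T (x 0) (Q x))" for i
    using state_map_nth[of i T "future x" 1 "Q x"] that unfolding p1 code_state_map[OF x] by simp
  show "\<bar>height (Q x)\<bar> \<le> B" by (rule height_bound[OF Q_mem[OF x]])
  show "Q x = Q y \<and> height (Q x) = height (Q y)"
    if "y \<in> sequences n" "\<And>i. - int k \<le> i \<Longrightarrow> i < 0 \<Longrightarrow> x i = y i" for y
    using Q_window[OF that(2)] by simp
qed (simp_all add: n2 states_eq Q_next block_code)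

end

lemma exists_tracking:
  assumes n: "2 \<le> n" and M: "in_M n T" and T: "responsive n T" "strongly_connected n T"
    "length_preserving_loops n T"
  shows "\<exists>Q d f r K B. tracking n T Q d f r K B"
proof -
  obtain k where k: "sync_level n T k" using M unfolding in_M_def strongly_synchronizing_def by blast
  have fin: "finite (states T)" "states T \<noteq> {}" using M unfolding in_M_def is_transducer_def by blast+
  then obtain q where q: "q \<in> states T" by blast
  interpret synchronizing_transducer n T k q
    by unfold_locales (fact n responsive_productive[OF T(1)] fin(1) q T(2,3) k)+
  show ?thesis using tracking by blast
qed

text \<open>The product is a union over pairs of representatives, so a member of the identity class
  already comes from one pair.\<close>

lemma M_mult_one:
  assumes n: "2 \<le> n" and X: "X \<otimes>\<^bsub>M_monoid n\<^esub> Y = \<one>\<^bsub>M_monoid n\<^esub>"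
  obtains T U where "T \<in> X" "U \<in> Y"
    "transducer_eq n (reduction n (core n (transducer_prod T U))) identity_transducer"
proof -
  obtain V :: "nat transducer" where V: "V \<in> represented_class n (\<lambda>x. x)"
    using represented_class_nonempty[OF invertible_code_id n] by (auto simp: represented_class_def)
  have "V \<in> X \<otimes>\<^bsub>M_monoid n\<^esub> Y" using V unfolding X M_one[OF n] .
  then obtain T U where TU: "T \<in> X" "U \<in> Y"
      "V \<in> transducer_class n (reduction n (core n (transducer_prod T U)))"
    by (auto simp: M_monoid_def)
  have "V \<in> transducer_class n identity_transducer"
    using V transducer_class_represents[OF represents_identity[OF n]] by simp
  then have "transducer_eq n (reduction n (core n (transducer_prod T U))) identity_transducer"
    using TU(3) transducer_eq_trans transducer_eq_sym unfolding transducer_class_def by blast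
  with TU show ?thesis using that by blast
qed

text \<open>A unit and its inverse both satisfy the loop condition and so track codes
  \<open>f\<close> and \<open>g\<close>. Both products reduce to the identity, so \<open>g\<close>
  after \<open>f\<close> and \<open>f\<close> after \<open>g\<close> are powers of the shift, and
  correcting \<open>g\<close> by one of them inverts \<open>f\<close>.\<close>

theorem L_group_represented:
  assumes n: "2 \<le> n" and A: "A \<in> carrier (L_group n)"
  obtains r f g where "invertible_code n r f g" "A = represented_class n f"
proof -
  have "A \<in> O_units n" and AL: "A \<in> L_tilde n" using A by (auto simp: L_group_def)
  then obtain A' where AO: "A \<in> O_tilde n" and A'O: "A' \<in> O_tilde n"
    and AA': "A \<otimes>\<^bsub>M_monoid n\<^esub> A' = \<one>\<^bsub>M_monoid n\<^esub>" and A'A: "A' \<otimes>\<^bsub>M_monoid n\<^esub> A = \<one>\<^bsub>M_monoid n\<^esub>"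
    unfolding O_units_def Units_def by auto
  obtain T U where TU: "T \<in> A" "U \<in> A'"
      "transducer_eq n (reduction n (core n (transducer_prod T U))) identity_transducer"
    by (rule M_mult_one[OF n AA'])
  \<comment> \<open>The two orders of the product may supply different representatives, which agree
    only up to \<open>transducer_eq\<close>.\<close>
  obtain U' T' where UT: "U' \<in> A'" "T' \<in> A"
      "transducer_eq n (reduction n (core n (transducer_prod U' T'))) identity_transducer"
    by (rule M_mult_one[OF n A'A])
  note T = O_tilde_representative[OF AO TU(1) n] and T' = O_tilde_representative[OF AO UT(2) n]
    and U = O_tilde_representative[OF A'O TU(2) n] and U' = O_tilde_representative[OF A'O UT(1) n]
  have TT': "transducer_eq n T T'" using class_members_eq TU(1) UT(2) unfolding T(5) by blast
  have UU': "transducer_eq n U U'" using class_members_eq TU(2) UT(1) unfolding U(5) by blast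
  obtain T0 :: "nat transducer" where T0: "in_M n T0" "A = transducer_class n T0" "length_preserving_loops n T0"
    using AL unfolding L_tilde_def length_preserving_loops_def by blast
  have "transducer_eq n T0 T0"
    unfolding transducer_eq_def by (rule exI[of _ id]) (simp add: omega_equivalent_refl)
  then have T0A: "T0 \<in> A" using T0(1) unfolding T0(2) transducer_class_def by simp
  note T0' = O_tilde_representative[OF AO T0A n]
  have loops: "length_preserving_loops n V" if "V \<in> A" for V
    using length_preserving_loops_transfer[OF T0'(2,3) T0(3)
        O_tilde_representative(2)[OF AO that n]] class_members_eq that T0A unfolding T0(2) by blast
  note C = reduces_to_identity[OF productive_prod[OF responsive_productive[OF T(2)]
        responsive_productive[OF U(2)]] n TU(3)]
    and C' = reduces_to_identity[OF productive_prod[OF responsive_productive[OF U'(2)]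
        responsive_productive[OF T'(2)]] n UT(3)]
  have loopsU': "length_preserving_loops n U'"
    by (rule length_preserving_loops_left[OF n responsive_productive[OF U'(2)]
          responsive_productive[OF T'(2)] C' loops[OF UT(2)]])
  have loopsU: "length_preserving_loops n U"
    by (rule length_preserving_loops_transfer[OF U'(2,3) loopsU' U(2) transducer_eq_sym[OF UU']])
  obtain Q d f r K B where t: "tracking n T Q d f r K B"
    using exists_tracking[OF n T(1,2,4) loops[OF TU(1)]] by blast
  obtain P e g s L D where u: "tracking n U P e g s L D"
    using exists_tracking[OF n U(1,2,4) loopsU] by blast
  have rT: "represents n T f" and rU: "represents n U g"
    using t u T U unfolding represents_def by blast+
  have rT': "represents n T' f" by (rule represents_transfer[OF rT TT' T'(2,3)])
  have rU': "represents n U' g" by (rule represents_transfer[OF rU UU' U'(2,3)])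
  obtain Q' d' r' K' B' where t': "tracking n T' Q' d' f r' K' B'"
    using rT' unfolding represents_def by blast
  obtain P' e' s' L' D' where u': "tracking n U' P' e' g s' L' D'"
    using rU' unfolding represents_def by blast
  obtain k where k: "\<And>x. x \<in> sequences n \<Longrightarrow> g (f x) = translate k x"
    using tracking_prefixing[OF tracking_prod[OF t u] C(1)] by blast
  obtain l where l: "\<And>x. x \<in> sequences n \<Longrightarrow> f (g x) = translate l x"
    using tracking_prefixing[OF tracking_prod[OF u' t'] C'(1)] by blast
  have fb: "block_code n r f" and gb: "block_code n s g"
    using t u by (auto simp: tracking_def)
  define g' where "g' = (\<lambda>x. translate (- k) (g x))"
  have gb': "block_code n (s + \<bar>- k\<bar>) g'"
    unfolding g'_def by (rule block_code_comp[OF gb block_code_translation])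
  have g'f: "g' (f x) = x" if "x \<in> sequences n" for x using k[OF that] by (simp add: g'_def)
  have fg': "f (g' x) = x" if x: "x \<in> sequences n" for x
  proof -
    \<comment> \<open>A point with \<open>f y = x\<close>; since \<open>g'\<close> is a left
      inverse, \<open>g' x = y\<close>.\<close>
    define y where "y = g (translate (- l) x)"
    have y: "y \<in> sequences n" unfolding y_def using x by (intro block_code_mem[OF gb]) simp
    have "f y = x" using l[of "translate (- l) x"] x by (simp add: y_def)
    then show ?thesis using g'f[OF y] by simp
  qed
  have "invertible_code n (max r (s + \<bar>- k\<bar>)) f g'"
    unfolding invertible_code_def using block_code_mono[OF fb] block_code_mono[OF gb'] g'f fg' by simp
  moreover have "A = represented_class n f"
    unfolding T(5) by (rule transducer_class_represents[OF rT])
  ultimately show ?thesis by (rule that)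
qed

section \<open>The isomorphism\<close>

lemma invertible_code_inv_into:
  assumes f: "invertible_code n r f g"
  shows "x \<in> sequences n \<Longrightarrow> inv_into (sequences n) f x = g x"
    and "invertible_code n r (inv_into (sequences n) f) f"
proof -
  note F = invertible_codeD[OF f]
  show eq: "inv_into (sequences n) f x = g x" if x: "x \<in> sequences n" for x
    using inv_into_f_f[OF invertible_code_inj[OF f] F(7)[OF x]] F(5)[OF x] by simp
  show "invertible_code n r (inv_into (sequences n) f) f"
    by (rule invertible_code_cong[OF invertible_code_sym[OF f] eq])
qed

lemma represented_class_translate:
  assumes f: "invertible_code n r f g" and n: "2 \<le> n"
  shows "represented_class n (\<lambda>x. translate k (f x)) = represented_class n f"
proof -
  obtain V :: "nat transducer" where V: "represents n V f" "represented_class n f = transducer_class n V"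
    by (rule represented_class_nonempty[OF assms])
  show ?thesis
    unfolding V(2) by (rule transducer_class_represents[OF represents_translate[OF V(1)], symmetric])
qed

lemma represented_class_eqD:
  assumes f: "invertible_code n r f f'" and n: "2 \<le> n"
    and eq: "represented_class n f = represented_class n g"
  obtains k where "\<And>x. x \<in> sequences n \<Longrightarrow> g x = translate k (f x)"
proof -
  obtain V :: "nat transducer" where V: "represents n V f" "represented_class n f = transducer_class n V"
    by (rule represented_class_nonempty[OF f n])
  have "represents n V g" using V(1) eq by (auto simp: represented_class_def)
  from represents_same_transducer[OF V(1) this] show ?thesis using that by metis
qed

theorem nonpower_iso:
  assumes n: "2 \<le> n" and np: "\<not> power_of_smaller n"
  shows "shift_Aut n \<cong> integer_group \<times>\<times> L_group n"
proof -
  let ?X = "sequences n :: (int \<Rightarrow> nat) set" and ?A = "carrier (shift_Aut n)"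
  obtain D where D_comp: "\<And>r f f' s g g'. invertible_code n r f f' \<Longrightarrow> invertible_code n s g g' \<Longrightarrow>
      D (\<lambda>x. g (f x)) = D f + (D g :: int)"
    and D_shift: "D (translate (- 1)) = 1"
    and D_cong: "\<And>r f f' g. invertible_code n r f f' \<Longrightarrow> (\<And>x. x \<in> ?X \<Longrightarrow> f x = g x) \<Longrightarrow> D f = D g"
    by (rule integer_valued_hom[OF n np]) blast
  have D_add: "D (translate (i + j)) = D (translate i) + D (translate j)" for i j
  proof -
    have "(\<lambda>x. translate j (translate i x)) = (translate (i + j) :: (int \<Rightarrow> nat) \<Rightarrow> _)"
      by (rule ext) (simp add: add.commute)
    then show ?thesis
      using D_comp[OF invertible_code_translate[of n i] invertible_code_translate[of n j]] by simp
  qed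
  have D_0: "D (translate 0) = 0" using D_add[of 0 0] by simp
  have D_1: "D (translate 1) = - 1" using D_add[of 1 "- 1"] D_0 D_shift by simp
  have D_translate: "D (translate j) = - j" for j
  proof (induction j rule: int_induct[where k = 0])
    case (step1 i)
    then show ?case using D_add[of i 1] D_1 by linarith
  next
    case (step2 i)
    have "D (translate i) = D (translate (i - 1)) + D (translate 1)"
      using D_add[of "i - 1" 1] by (simp only: diff_add_cancel)
    then show ?case using step2 D_1 by linarith
  qed (simp only: D_0 minus_zero)
  \<comment> \<open>A product of transducers applies its left factor first, hence the inverse.\<close>
  define H where "H = (\<lambda>f. (D f, represented_class n (inv_into ?X f)))"
  have A: "\<exists>r g. invertible_code n r f g" "f \<in> extensional ?X" if "f \<in> ?A" for f
    using that unfolding mem_shift_Aut_iff by blast+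
  have "H \<in> hom (shift_Aut n) (integer_group \<times>\<times> L_group n)"
  proof (rule homI)
    fix f assume "f \<in> ?A"
    then obtain r f' where f: "invertible_code n r f f'" using A by blast
    show "H f \<in> carrier (integer_group \<times>\<times> L_group n)"
      using represented_class_L_group[OF invertible_code_inv_into(2)[OF f] n]
      by (simp add: H_def DirProd_def)
  next
    fix f g assume fA: "f \<in> ?A" and gA: "g \<in> ?A"
    obtain r f' where f: "invertible_code n r f f'" using A fA by blast
    obtain s g' where g: "invertible_code n s g g'" using A gA by blast
    note fg = invertible_code_comp[OF g f]
    have m: "f \<otimes>\<^bsub>shift_Aut n\<^esub> g = restrict (\<lambda>x. f (g x)) ?X" by (rule shift_Aut_mult[OF fA gA])
    have m': "invertible_code n (s + r) (f \<otimes>\<^bsub>shift_Aut n\<^esub> g) (\<lambda>x. g' (f' x))"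
      unfolding m by (rule invertible_code_cong[OF fg]) simp
    have "D (f \<otimes>\<^bsub>shift_Aut n\<^esub> g) = D (\<lambda>x. f (g x))"
      by (rule D_cong[OF m']) (simp add: m)
    then have "D (f \<otimes>\<^bsub>shift_Aut n\<^esub> g) = D f + D g"
      using D_comp[OF g f] by simp
    moreover have "represented_class n (inv_into ?X (f \<otimes>\<^bsub>shift_Aut n\<^esub> g)) =
        represented_class n (inv_into ?X f) \<otimes>\<^bsub>M_monoid n\<^esub> represented_class n (inv_into ?X g)"
      unfolding M_mult_represented[OF invertible_code_inv_into(2)[OF f] invertible_code_inv_into(2)[OF g] n]
    proof (rule represented_class_cong)
      fix x :: "int \<Rightarrow> nat" assume x: "x \<in> ?X"
      show "inv_into ?X (f \<otimes>\<^bsub>shift_Aut n\<^esub> g) x = inv_into ?X g (inv_into ?X f x)"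
        using x invertible_codeD(7)[OF f x]
        by (simp add: invertible_code_inv_into(1)[OF m'] invertible_code_inv_into(1)[OF f]
            invertible_code_inv_into(1)[OF g])
    qed
    ultimately show "H (f \<otimes>\<^bsub>shift_Aut n\<^esub> g) = H f \<otimes>\<^bsub>integer_group \<times>\<times> L_group n\<^esub> H g"
      by (simp add: H_def DirProd_def L_group_def)
  qed
  moreover have "inj_on H ?A"
  proof (rule inj_onI)
    fix f g assume fA: "f \<in> ?A" and gA: "g \<in> ?A" and eq: "H f = H g"
    obtain r f' where f: "invertible_code n r f f'" using A fA by blast
    obtain s g' where g: "invertible_code n s g g'" using A gA by blast
    obtain k where k: "\<And>x. x \<in> ?X \<Longrightarrow> inv_into ?X g x = translate k (inv_into ?X f x)"
      using represented_class_eqD[OF invertible_code_inv_into(2)[OF f] n, of "inv_into ?X g"] eq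
      by (auto simp: H_def)
    \<comment> \<open>Equal classes leave only a power of the shift between the inverses, hence
      between \<open>f\<close> and \<open>g\<close>; equality of \<open>D\<close> will make this
      power trivial.\<close>
    have gf: "translate (- k) (f x) = g x" if x: "x \<in> ?X" for x
    proof -
      have gx: "g x \<in> ?X" by (rule invertible_codeD(6)[OF g x])
      have "x = translate k (f' (g x))"
        using k[OF gx] invertible_codeD(4)[OF g x]
        by (simp add: invertible_code_inv_into(1)[OF f gx] invertible_code_inv_into(1)[OF g gx])
      then have "f x = translate k (f (f' (g x)))"
        using block_code_translate[OF invertible_codeD(1)[OF f] invertible_codeD(7)[OF f gx], of k] by simp
      then show ?thesis by (simp add: invertible_codeD(5)[OF f gx])
    qed
    have "D g = D (\<lambda>x. translate (- k) (f x))"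
      by (rule D_cong[OF invertible_code_comp[OF f invertible_code_translate] gf, symmetric])
    also have "\<dots> = D f + k"
      using D_comp[OF f invertible_code_translate[of n "- k"]] D_translate[of "- k"] by simp
    finally have "k = 0" using eq by (simp add: H_def)
    then have "f x = g x" if "x \<in> ?X" for x using gf[OF that] by simp
    then show "f = g" by (rule extensionalityI[OF A(2)[OF fA] A(2)[OF gA]])
  qed
  moreover have "carrier (integer_group \<times>\<times> L_group n) \<subseteq> H ` ?A"
  proof
    fix z assume "z \<in> carrier (integer_group \<times>\<times> L_group n)"
    then obtain m Y where z: "z = (m, Y)" "Y \<in> carrier (L_group n)" by (auto simp: DirProd_def)
    obtain r f g where f: "invertible_code n r f g" and Y: "Y = represented_class n f"
      by (rule L_group_represented[OF n z(2)])
    note g = invertible_code_sym[OF f]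
    \<comment> \<open>A power of the shift does not change the class but adjusts \<open>D\<close>:
      \<open>translate j\<close> contributes \<open>- j\<close>.\<close>
    define j where "j = D g - m"
    define h where "h = restrict (\<lambda>x. translate j (g x)) ?X"
    note c = invertible_code_comp[OF g invertible_code_translate[of n j]]
    have h: "invertible_code n (r + \<bar>j\<bar>) h (\<lambda>x. f (translate (- j) x))"
      unfolding h_def by (rule invertible_code_cong[OF c]) simp
    have hA: "h \<in> ?A" unfolding h_def by (rule restrict_mem_shift_Aut[OF c])
    have "D h = D (\<lambda>x. translate j (g x))" by (rule D_cong[OF h]) (simp add: h_def)
    also have "\<dots> = D g - j" using D_comp[OF g invertible_code_translate[of n j]] D_translate[of j] by simp
    finally have "D h = m" by (simp add: j_def)
    moreover have "represented_class n (inv_into ?X h) = represented_class n (\<lambda>x. translate (- j) (f x))"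
      by (rule represented_class_cong)
        (simp add: invertible_code_inv_into(1)[OF h] block_code_translate[OF invertible_codeD(1)[OF f]])
    then have "represented_class n (inv_into ?X h) = Y"
      unfolding Y represented_class_translate[OF f n] .
    ultimately have "H h = z" by (simp add: H_def z(1))
    then show "z \<in> H ` ?A" using hA by blast
  qed
  ultimately have "H \<in> iso (shift_Aut n) (integer_group \<times>\<times> L_group n)"
    unfolding iso_def bij_betw_def using hom_carrier by blast
  then show ?thesis unfolding is_iso_def by blast
qed

theorem theorem1p2:
  fixes n :: nat
  assumes "n \<ge> 2"
  shows "shift_Aut n \<cong> integer_group \<times>\<times> L_group n \<longleftrightarrow> \<not> power_of_smaller n"
proof
  assume iso: "shift_Aut n \<cong> integer_group \<times>\<times> L_group n"
  show "\<not> power_of_smaller n"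
  proof
    assume "power_of_smaller n"
    then obtain m k where mk: "1 \<le> m" "m < n" "2 \<le> k" "n = m ^ k"
      unfolding power_of_smaller_def by blast
    have "m \<noteq> 1" using mk by auto
    with mk(1) have "2 \<le> m" by simp
    from power_not_iso[OF this mk(3,4)] iso show False by blast
  qed
next
  assume "\<not> power_of_smaller n"
  with assms show "shift_Aut n \<cong> integer_group \<times>\<times> L_group n" by (rule nonpower_iso)
qed

end
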